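(* Let $\Gamma$ be a groupoid and let $R$ be a $\Gamma$-graded ring. Write $J:=\mathrm{rad}^{\mathrm{gr}}(R)$. The following assertions are equivalent: (1) $R$ is a right $\Gamma_0$-artinian and a right $\Gamma_0$-noetherian ring. (2) $R$ is a right $\Gamma_0$-artinian ring and $J$ is $\Gamma_0$-finitely generated as a right ideal. (3) $R$ is a right $\Gamma_0$-artinian ring and $J^k$ is $\Gamma_0$-finitely generated as a right ideal for some positive integer $k$. (4) $R$ is a right $\Gamma_0$-artinian ring and $J$ is right objectwise nilpotent. (5) $R$ is a right $\Gamma_0$-artinian ring and $J^\infty=\{0\}$, where $J^\infty:=\bigcap_{n\ge 1}J^n$. (6) $R$ is a right $\Gamma_0$-artinian ring and $\mathrm{soc}_{\mathrm{gr}}^\infty(R_R)=R$. (7) $R$ is a gr-semilocal right $\Gamma_0$-noetherian ring and $J$ is right objectwise nilpotent.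
   Context: A groupoid $\Gamma$ is the set of morphisms of a small category in which all morphisms are invertible; $\Gamma_0\subseteq\Gamma$ is the set of identity morphisms; $d(\gamma)=\gamma^{-1}\gamma$, $r(\gamma)=\gamma\gamma^{-1}$; the product $\gamma\delta$ is defined iff $d(\gamma)=r(\delta)$. Rings are associative, not necessarily unital. A $\Gamma$-graded ring is a ring $R=\bigoplus_{\gamma\in\Gamma}R_\gamma$ (additive subgroups) with $R_\gamma R_\delta\subseteq R_{\gamma\delta}$ if $d(\gamma)=r(\delta)$ and $R_\gamma R_\delta=0$ otherwise; it is always assumed object unital: for each $e\in\Gamma_0$ the ring $R_e$ has an identity $1_e$ (possibly $0$) with $1_{r(\gamma)}a=a=a1_{d(\gamma)}$ for all $a\in R_\gamma$, $\gamma\in\Gamma$. A $\Gamma$-graded right $R$-module is a right $R$-module $M=\bigoplus_{\gamma}M_\gamma$ with $M_\sigma R_\tau\subseteq M_{\sigma\tau}$ if $d(\sigma)=r(\tau)$, $M_\sigma R_\tau=0$ otherwise, and $m1_{d(\sigma)}=m$ for $m\in M_\sigma$. A submodule (or one- or two-sided ideal) $N$ is graded if $N=\bigoplus_\gamma (N\cap M_\gamma)$. For $e\in\Gamma_0$, $M(e):=\bigoplus_{r(\gamma)=e}M_\gamma$, a graded submodule; $M=\bigoplus_{e\in\Gamma_0}M(e)$; for a graded right ideal $U$ of $R$, $U(e)=1_eU$. A graded module is gr-artinian (gr-noetherian) if it has no infinite strictly decreasing (increasing) chain of graded submodules. $M$ is $\Gamma_0$-artinian / $\Gamma_0$-noetherian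 / $\Gamma_0$-finitely generated if $M(e)$ is gr-artinian / gr-noetherian / finitely generated for every $e\in\Gamma_0$. $R$ is right $\Gamma_0$-artinian (noetherian) if $R_R$ is. $\mathrm{rad}^{\mathrm{gr}}(R)$, the graded Jacobson radical, is the intersection of all gr-maximal graded right ideals (those maximal among proper graded right ideals); it is a graded two-sided ideal. A nonzero graded module is gr-simple if its only graded submodules are $0$ and itself; a graded module is gr-semisimple if it is a sum of gr-simple graded submodules; a graded ring is gr-semisimple if it is so as a right module over itself; $R$ is gr-semilocal if the graded ring $R/\mathrm{rad}^{\mathrm{gr}}(R)$ is gr-semisimple. A graded ideal $U$ is right objectwise nilpotent if for each $e\in\Gamma_0$ there is a positive integer $n_e$ with $1_eU^{n_e}=0$. For a graded right module $M$: $\mathrm{soc}_{\mathrm{gr}}(M)$ is the sum of all gr-simple graded submodules ($0$ if none). Put $\mathrm{soc}^0_{\mathrm{gr}}(M)=0$ and let $\mathrm{soc}^{n+1}_{\mathrm{gr}}(M)\supseteq \mathrm{soc}^{n}_{\mathrm{gr}}(M)$ be the graded submodule with $\mathrm{soc}^{n+1}_{\mathrm{gr}}(M)/\mathrm{soc}^n_{\mathrm{gr}}(M)=\mathrm{soc}_{\mathrm{gr}}(M/\mathrm{soc}^n_{\mathrm{gr}}(M))$; $\mathrm{soc}^\infty_{\mathrm{gr}}(M)=\bigcup_{n\ge 0}\mathrm{soc}^n_{\mathrm{gr}}(M)$. *)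

theory Defs
  imports "HOL-Algebra.QuotRing" "HOL-Algebra.Ideal_Product"
begin

section \<open>Groupoids\<close>

text \<open>
  A groupoid is the set of morphisms of a small category with all morphisms invertible.
  The functions \<open>src\<close> and \<open>tgt\<close> send a morphism to the identity morphism at its domain and
  codomain.  By the axiom \<open>invertible\<close> they are \<open>d(\<gamma>) = \<gamma>\<inverse>\<gamma>\<close> and \<open>r(\<gamma>) = \<gamma>\<gamma>\<inverse>\<close>.
  The function \<open>comp\<close> is only meaningful on pairs with \<open>src \<gamma> = tgt \<delta>\<close>.
\<close>

record 'g groupoid = "'g partial_object" +
  src :: "'g \<Rightarrow> 'g"
  tgt :: "'g \<Rightarrow> 'g"
  comp :: "'g \<Rightarrow> 'g \<Rightarrow> 'g"

locale groupoid =
  fixes \<Gamma> :: "'g groupoid"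
  assumes src_closed: "\<gamma> \<in> carrier \<Gamma> \<Longrightarrow> src \<Gamma> \<gamma> \<in> carrier \<Gamma>"
    and tgt_closed: "\<gamma> \<in> carrier \<Gamma> \<Longrightarrow> tgt \<Gamma> \<gamma> \<in> carrier \<Gamma>"
    and src_src: "\<gamma> \<in> carrier \<Gamma> \<Longrightarrow> src \<Gamma> (src \<Gamma> \<gamma>) = src \<Gamma> \<gamma>"
    and tgt_src: "\<gamma> \<in> carrier \<Gamma> \<Longrightarrow> tgt \<Gamma> (src \<Gamma> \<gamma>) = src \<Gamma> \<gamma>"
    and src_tgt: "\<gamma> \<in> carrier \<Gamma> \<Longrightarrow> src \<Gamma> (tgt \<Gamma> \<gamma>) = tgt \<Gamma> \<gamma>"
    and tgt_tgt: "\<gamma> \<in> carrier \<Gamma> \<Longrightarrow> tgt \<Gamma> (tgt \<Gamma> \<gamma>) = tgt \<Gamma> \<gamma>"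
    and comp_closed:
      "\<lbrakk>\<gamma> \<in> carrier \<Gamma>; \<delta> \<in> carrier \<Gamma>; src \<Gamma> \<gamma> = tgt \<Gamma> \<delta>\<rbrakk> \<Longrightarrow> comp \<Gamma> \<gamma> \<delta> \<in> carrier \<Gamma>"
    and src_comp:
      "\<lbrakk>\<gamma> \<in> carrier \<Gamma>; \<delta> \<in> carrier \<Gamma>; src \<Gamma> \<gamma> = tgt \<Gamma> \<delta>\<rbrakk> \<Longrightarrow> src \<Gamma> (comp \<Gamma> \<gamma> \<delta>) = src \<Gamma> \<delta>"
    and tgt_comp:
      "\<lbrakk>\<gamma> \<in> carrier \<Gamma>; \<delta> \<in> carrier \<Gamma>; src \<Gamma> \<gamma> = tgt \<Gamma> \<delta>\<rbrakk> \<Longrightarrow> tgt \<Gamma> (comp \<Gamma> \<gamma> \<delta>) = tgt \<Gamma> \<gamma>"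
    and comp_assoc:
      "\<lbrakk>\<gamma> \<in> carrier \<Gamma>; \<delta> \<in> carrier \<Gamma>; \<epsilon> \<in> carrier \<Gamma>; src \<Gamma> \<gamma> = tgt \<Gamma> \<delta>; src \<Gamma> \<delta> = tgt \<Gamma> \<epsilon>\<rbrakk>
        \<Longrightarrow> comp \<Gamma> (comp \<Gamma> \<gamma> \<delta>) \<epsilon> = comp \<Gamma> \<gamma> (comp \<Gamma> \<delta> \<epsilon>)"
    and comp_tgt: "\<gamma> \<in> carrier \<Gamma> \<Longrightarrow> comp \<Gamma> (tgt \<Gamma> \<gamma>) \<gamma> = \<gamma>"
    and comp_src: "\<gamma> \<in> carrier \<Gamma> \<Longrightarrow> comp \<Gamma> \<gamma> (src \<Gamma> \<gamma>) = \<gamma>"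
    and invertible:
      "\<gamma> \<in> carrier \<Gamma> \<Longrightarrow> \<exists>\<delta>\<in>carrier \<Gamma>. src \<Gamma> \<delta> = tgt \<Gamma> \<gamma> \<and> tgt \<Gamma> \<delta> = src \<Gamma> \<gamma> \<and>
         comp \<Gamma> \<delta> \<gamma> = src \<Gamma> \<gamma> \<and> comp \<Gamma> \<gamma> \<delta> = tgt \<Gamma> \<gamma>"

definition identities :: "'g groupoid \<Rightarrow> 'g set" where
  "identities \<Gamma> = {e \<in> carrier \<Gamma>. src \<Gamma> e = e}"

section \<open>Sums of subgroups\<close>

definition family_sum :: "('a, 'z) ring_scheme \<Rightarrow> 'i set \<Rightarrow> ('i \<Rightarrow> 'a set) \<Rightarrow> 'a set" where
  "family_sum M I P =
     {finsum M f A | f A. finite A \<and> A \<subseteq> I \<and> (\<forall>i\<in>A. f i \<in> P i)}"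

definition is_direct_sum ::
  "('a, 'z) ring_scheme \<Rightarrow> 'i set \<Rightarrow> ('i \<Rightarrow> 'a set) \<Rightarrow> 'a set \<Rightarrow> bool" where
  "is_direct_sum M I P N \<longleftrightarrow>
     (\<forall>i\<in>I. additive_subgroup (P i) M) \<and>
     N = family_sum M I P \<and>
     (\<forall>f A. finite A \<and> A \<subseteq> I \<and> (\<forall>i\<in>A. f i \<in> P i) \<and> finsum M f A = \<zero>\<^bsub>M\<^esub>
        \<longrightarrow> (\<forall>i\<in>A. f i = \<zero>\<^bsub>M\<^esub>))"

section \<open>Graded rings\<close>

text \<open>
  Rings need not have an identity.  We reuse the record \<open>ring\<close> of HOL-Algebra (and
  with it \<open>abelian_group\<close>, \<open>finsum\<close>, cosets and quotients), but nothing is assumed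
  about its field \<open>one\<close>.
\<close>

record ('a, 'g) graded = "'a ring" +
  component :: "'g \<Rightarrow> 'a set"

definition loc_one :: "('r, 'g) graded \<Rightarrow> 'g \<Rightarrow> 'r" where
  "loc_one R e =
     (THE u. u \<in> component R e \<and> (\<forall>a\<in>component R e. u \<otimes>\<^bsub>R\<^esub> a = a \<and> a \<otimes>\<^bsub>R\<^esub> u = a))"

locale graded_ring = groupoid \<Gamma> + abelian_group R
  for \<Gamma> :: "'g groupoid" and R :: "('r, 'g) graded" (structure) +
  assumes mult_closed: "\<lbrakk>a \<in> carrier R; b \<in> carrier R\<rbrakk> \<Longrightarrow> a \<otimes> b \<in> carrier R"
    and mult_assoc:
      "\<lbrakk>a \<in> carrier R; b \<in> carrier R; c \<in> carrier R\<rbrakk> \<Longrightarrow> (a \<otimes> b) \<otimes> c = a \<otimes> (b \<otimes> c)"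
    and left_distrib:
      "\<lbrakk>a \<in> carrier R; b \<in> carrier R; c \<in> carrier R\<rbrakk> \<Longrightarrow> (a \<oplus> b) \<otimes> c = a \<otimes> c \<oplus> b \<otimes> c"
    and right_distrib:
      "\<lbrakk>a \<in> carrier R; b \<in> carrier R; c \<in> carrier R\<rbrakk> \<Longrightarrow> a \<otimes> (b \<oplus> c) = a \<otimes> b \<oplus> a \<otimes> c"
    and ring_decomposition: "is_direct_sum R (carrier \<Gamma>) (component R) (carrier R)"
    and component_mult:
      "\<lbrakk>\<gamma> \<in> carrier \<Gamma>; \<delta> \<in> carrier \<Gamma>; src \<Gamma> \<gamma> = tgt \<Gamma> \<delta>; a \<in> component R \<gamma>; b \<in> component R \<delta>\<rbrakk>
        \<Longrightarrow> a \<otimes> b \<in> component R (comp \<Gamma> \<gamma> \<delta>)"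
    and component_mult_zero:
      "\<lbrakk>\<gamma> \<in> carrier \<Gamma>; \<delta> \<in> carrier \<Gamma>; src \<Gamma> \<gamma> \<noteq> tgt \<Gamma> \<delta>; a \<in> component R \<gamma>; b \<in> component R \<delta>\<rbrakk>
        \<Longrightarrow> a \<otimes> b = \<zero>"
    and loc_one_exists:
      "e \<in> identities \<Gamma> \<Longrightarrow>
        \<exists>u\<in>component R e. \<forall>a\<in>component R e. u \<otimes> a = a \<and> a \<otimes> u = a"
    and loc_one_left:
      "\<lbrakk>\<gamma> \<in> carrier \<Gamma>; a \<in> component R \<gamma>\<rbrakk> \<Longrightarrow> loc_one R (tgt \<Gamma> \<gamma>) \<otimes> a = a"
    and loc_one_right:
      "\<lbrakk>\<gamma> \<in> carrier \<Gamma>; a \<in> component R \<gamma>\<rbrakk> \<Longrightarrow> a \<otimes> loc_one R (src \<Gamma> \<gamma>) = a"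

section \<open>Graded right modules\<close>

text \<open>
  As in HOL-Algebra, the module record extends the ring record; its fields \<open>mult\<close> and \<open>one\<close>
  are ignored.  \<open>act M m r\<close> is the right action \<open>m r\<close>.
\<close>

record ('m, 'g, 'r) graded_rmod = "('m, 'g) graded" +
  act :: "'m \<Rightarrow> 'r \<Rightarrow> 'm"

locale graded_rmodule = graded_ring \<Gamma> R + M: abelian_group M
  for \<Gamma> :: "'g groupoid" and R :: "('r, 'g) graded" (structure)
    and M :: "('m, 'g, 'r) graded_rmod" +
  assumes act_closed: "\<lbrakk>x \<in> carrier M; a \<in> carrier R\<rbrakk> \<Longrightarrow> act M x a \<in> carrier M"
    and act_assoc:
      "\<lbrakk>x \<in> carrier M; a \<in> carrier R; b \<in> carrier R\<rbrakk> \<Longrightarrow> act M (act M x a) b = act M x (a \<otimes> b)"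
    and act_add_left:
      "\<lbrakk>x \<in> carrier M; y \<in> carrier M; a \<in> carrier R\<rbrakk>
        \<Longrightarrow> act M (x \<oplus>\<^bsub>M\<^esub> y) a = act M x a \<oplus>\<^bsub>M\<^esub> act M y a"
    and act_add_right:
      "\<lbrakk>x \<in> carrier M; a \<in> carrier R; b \<in> carrier R\<rbrakk>
        \<Longrightarrow> act M x (a \<oplus> b) = act M x a \<oplus>\<^bsub>M\<^esub> act M x b"
    and module_decomposition: "is_direct_sum M (carrier \<Gamma>) (component M) (carrier M)"
    and component_act:
      "\<lbrakk>\<sigma> \<in> carrier \<Gamma>; \<tau> \<in> carrier \<Gamma>; src \<Gamma> \<sigma> = tgt \<Gamma> \<tau>; x \<in> component M \<sigma>; a \<in> component R \<tau>\<rbrakk>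
        \<Longrightarrow> act M x a \<in> component M (comp \<Gamma> \<sigma> \<tau>)"
    and component_act_zero:
      "\<lbrakk>\<sigma> \<in> carrier \<Gamma>; \<tau> \<in> carrier \<Gamma>; src \<Gamma> \<sigma> \<noteq> tgt \<Gamma> \<tau>; x \<in> component M \<sigma>; a \<in> component R \<tau>\<rbrakk>
        \<Longrightarrow> act M x a = \<zero>\<^bsub>M\<^esub>"
    and act_loc_one:
      "\<lbrakk>\<sigma> \<in> carrier \<Gamma>; x \<in> component M \<sigma>\<rbrakk> \<Longrightarrow> act M x (loc_one R (src \<Gamma> \<sigma>)) = x"

definition regular :: "('r, 'g) graded \<Rightarrow> ('r, 'g, 'r) graded_rmod" where
  "regular R = graded.extend R (graded_rmod.fields (mult R))"

definition rsubmodule :: "('r, 'g) graded \<Rightarrow> ('m, 'g, 'r) graded_rmod \<Rightarrow> 'm set \<Rightarrow> bool" where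
  "rsubmodule R M N \<longleftrightarrow>
     additive_subgroup N M \<and> (\<forall>x\<in>N. \<forall>a\<in>carrier R. act M x a \<in> N)"

definition graded_submodule ::
  "'g groupoid \<Rightarrow> ('r, 'g) graded \<Rightarrow> ('m, 'g, 'r) graded_rmod \<Rightarrow> 'm set \<Rightarrow> bool" where
  "graded_submodule \<Gamma> R M N \<longleftrightarrow>
     rsubmodule R M N \<and> is_direct_sum M (carrier \<Gamma>) (\<lambda>\<gamma>. N \<inter> component M \<gamma>) N"

definition submod :: "('m, 'g, 'r) graded_rmod \<Rightarrow> 'm set \<Rightarrow> ('m, 'g, 'r) graded_rmod" where
  "submod M N = M\<lparr>carrier := N, component := (\<lambda>\<gamma>. N \<inter> component M \<gamma>)\<rparr>"

definition graded_quot :: "('a, 'g, 'z) graded_scheme \<Rightarrow> 'a set \<Rightarrow> ('a set, 'g) graded" where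
  "graded_quot R I =
     ring.extend (R Quot I) (graded.fields (\<lambda>\<gamma>. (\<lambda>a. I +>\<^bsub>R\<^esub> a) ` component R \<gamma>))"

definition quot_rmod ::
  "('m, 'g, 'r) graded_rmod \<Rightarrow> 'm set \<Rightarrow> ('m set, 'g, 'r) graded_rmod" where
  "quot_rmod M N =
     graded.extend (graded_quot M N) (graded_rmod.fields (\<lambda>X a. \<Union>x\<in>X. N +>\<^bsub>M\<^esub> act M x a))"

text \<open>The graded submodule \<open>M(e)\<close>.\<close>

definition piece :: "'g groupoid \<Rightarrow> ('m, 'g, 'r) graded_rmod \<Rightarrow> 'g \<Rightarrow> 'm set" where
  "piece \<Gamma> M e = family_sum M {\<gamma> \<in> carrier \<Gamma>. tgt \<Gamma> \<gamma> = e} (component M)"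

section \<open>Finiteness conditions\<close>

definition gr_artinian ::
  "'g groupoid \<Rightarrow> ('r, 'g) graded \<Rightarrow> ('m, 'g, 'r) graded_rmod \<Rightarrow> bool" where
  "gr_artinian \<Gamma> R M \<longleftrightarrow>
     \<not> (\<exists>N :: nat \<Rightarrow> 'm set. \<forall>n. graded_submodule \<Gamma> R M (N n) \<and> N (Suc n) \<subset> N n)"

definition gr_noetherian ::
  "'g groupoid \<Rightarrow> ('r, 'g) graded \<Rightarrow> ('m, 'g, 'r) graded_rmod \<Rightarrow> bool" where
  "gr_noetherian \<Gamma> R M \<longleftrightarrow>
     \<not> (\<exists>N :: nat \<Rightarrow> 'm set. \<forall>n. graded_submodule \<Gamma> R M (N n) \<and> N n \<subset> N (Suc n))"

definition finitely_generated ::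
  "('r, 'g) graded \<Rightarrow> ('m, 'g, 'r) graded_rmod \<Rightarrow> bool" where
  "finitely_generated R M \<longleftrightarrow>
     (\<exists>X. finite X \<and> X \<subseteq> carrier M \<and> carrier M = \<Inter>{N. rsubmodule R M N \<and> X \<subseteq> N})"

definition obj_artinian ::
  "'g groupoid \<Rightarrow> ('r, 'g) graded \<Rightarrow> ('m, 'g, 'r) graded_rmod \<Rightarrow> bool" where
  "obj_artinian \<Gamma> R M \<longleftrightarrow> (\<forall>e\<in>identities \<Gamma>. gr_artinian \<Gamma> R (submod M (piece \<Gamma> M e)))"

definition obj_noetherian ::
  "'g groupoid \<Rightarrow> ('r, 'g) graded \<Rightarrow> ('m, 'g, 'r) graded_rmod \<Rightarrow> bool" where
  "obj_noetherian \<Gamma> R M \<longleftrightarrow> (\<forall>e\<in>identities \<Gamma>. gr_noetherian \<Gamma> R (submod M (piece \<Gamma> M e)))"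

definition obj_finitely_generated ::
  "'g groupoid \<Rightarrow> ('r, 'g) graded \<Rightarrow> ('m, 'g, 'r) graded_rmod \<Rightarrow> bool" where
  "obj_finitely_generated \<Gamma> R M \<longleftrightarrow>
     (\<forall>e\<in>identities \<Gamma>. finitely_generated R (submod M (piece \<Gamma> M e)))"

definition right_obj_artinian :: "'g groupoid \<Rightarrow> ('r, 'g) graded \<Rightarrow> bool" where
  "right_obj_artinian \<Gamma> R \<longleftrightarrow> obj_artinian \<Gamma> R (regular R)"

definition right_obj_noetherian :: "'g groupoid \<Rightarrow> ('r, 'g) graded \<Rightarrow> bool" where
  "right_obj_noetherian \<Gamma> R \<longleftrightarrow> obj_noetherian \<Gamma> R (regular R)"

section \<open>Radical, simplicity and socle\<close>

definition gr_maximal_right_ideal :: "'g groupoid \<Rightarrow> ('r, 'g) graded \<Rightarrow> 'r set \<Rightarrow> bool" where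
  "gr_maximal_right_ideal \<Gamma> R I \<longleftrightarrow>
     graded_submodule \<Gamma> R (regular R) I \<and> I \<noteq> carrier R \<and>
     (\<forall>K. graded_submodule \<Gamma> R (regular R) K \<and> I \<subseteq> K \<and> K \<noteq> carrier R \<longrightarrow> K = I)"

text \<open>The empty intersection is the whole ring; this only matters for the zero ring.\<close>

definition gr_rad :: "'g groupoid \<Rightarrow> ('r, 'g) graded \<Rightarrow> 'r set" where
  "gr_rad \<Gamma> R = carrier R \<inter> \<Inter>{I. gr_maximal_right_ideal \<Gamma> R I}"

definition gr_simple ::
  "'g groupoid \<Rightarrow> ('r, 'g) graded \<Rightarrow> ('m, 'g, 'r) graded_rmod \<Rightarrow> bool" where
  "gr_simple \<Gamma> R M \<longleftrightarrow>
     carrier M \<noteq> {\<zero>\<^bsub>M\<^esub>} \<and>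
     (\<forall>N. graded_submodule \<Gamma> R M N \<longrightarrow> N = {\<zero>\<^bsub>M\<^esub>} \<or> N = carrier M)"

definition gr_simple_submodules ::
  "'g groupoid \<Rightarrow> ('r, 'g) graded \<Rightarrow> ('m, 'g, 'r) graded_rmod \<Rightarrow> 'm set set" where
  "gr_simple_submodules \<Gamma> R M =
     {S. graded_submodule \<Gamma> R M S \<and> gr_simple \<Gamma> R (submod M S)}"

definition gr_semisimple ::
  "'g groupoid \<Rightarrow> ('r, 'g) graded \<Rightarrow> ('m, 'g, 'r) graded_rmod \<Rightarrow> bool" where
  "gr_semisimple \<Gamma> R M \<longleftrightarrow>
     (\<exists>\<S>. \<S> \<subseteq> gr_simple_submodules \<Gamma> R M \<and> carrier M = family_sum M \<S> (\<lambda>S. S))"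

definition gr_semisimple_ring :: "'g groupoid \<Rightarrow> ('r, 'g) graded \<Rightarrow> bool" where
  "gr_semisimple_ring \<Gamma> R \<longleftrightarrow> gr_semisimple \<Gamma> R (regular R)"

definition gr_semilocal :: "'g groupoid \<Rightarrow> ('r, 'g) graded \<Rightarrow> bool" where
  "gr_semilocal \<Gamma> R \<longleftrightarrow> gr_semisimple_ring \<Gamma> (graded_quot R (gr_rad \<Gamma> R))"

definition gr_soc ::
  "'g groupoid \<Rightarrow> ('r, 'g) graded \<Rightarrow> ('m, 'g, 'r) graded_rmod \<Rightarrow> 'm set" where
  "gr_soc \<Gamma> R M = family_sum M (gr_simple_submodules \<Gamma> R M) (\<lambda>S. S)"

text \<open>
  The submodule of \<open>M\<close> corresponding to the submodule \<open>soc(M / soc\<^sup>n(M))\<close> of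
  \<open>M / soc\<^sup>n(M)\<close> is the preimage of the latter under the canonical projection.
\<close>

primrec gr_soc_iter ::
  "'g groupoid \<Rightarrow> ('r, 'g) graded \<Rightarrow> ('m, 'g, 'r) graded_rmod \<Rightarrow> nat \<Rightarrow> 'm set" where
  "gr_soc_iter \<Gamma> R M 0 = {\<zero>\<^bsub>M\<^esub>}"
| "gr_soc_iter \<Gamma> R M (Suc n) =
     {x \<in> carrier M.
        gr_soc_iter \<Gamma> R M n +>\<^bsub>M\<^esub> x \<in> gr_soc \<Gamma> R (quot_rmod M (gr_soc_iter \<Gamma> R M n))}"

definition gr_soc_infinity ::
  "'g groupoid \<Rightarrow> ('r, 'g) graded \<Rightarrow> ('m, 'g, 'r) graded_rmod \<Rightarrow> 'm set" where
  "gr_soc_infinity \<Gamma> R M = (\<Union>n. gr_soc_iter \<Gamma> R M n)"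

section \<open>Powers of ideals and nilpotency\<close>

text \<open>
  Without an identity \<open>carrier R \<cdot> I\<close> can differ from \<open>I\<close>, so the recursion starts
  at exponent 1.  The value at exponent 0 is a convention and is never used.
\<close>

fun ideal_power :: "('r, 'g) graded \<Rightarrow> 'r set \<Rightarrow> nat \<Rightarrow> 'r set" where
  "ideal_power R I 0 = carrier R"
| "ideal_power R I (Suc 0) = I"
| "ideal_power R I (Suc (Suc n)) = ideal_prod R (ideal_power R I (Suc n)) I"

definition right_obj_nilpotent :: "'g groupoid \<Rightarrow> ('r, 'g) graded \<Rightarrow> 'r set \<Rightarrow> bool" where
  "right_obj_nilpotent \<Gamma> R U \<longleftrightarrow>
     (\<forall>e\<in>identities \<Gamma>. \<exists>n\<ge>1. (\<lambda>x. loc_one R e \<otimes>\<^bsub>R\<^esub> x) ` ideal_power R U n = {\<zero>\<^bsub>R\<^esub>})"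

section \<open>Equivalence of a list of assertions\<close>

definition all_equivalent :: "bool list \<Rightarrow> bool" where
  "all_equivalent Ps \<longleftrightarrow> (\<forall>P\<in>set Ps. \<forall>Q\<in>set Ps. P \<longleftrightarrow> Q)"

end

theory Submission
  imports Defs
begin

text \<open>
  The pivot is (4). A graded module annihilated by \<open>J\<close> is
  gr-semisimple as soon as \<open>R/J\<close> is, which holds for \<open>\<Gamma>\<^sub>0\<close>-artinian \<open>R\<close>. If moreover \<open>1\<^sub>e J\<^sup>n = 0\<close>,
  the chain \<open>R(e) \<supseteq> J(e) \<supseteq> J\<^sup>2(e) \<supseteq> \<dots> \<supseteq> 0\<close> has gr-semisimple layers; on such layers each chain
  condition forces finite length, so both chain conditions agree (Hopkins--Levitzki), and the
  chain lies inside the socle series. Conversely, in the artinian case \<open>J\<^sup>n(e)\<close> becomes stationary;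
  it vanishes by Nakayama's lemma if some power of \<open>J\<close> is \<open>\<Gamma>\<^sub>0\<close>-finitely generated, and trivially if
  \<open>J\<^sup>\<infinity> = 0\<close>. Finally \<open>J\<close> sends each step of the socle series into the previous one, so
  \<open>1\<^sub>e \<in> soc\<^sup>n\<close> gives \<open>1\<^sub>e J\<^sup>n = 0\<close>.
\<close>

text \<open>Every module that occurs is a subquotient of the right module R, so the argument stays
  inside the lattice of graded right ideals of R: B/A is the pair A \<subseteq> B, gr-simplicity of
  B/A is a covering relation, and the modular law does the work of the isomorphism theorems.
  Quotient records appear only where the given notions of socle and semilocality are translated into
  this lattice. The place of module homomorphisms is taken by left multiplication with a homogeneous
  element. Inverses in \<Gamma> make it separate degrees, hence images and preimages of graded right
  ideals are graded; this forces annihilators and generators to be treated for homogeneous elements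
  first and extended by additivity afterwards. Two substitutes stand in for the missing identity of
  R: b = b 1_d for homogeneous b whose degree has domain d, and x = 1_e x for x in R(e). Chain
  conditions hold within a single R(e) only, so each use of them is confined to one object, and the
  objects are reassembled because R is the sum of the R(e).\<close>

section \<open>Additive subgroups and sums of families\<close>

lemma (in abelian_group) additive_subgroup_iff:
  "additive_subgroup H G \<longleftrightarrow>
    H \<subseteq> carrier G \<and> \<zero> \<in> H \<and> (\<forall>x\<in>H. \<forall>y\<in>H. x \<oplus> y \<in> H) \<and> (\<forall>x\<in>H. \<ominus> x \<in> H)"
proof
  assume "additive_subgroup H G"
  then interpret H: additive_subgroup H G .
  show "H \<subseteq> carrier G \<and> \<zero> \<in> H \<and> (\<forall>x\<in>H. \<forall>y\<in>H. x \<oplus> y \<in> H) \<and> (\<forall>x\<in>H. \<ominus> x \<in> H)"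
    using H.a_subset H.a_closed H.zero_closed H.a_inv_closed[of _, OF _] abelian_group_axioms
    by blast
next
  assume "H \<subseteq> carrier G \<and> \<zero> \<in> H \<and> (\<forall>x\<in>H. \<forall>y\<in>H. x \<oplus> y \<in> H) \<and> (\<forall>x\<in>H. \<ominus> x \<in> H)"
  then show "additive_subgroup H G"
    by (intro additive_subgroup.intro subgroup.intro) (auto simp: a_inv_def[symmetric])
qed

lemma (in abelian_group) additive_subgroup_uminus:
  "additive_subgroup H G \<Longrightarrow> x \<in> H \<Longrightarrow> \<ominus> x \<in> H"
  by (simp add: additive_subgroup_iff)

lemma (in abelian_group) finsum_in_additive_subgroup:
  assumes "additive_subgroup H G" "finite A" "\<And>i. i \<in> A \<Longrightarrow> f i \<in> H"
  shows "finsum G f A \<in> H"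
proof -
  interpret H: additive_subgroup H G by fact
  show ?thesis using assms(2,3)
    by (induction A) (auto simp: H.a_Hcarr Pi_def intro!: H.a_closed)
qed

lemma (in abelian_group) finsum_single:
  assumes "finite A" "i \<in> A" "f i \<in> carrier G" "\<And>j. j \<in> A \<Longrightarrow> j \<noteq> i \<Longrightarrow> f j = \<zero>"
  shows "finsum G f A = f i"
proof -
  have A: "A = insert i (A - {i})" using assms(2) by auto
  have z: "finsum G f (A - {i}) = \<zero>"
    using assms(4) by (intro add.finprod_one_eqI) auto
  have "finsum G f (insert i (A - {i})) = f i \<oplus> finsum G f (A - {i})"
  proof (rule finsum_insert)
    show "f \<in> A - {i} \<rightarrow> carrier G" using assms(4) by force
  qed (use assms in auto)
  then show ?thesis using A z assms(3) by simp
qed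

lemma (in abelian_group) family_sum_additive_subgroup:
  assumes "\<And>i. i \<in> I \<Longrightarrow> additive_subgroup (P i) G"
  shows "additive_subgroup (family_sum G I P) G"
proof -
  have sub: "P i \<subseteq> carrier G" if "i \<in> I" for i
    using additive_subgroup.a_subset[OF assms[OF that]] .
  have Z: "\<zero> \<in> P i" if "i \<in> I" for i
    using additive_subgroup.zero_closed[OF assms[OF that]] .
  have cl: "finsum G f A \<in> carrier G" if "A \<subseteq> I" "\<forall>i\<in>A. f i \<in> P i" for f A
    using that sub by (intro finsum_closed) blast
  show ?thesis unfolding additive_subgroup_iff
  proof (intro conjI ballI)
    show "family_sum G I P \<subseteq> carrier G" using cl by (auto simp: family_sum_def)
    have "finsum G (\<lambda>i. \<zero>) ({}::'c set) = \<zero>" by simp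
    then show "\<zero> \<in> family_sum G I P"
      unfolding family_sum_def by (intro CollectI exI[of _ "\<lambda>i. \<zero>"] exI[of _ "{}"]) simp
  next
    fix x y assume "x \<in> family_sum G I P" "y \<in> family_sum G I P"
    then obtain f A g B where f: "x = finsum G f A" "finite A" "A \<subseteq> I" "\<forall>i\<in>A. f i \<in> P i"
      and g: "y = finsum G g B" "finite B" "B \<subseteq> I" "\<forall>i\<in>B. g i \<in> P i"
      unfolding family_sum_def by blast
    \<comment> \<open>Extension by zero lets both sums run over the common index set
      \<open>A \<union> B\<close>.\<close>
    define f' where "f' i = (if i \<in> A then f i else \<zero>)" for i
    define g' where "g' i = (if i \<in> B then g i else \<zero>)" for i
    have fc: "f i \<in> carrier G" if "i \<in> A" for i using f sub that by blast
    have gc: "g i \<in> carrier G" if "i \<in> B" for i using g sub that by blast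
    have "finsum G f' (A \<union> B) = finsum G f A"
      using f(2) g(2) fc by (intro add.finprod_mono_neutral_cong_right) (auto simp: f'_def)
    moreover have "finsum G g' (A \<union> B) = finsum G g B"
      using f(2) g(2) gc by (intro add.finprod_mono_neutral_cong_right) (auto simp: g'_def)
    moreover have "finsum G (\<lambda>i. f' i \<oplus> g' i) (A \<union> B) = finsum G f' (A \<union> B) \<oplus> finsum G g' (A \<union> B)"
      using fc gc by (intro finsum_addf) (auto simp: f'_def g'_def)
    ultimately have "x \<oplus> y = finsum G (\<lambda>i. f' i \<oplus> g' i) (A \<union> B)" using f(1) g(1) by simp
    moreover have "f' i \<oplus> g' i \<in> P i" if "i \<in> A \<union> B" for i
    proof -
      have i: "i \<in> I" using that f(3) g(3) by blast
      then have "f' i \<in> P i" "g' i \<in> P i" using f(4) g(4) Z by (auto simp: f'_def g'_def)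
      then show ?thesis using additive_subgroup.a_closed[OF assms[OF i]] by blast
    qed
    ultimately show "x \<oplus> y \<in> family_sum G I P"
      unfolding family_sum_def using f(2,3) g(2,3)
      by (intro CollectI exI[of _ "\<lambda>i. f' i \<oplus> g' i"] exI[of _ "A \<union> B"]) blast
  next
    fix x assume "x \<in> family_sum G I P"
    then obtain f A where f: "x = finsum G f A" "finite A" "A \<subseteq> I" "\<forall>i\<in>A. f i \<in> P i"
      unfolding family_sum_def by blast
    have fc: "f i \<in> carrier G" if "i \<in> A" for i using f sub that by blast
    have fn: "\<ominus> f i \<in> P i" if "i \<in> A" for i
      using f(3,4) that assms[of i] additive_subgroup_uminus by blast
    have "finsum G f A \<oplus> finsum G (\<lambda>i. \<ominus> f i) A = finsum G (\<lambda>i. f i \<oplus> \<ominus> f i) A"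
      using fc by (subst finsum_addf) auto
    also have "\<dots> = \<zero>" using fc by (intro add.finprod_one_eqI) (auto simp: r_neg)
    finally have "finsum G (\<lambda>i. \<ominus> f i) A = \<ominus> x"
      using fc f(1) by (metis (no_types, lifting) Pi_I a_inv_closed add.m_comm finsum_closed minus_equality)
    then show "\<ominus> x \<in> family_sum G I P"
      unfolding family_sum_def using f(2,3) fn
      by (intro CollectI exI[of _ "\<lambda>i. \<ominus> f i"] exI[of _ A]) auto
  qed
qed

lemma (in abelian_group) family_sum_upper:
  assumes "i \<in> I" "P i \<subseteq> carrier G"
  shows "P i \<subseteq> family_sum G I P"
proof
  fix x assume x: "x \<in> P i"
  then have "finsum G (\<lambda>_. x) {i} = x" using assms by (subst finsum_insert) auto
  then show "x \<in> family_sum G I P" unfolding family_sum_def using x assms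
    by (intro CollectI exI[of _ "\<lambda>_. x"] exI[of _ "{i}"]) auto
qed

lemma (in abelian_group) family_sum_least:
  assumes "additive_subgroup T G" "\<And>i. i \<in> I \<Longrightarrow> P i \<subseteq> T"
  shows "family_sum G I P \<subseteq> T"
  using assms by (auto simp: family_sum_def intro!: finsum_in_additive_subgroup[OF assms(1)])

section \<open>Transfer between records with the same addition\<close>

text \<open>The records \<open>regular R\<close> and \<open>submod M B\<close> take over the
  addition of the record they come from, possibly on a smaller carrier. Sums, inverses and direct
  sums formed in one have to be recognised as those of the other.\<close>

lemma finsum_transfer:
  assumes "abelian_group M" "abelian_group M'" "carrier M \<subseteq> carrier M'"
    "add M = add M'" "zero M = zero M'" "\<And>i. i \<in> A \<Longrightarrow> f i \<in> carrier M"
  shows "finsum M f A = finsum M' f A"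
proof (cases "finite A")
  case True
  interpret M: abelian_group M by fact
  interpret M': abelian_group M' by fact
  show ?thesis using True assms(3,6)
  proof (induction A)
    case empty
    then show ?case using assms(5) by simp
  next
    case (insert i A)
    then have "f \<in> A \<rightarrow> carrier M" "f \<in> A \<rightarrow> carrier M'" "f i \<in> carrier M" "f i \<in> carrier M'" by auto
    then show ?case using insert assms(4) by simp
  qed
next
  case False
  interpret M: abelian_group M by fact
  interpret M': abelian_group M' by fact
  \<comment> \<open>Over an infinite index set \<open>finsum\<close> defaults to zero in either
    group.\<close>
  show ?thesis using False assms(5) by (simp add: M.finsum_infinite M'.finsum_infinite)
qed

lemma a_inv_transfer:
  assumes "abelian_group M" "abelian_group M'" "carrier M \<subseteq> carrier M'"
    "add M = add M'" "zero M = zero M'" "x \<in> carrier M"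
  shows "a_inv M x = a_inv M' x"
proof -
  interpret M: abelian_group M by fact
  interpret M': abelian_group M' by fact
  have "add M' (a_inv M x) x = zero M'" using assms M.l_neg[of x] by simp
  moreover have "x \<in> carrier M'" "a_inv M x \<in> carrier M'" using assms(3,6) M.a_inv_closed by auto
  ultimately show ?thesis using M'.minus_equality by simp
qed

lemma additive_subgroup_transfer:
  assumes "abelian_group M" "abelian_group M'" "carrier M \<subseteq> carrier M'"
    "add M = add M'" "zero M = zero M'"
  shows "additive_subgroup H M \<longleftrightarrow> additive_subgroup H M' \<and> H \<subseteq> carrier M"
proof -
  have "a_inv M x = a_inv M' x" if "x \<in> carrier M" for x
    using a_inv_transfer[OF assms that] .
  then show ?thesis
    unfolding abelian_group.additive_subgroup_iff[OF assms(1)]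
      abelian_group.additive_subgroup_iff[OF assms(2)]
    using assms(3-5) by (auto simp: subset_iff)
qed

lemma (in abelian_group) abelian_group_of_additive_subgroup:
  fixes M' :: "('a, 'z) ring_scheme"
  assumes "additive_subgroup (carrier M') G" "add M' = add G" "zero M' = \<zero>"
  shows "abelian_group M'"
proof -
  have H: "carrier M' \<subseteq> carrier G" "\<zero> \<in> carrier M'" "\<And>x y. x \<in> carrier M' \<Longrightarrow> y \<in> carrier M' \<Longrightarrow> x \<oplus> y \<in> carrier M'"
    "\<And>x. x \<in> carrier M' \<Longrightarrow> \<ominus> x \<in> carrier M'"
    using assms(1) by (simp_all add: additive_subgroup_iff)
  show ?thesis
  proof (rule abelian_groupI)
    fix x assume "x \<in> carrier M'"
    then show "\<exists>y\<in>carrier M'. y \<oplus>\<^bsub>M'\<^esub> x = \<zero>\<^bsub>M'\<^esub>"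
      using H assms by (intro bexI[of _ "\<ominus> x"]) (auto simp: l_neg subset_iff)
  qed (use H assms in \<open>auto simp: subset_iff a_ac\<close>)
qed

lemma family_sum_transfer:
  assumes "abelian_group M" "abelian_group M'" "carrier M \<subseteq> carrier M'"
    "add M = add M'" "zero M = zero M'" "\<And>i. i \<in> I \<Longrightarrow> P i \<subseteq> carrier M"
  shows "family_sum M I P = family_sum M' I P"
proof -
  have "finsum M f A = finsum M' f A" if "A \<subseteq> I" "\<forall>i\<in>A. f i \<in> P i" for f A
    using assms(6) that by (intro finsum_transfer[OF assms(1-5)]) blast
  then have "(x = finsum M f A \<and> finite A \<and> A \<subseteq> I \<and> (\<forall>i\<in>A. f i \<in> P i)) \<longleftrightarrow>
      (x = finsum M' f A \<and> finite A \<and> A \<subseteq> I \<and> (\<forall>i\<in>A. f i \<in> P i))" for x f A by auto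
  then show ?thesis unfolding family_sum_def by simp
qed

lemma family_sum_cong:
  assumes "\<And>i. i \<in> I \<Longrightarrow> P i = P' i"
  shows "family_sum M I P = family_sum M I P'"
proof -
  have "(x = finsum M f A \<and> finite A \<and> A \<subseteq> I \<and> (\<forall>i\<in>A. f i \<in> P i)) \<longleftrightarrow>
      (x = finsum M f A \<and> finite A \<and> A \<subseteq> I \<and> (\<forall>i\<in>A. f i \<in> P' i))" for x f A
    using assms by (auto simp: subset_iff)
  then show ?thesis unfolding family_sum_def by simp
qed

lemma is_direct_sum_transfer:
  assumes "abelian_group M" "abelian_group M'" "carrier M \<subseteq> carrier M'"
    "add M = add M'" "zero M = zero M'" "\<And>i. i \<in> I \<Longrightarrow> P i \<subseteq> carrier M"
  shows "is_direct_sum M I P N \<longleftrightarrow> is_direct_sum M' I P N"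
proof -
  have 1: "finsum M f A = finsum M' f A" if "A \<subseteq> I" "\<forall>i\<in>A. f i \<in> P i" for f A
    using assms(6) that by (intro finsum_transfer[OF assms(1-5)]) blast
  have 2: "additive_subgroup (P i) M \<longleftrightarrow> additive_subgroup (P i) M'" if "i \<in> I" for i
    using additive_subgroup_transfer[OF assms(1-5)] assms(6)[OF that] by blast
  have 3: "(finite A \<and> A \<subseteq> I \<and> (\<forall>i\<in>A. f i \<in> P i) \<and> finsum M f A = \<zero>\<^bsub>M\<^esub>) \<longleftrightarrow>
      (finite A \<and> A \<subseteq> I \<and> (\<forall>i\<in>A. f i \<in> P i) \<and> finsum M' f A = \<zero>\<^bsub>M'\<^esub>)" for f A
    using 1[of A f] assms(5) by auto
  have 4: "family_sum M I P = family_sum M' I P" by (rule family_sum_transfer[OF assms])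
  show ?thesis unfolding is_direct_sum_def 3 4 unfolding assms(5) using 2 by simp
qed

section \<open>Submodules of submodules and the gr-simple ones\<close>

lemma submod_simps [simp]:
  "carrier (submod M B) = B" "add (submod M B) = add M" "zero (submod M B) = zero M"
  "component (submod M B) = (\<lambda>\<gamma>. B \<inter> component M \<gamma>)" "act (submod M B) = act M"
  by (simp_all add: submod_def)

lemma abelian_group_submod:
  assumes "abelian_group M" "additive_subgroup B M"
  shows "abelian_group (submod M B)"
  by (rule abelian_group.abelian_group_of_additive_subgroup[OF assms(1)]) (use assms in auto)

lemma rsubmodule_submod:
  assumes "abelian_group M" "additive_subgroup B M"
  shows "rsubmodule R (submod M B) N \<longleftrightarrow> rsubmodule R M N \<and> N \<subseteq> B"
proof -
  have "B \<subseteq> carrier M" using additive_subgroup.a_subset[OF assms(2)] .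
  then show ?thesis
    using additive_subgroup_transfer[OF abelian_group_submod[OF assms] assms(1)]
    by (auto simp: rsubmodule_def)
qed

text \<open>Gradedness is absolute: a chain of graded submodules of M(e) is a chain in M below
  M(e).\<close>

lemma graded_submodule_submod:
  assumes "abelian_group M" "additive_subgroup B M"
  shows "graded_submodule \<Gamma> R (submod M B) N \<longleftrightarrow> graded_submodule \<Gamma> R M N \<and> N \<subseteq> B"
proof (cases "N \<subseteq> B")
  case True
  have B: "B \<subseteq> carrier M" using additive_subgroup.a_subset[OF assms(2)] .
  have "N \<inter> (B \<inter> X) = N \<inter> X" for X using True by auto
  then show ?thesis
    using is_direct_sum_transfer[OF abelian_group_submod[OF assms] assms(1),
        of "carrier \<Gamma>" "\<lambda>\<gamma>. N \<inter> component M \<gamma>" N] True B rsubmodule_submod[OF assms]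
    by (auto simp: graded_submodule_def)
next
  case False
  then show ?thesis using rsubmodule_submod[OF assms] by (auto simp: graded_submodule_def)
qed

lemma gr_simple_submodules_iff:
  assumes "abelian_group M"
  shows "S \<in> gr_simple_submodules \<Gamma> R M \<longleftrightarrow>
    graded_submodule \<Gamma> R M S \<and> S \<noteq> {\<zero>\<^bsub>M\<^esub>} \<and>
    (\<forall>N. graded_submodule \<Gamma> R M N \<longrightarrow> N \<subseteq> S \<longrightarrow> N = {\<zero>\<^bsub>M\<^esub>} \<or> N = S)"
proof -
  have "additive_subgroup S M" if "graded_submodule \<Gamma> R M S"
    using that by (auto simp: graded_submodule_def rsubmodule_def)
  then show ?thesis
    unfolding gr_simple_submodules_def gr_simple_def
    using graded_submodule_submod[OF assms, of S] by auto
qed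

text \<open>A witnessing family can be enlarged to the family of all gr-simple submodules, which
  removes the existential quantifier.\<close>

lemma gr_semisimple_iff:
  assumes "abelian_group M"
  shows "gr_semisimple \<Gamma> R M \<longleftrightarrow> carrier M \<subseteq> gr_soc \<Gamma> R M"
proof -
  interpret M: abelian_group M by fact
  have a: "additive_subgroup S M" if "S \<in> gr_simple_submodules \<Gamma> R M" for S
    using that by (auto simp: gr_simple_submodules_def graded_submodule_def rsubmodule_def)
  have "additive_subgroup (gr_soc \<Gamma> R M) M"
    unfolding gr_soc_def by (rule M.family_sum_additive_subgroup) (rule a)
  then have "gr_soc \<Gamma> R M \<subseteq> carrier M" by (rule additive_subgroup.a_subset)
  moreover have "family_sum M \<S> (\<lambda>S. S) \<subseteq> gr_soc \<Gamma> R M" if "\<S> \<subseteq> gr_simple_submodules \<Gamma> R M" for \<S>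
    unfolding family_sum_def gr_soc_def using that by blast
  ultimately show ?thesis unfolding gr_semisimple_def
    by (metis gr_soc_def order_refl subset_antisym)
qed

section \<open>Arithmetic and additive maps in a graded ring\<close>

context graded_ring
begin

lemma uminus_zero [simp]: "\<ominus> \<zero> = \<zero>"
  by (rule minus_equality) simp_all

lemma add_minus_cancel:
  "x \<in> carrier R \<Longrightarrow> y \<in> carrier R \<Longrightarrow> (x \<oplus> y) \<ominus> x = y"
  "x \<in> carrier R \<Longrightarrow> y \<in> carrier R \<Longrightarrow> y \<oplus> (x \<ominus> y) = x"
  by (simp_all add: minus_eq a_comm[of x y] a_lcomm[of y x] a_assoc r_neg)

lemma mult_zero_right [simp]: "a \<in> carrier R \<Longrightarrow> a \<otimes> \<zero> = \<zero>"
  by (metis add.r_cancel_one' mult_closed right_distrib zero_closed l_zero)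

lemma mult_zero_left [simp]: "a \<in> carrier R \<Longrightarrow> \<zero> \<otimes> a = \<zero>"
  by (metis add.r_cancel_one' mult_closed left_distrib zero_closed l_zero)

lemma mult_uminus_right: "a \<in> carrier R \<Longrightarrow> b \<in> carrier R \<Longrightarrow> a \<otimes> (\<ominus> b) = \<ominus> (a \<otimes> b)"
  by (metis a_inv_closed l_neg minus_equality mult_closed mult_zero_right right_distrib)

lemma mult_uminus_left: "a \<in> carrier R \<Longrightarrow> b \<in> carrier R \<Longrightarrow> (\<ominus> a) \<otimes> b = \<ominus> (a \<otimes> b)"
  by (metis a_inv_closed l_neg minus_equality mult_closed mult_zero_left left_distrib)

lemma additive_map_zero:
  assumes "\<And>x. x \<in> carrier R \<Longrightarrow> \<phi> x \<in> carrier R"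
    "\<And>x y. x \<in> carrier R \<Longrightarrow> y \<in> carrier R \<Longrightarrow> \<phi> (x \<oplus> y) = \<phi> x \<oplus> \<phi> y"
  shows "\<phi> \<zero> = \<zero>"
  using assms(1)[OF zero_closed] assms(2)[OF zero_closed zero_closed]
  by (metis add.r_cancel_one' l_zero zero_closed)

lemma additive_map_uminus:
  assumes "\<And>x. x \<in> carrier R \<Longrightarrow> \<phi> x \<in> carrier R"
    "\<And>x y. x \<in> carrier R \<Longrightarrow> y \<in> carrier R \<Longrightarrow> \<phi> (x \<oplus> y) = \<phi> x \<oplus> \<phi> y" "x \<in> carrier R"
  shows "\<phi> (\<ominus> x) = \<ominus> \<phi> x"
  using assms(2)[of "\<ominus> x" x] assms(1,3) additive_map_zero[OF assms(1,2)]
  by (simp add: l_neg minus_equality)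

text \<open>Additive properties of elements are proved throughout by displaying the elements that
  have them as such a preimage and then checking homogeneous elements only.\<close>

lemma vimage_additive_subgroup:
  assumes "additive_subgroup T R" "\<And>x. x \<in> carrier R \<Longrightarrow> \<phi> x \<in> carrier R"
    "\<And>x y. x \<in> carrier R \<Longrightarrow> y \<in> carrier R \<Longrightarrow> \<phi> (x \<oplus> y) = \<phi> x \<oplus> \<phi> y"
  shows "additive_subgroup {x \<in> carrier R. \<phi> x \<in> T} R"
  using assms additive_map_zero[OF assms(2,3)] additive_map_uminus[OF assms(2,3)]
  by (auto simp: additive_subgroup_iff)

lemma Int_additive_subgroup:
  "additive_subgroup A R \<Longrightarrow> additive_subgroup B R \<Longrightarrow> additive_subgroup (A \<inter> B) R"
  by (auto simp: additive_subgroup_iff)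

lemma zero_additive_subgroup: "additive_subgroup {\<zero>} R"
  by (auto simp: additive_subgroup_iff)

lemma carrier_additive_subgroup: "additive_subgroup (carrier R) R"
  by (auto simp: additive_subgroup_iff)

lemma equalizer_additive_subgroup:
  assumes "\<And>x. x \<in> carrier R \<Longrightarrow> \<phi> x \<in> carrier R"
    "\<And>x y. x \<in> carrier R \<Longrightarrow> y \<in> carrier R \<Longrightarrow> \<phi> (x \<oplus> y) = \<phi> x \<oplus> \<phi> y"
    "\<And>x. x \<in> carrier R \<Longrightarrow> \<psi> x \<in> carrier R"
    "\<And>x y. x \<in> carrier R \<Longrightarrow> y \<in> carrier R \<Longrightarrow> \<psi> (x \<oplus> y) = \<psi> x \<oplus> \<psi> y"
  shows "additive_subgroup {x \<in> carrier R. \<phi> x = \<psi> x} R"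
  using assms additive_map_zero[OF assms(1,2)] additive_map_zero[OF assms(3,4)]
    additive_map_uminus[OF assms(1,2)] additive_map_uminus[OF assms(3,4)]
  by (auto simp: additive_subgroup_iff)

subsection \<open>Homogeneous components\<close>

lemma component_additive_subgroup: "\<gamma> \<in> carrier \<Gamma> \<Longrightarrow> additive_subgroup (component R \<gamma>) R"
  using ring_decomposition by (simp add: is_direct_sum_def)

lemma component_closed: "\<gamma> \<in> carrier \<Gamma> \<Longrightarrow> x \<in> component R \<gamma> \<Longrightarrow> x \<in> carrier R"
  using additive_subgroup.a_subset[OF component_additive_subgroup] by blast

text \<open>Induction over homogeneous elements: with a preimage or an equalizer for T, an additive
  statement reduces to its homogeneous instances.\<close>

lemma carrier_le:
  assumes "additive_subgroup T R" "\<And>\<gamma>. \<gamma> \<in> carrier \<Gamma> \<Longrightarrow> component R \<gamma> \<subseteq> T"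
  shows "carrier R \<subseteq> T"
proof -
  have "carrier R = family_sum R (carrier \<Gamma>) (component R)"
    using ring_decomposition by (simp add: is_direct_sum_def)
  then show ?thesis using family_sum_least[OF assms] by simp
qed

lemma component_independent:
  assumes "\<gamma> \<in> carrier \<Gamma>" "y \<in> component R \<gamma>"
    "y \<in> family_sum R (carrier \<Gamma> - {\<gamma>}) (component R)"
  shows "y = \<zero>"
proof -
  obtain f A where f: "y = finsum R f A" "finite A" "A \<subseteq> carrier \<Gamma> - {\<gamma>}"
    "\<forall>i\<in>A. f i \<in> component R i"
    using assms(3) unfolding family_sum_def by blast
  \<comment> \<open>Moving y to the other side gives a vanishing sum with summand
    \<open>\<ominus> y\<close> in degree \<gamma>, to which directness applies.\<close>
  define g where "g = f(\<gamma> := \<ominus> y)"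
  have y: "y \<in> carrier R" using assms component_closed by blast
  have fc: "f i \<in> carrier R" if "i \<in> A" for i using f that component_closed by blast
  have "finsum R g (insert \<gamma> A) = \<ominus> y \<oplus> finsum R g A"
    using f(2,3) fc y by (subst finsum_insert) (auto simp: g_def)
  also have "finsum R g A = finsum R f A"
    using f(3) fc by (intro finsum_cong') (auto simp: g_def)
  finally have z: "finsum R g (insert \<gamma> A) = \<zero>" using f(1) y by (simp add: l_neg)
  have "\<ominus> y \<in> component R \<gamma>"
    using additive_subgroup_uminus[OF component_additive_subgroup] assms by blast
  then have "\<forall>i\<in>insert \<gamma> A. g i \<in> component R i" using f(4) by (auto simp: g_def)
  moreover have "finite (insert \<gamma> A)" "insert \<gamma> A \<subseteq> carrier \<Gamma>" using f assms by auto
  ultimately have "\<forall>i\<in>insert \<gamma> A. g i = \<zero>"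
    using z ring_decomposition unfolding is_direct_sum_def by blast
  then have "\<ominus> y = \<zero>" by (simp add: g_def)
  then show ?thesis using minus_minus[OF y] by simp
qed

text \<open>Describing the component of x by means of the complementary sum makes additivity a
  matter of uniqueness; no finite supports have to be matched.\<close>

definition proj :: "'g \<Rightarrow> 'r \<Rightarrow> 'r" where
  "proj \<gamma> x = (THE y. y \<in> component R \<gamma> \<and>
     x \<ominus> y \<in> family_sum R (carrier \<Gamma> - {\<gamma>}) (component R))"

abbreviation others :: "'g \<Rightarrow> 'r set" where
  "others \<gamma> \<equiv> family_sum R (carrier \<Gamma> - {\<gamma>}) (component R)"

lemma others_additive_subgroup: "additive_subgroup (others \<gamma>) R"
  by (rule family_sum_additive_subgroup) (use component_additive_subgroup in auto)

lemma component_le_others: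
  "\<delta> \<in> carrier \<Gamma> \<Longrightarrow> \<delta> \<noteq> \<gamma> \<Longrightarrow> component R \<delta> \<subseteq> others \<gamma>"
  by (rule family_sum_upper) (auto dest: component_closed)

lemma proj_eqI:
  assumes "\<gamma> \<in> carrier \<Gamma>" "x \<in> carrier R" "y \<in> component R \<gamma>" "x \<ominus> y \<in> others \<gamma>"
  shows "proj \<gamma> x = y"
  unfolding proj_def
proof (rule the_equality)
  show "y \<in> component R \<gamma> \<and> x \<ominus> y \<in> others \<gamma>" using assms by simp
next
  fix z assume z: "z \<in> component R \<gamma> \<and> x \<ominus> z \<in> others \<gamma>"
  have c: "z \<in> carrier R" "y \<in> carrier R" using z assms component_closed by auto
  \<comment> \<open>The difference of two candidates lies both in the component and in the
    complementary sum.\<close>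
  have "z \<ominus> y = (x \<ominus> y) \<oplus> \<ominus> (x \<ominus> z)"
    using c assms(2) by (simp add: minus_eq minus_add a_ac r_neg r_neg1 r_neg2)
  moreover have "(x \<ominus> y) \<oplus> \<ominus> (x \<ominus> z) \<in> others \<gamma>"
    using z assms(4) others_additive_subgroup[of \<gamma>] additive_subgroup_uminus additive_subgroup.a_closed
    by metis
  moreover have "z \<ominus> y \<in> component R \<gamma>"
    using z assms component_additive_subgroup[OF assms(1)] additive_subgroup_uminus additive_subgroup.a_closed
    unfolding minus_eq by metis
  ultimately have "z \<ominus> y = \<zero>" using component_independent assms(1) by simp
  then show "z = y" using c add_minus_cancel(2)[of z y] by simp
qed

lemma proj_props:
  assumes "\<gamma> \<in> carrier \<Gamma>" "x \<in> carrier R"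
  shows "proj \<gamma> x \<in> component R \<gamma>" "x \<ominus> proj \<gamma> x \<in> others \<gamma>"
proof -
  \<comment> \<open>This subgroup contains every component, hence all of R, and an element written
    in it displays its part in degree \<gamma>.\<close>
  let ?T = "component R \<gamma> <+>\<^bsub>R\<^esub> others \<gamma>"
  have T: "additive_subgroup ?T R"
    by (rule add_additive_subgroups[OF component_additive_subgroup[OF assms(1)] others_additive_subgroup])
  have "carrier R \<subseteq> ?T"
  proof (rule carrier_le[OF T])
    fix \<delta> assume d: "\<delta> \<in> carrier \<Gamma>"
    show "component R \<delta> \<subseteq> ?T"
    proof
      fix z assume z: "z \<in> component R \<delta>"
      have zc: "z \<in> carrier R" using z d component_closed by blast
      show "z \<in> ?T"
      proof (cases "\<delta> = \<gamma>")
        case True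
        have "z = z \<oplus> \<zero>" using zc by simp
        then show ?thesis using z True additive_subgroup.zero_closed[OF others_additive_subgroup]
          unfolding set_add_def' by blast
      next
        case False
        have "z = \<zero> \<oplus> z" using zc by simp
        then show ?thesis using z d False component_le_others
            additive_subgroup.zero_closed[OF component_additive_subgroup[OF assms(1)]]
          unfolding set_add_def' by blast
      qed
    qed
  qed
  then obtain y z where yz: "y \<in> component R \<gamma>" "z \<in> others \<gamma>" "x = y \<oplus> z"
    using assms(2) unfolding set_add_def' by blast
  have c: "y \<in> carrier R" "z \<in> carrier R"
    using yz component_closed[OF assms(1)] additive_subgroup.a_subset[OF others_additive_subgroup] by auto
  then have "x \<ominus> y = z" using yz(3) add_minus_cancel(1) by simp
  then have x: "x \<ominus> y \<in> others \<gamma>" using yz by simp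
  then have "proj \<gamma> x = y" using proj_eqI assms yz by blast
  then show "proj \<gamma> x \<in> component R \<gamma>" "x \<ominus> proj \<gamma> x \<in> others \<gamma>" using yz x by simp_all
qed

lemma proj_closed: "\<gamma> \<in> carrier \<Gamma> \<Longrightarrow> x \<in> carrier R \<Longrightarrow> proj \<gamma> x \<in> carrier R"
  using proj_props(1) component_closed by blast

lemma proj_add:
  assumes "\<gamma> \<in> carrier \<Gamma>" "x \<in> carrier R" "y \<in> carrier R"
  shows "proj \<gamma> (x \<oplus> y) = proj \<gamma> x \<oplus> proj \<gamma> y"
proof (rule proj_eqI)
  show "proj \<gamma> x \<oplus> proj \<gamma> y \<in> component R \<gamma>"
    using additive_subgroup.a_closed[OF component_additive_subgroup] proj_props(1) assms by blast
  have "x \<oplus> y \<ominus> (proj \<gamma> x \<oplus> proj \<gamma> y) = (x \<ominus> proj \<gamma> x) \<oplus> (y \<ominus> proj \<gamma> y)"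
    using assms proj_closed by (simp add: minus_eq minus_add a_ac)
  then show "x \<oplus> y \<ominus> (proj \<gamma> x \<oplus> proj \<gamma> y) \<in> others \<gamma>"
    using additive_subgroup.a_closed[OF others_additive_subgroup] proj_props(2) assms by metis
qed (use assms in auto)

lemma proj_same: "\<gamma> \<in> carrier \<Gamma> \<Longrightarrow> x \<in> component R \<gamma> \<Longrightarrow> proj \<gamma> x = x"
  using additive_subgroup.zero_closed[OF others_additive_subgroup]
  by (intro proj_eqI) (auto dest: component_closed simp: minus_eq r_neg)

lemma proj_other:
  "\<gamma> \<in> carrier \<Gamma> \<Longrightarrow> \<delta> \<in> carrier \<Gamma> \<Longrightarrow> \<delta> \<noteq> \<gamma> \<Longrightarrow> x \<in> component R \<delta> \<Longrightarrow> proj \<gamma> x = \<zero>"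
  using component_le_others[of \<delta> \<gamma>] additive_subgroup.zero_closed[OF component_additive_subgroup]
    component_closed[of \<delta> x]
  by (intro proj_eqI) (auto simp: minus_eq)

lemma proj_zero: "\<gamma> \<in> carrier \<Gamma> \<Longrightarrow> proj \<gamma> \<zero> = \<zero>"
  by (rule additive_map_zero) (auto simp: proj_closed proj_add)

lemma proj_finsum:
  assumes "finite F" "F \<subseteq> carrier \<Gamma>" "\<And>\<gamma>. \<gamma> \<in> F \<Longrightarrow> f \<gamma> \<in> component R \<gamma>" "\<delta> \<in> F"
  shows "proj \<delta> (finsum R f F) = f \<delta>"
proof -
  have d: "\<delta> \<in> carrier \<Gamma>" using assms by blast
  have fc: "f \<gamma> \<in> carrier R" if "\<gamma> \<in> F" for \<gamma> using assms(2,3) that component_closed by blast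
  have "proj \<delta> (finsum R f G) = finsum R (\<lambda>\<gamma>. proj \<delta> (f \<gamma>)) G" if "finite G" "G \<subseteq> F" for G
    using that
  proof (induction G)
    case empty
    then show ?case using proj_zero[OF d] by simp
  next
    case (insert i G)
    have fG: "f \<in> G \<rightarrow> carrier R" "f i \<in> carrier R" using insert fc by auto
    then have "(\<lambda>\<gamma>. proj \<delta> (f \<gamma>)) \<in> G \<rightarrow> carrier R" "proj \<delta> (f i) \<in> carrier R"
      using proj_closed[OF d] by auto
    then show ?case using insert fG proj_add[OF d] by simp
  qed
  then have "proj \<delta> (finsum R f F) = finsum R (\<lambda>\<gamma>. proj \<delta> (f \<gamma>)) F" using assms(1) by simp
  also have "\<dots> = proj \<delta> (f \<delta>)"
    using assms d proj_closed[OF d fc] proj_other[OF d] by (intro finsum_single) blast+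
  finally show ?thesis using proj_same d assms by simp
qed

lemma proj_decomposition:
  assumes "x \<in> carrier R"
  obtains F where "finite F" "F \<subseteq> carrier \<Gamma>" "x = finsum R (\<lambda>\<gamma>. proj \<gamma> x) F"
proof -
  have "x \<in> family_sum R (carrier \<Gamma>) (component R)"
    using ring_decomposition assms by (simp add: is_direct_sum_def)
  then obtain f F where f: "x = finsum R f F" "finite F" "F \<subseteq> carrier \<Gamma>"
    "\<forall>i\<in>F. f i \<in> component R i"
    unfolding family_sum_def by blast
  have "finsum R f F = finsum R (\<lambda>\<gamma>. proj \<gamma> x) F"
    using f proj_finsum[OF f(2,3)] proj_closed[OF _ assms] by (intro finsum_cong') (auto simp: subset_iff)
  then show ?thesis using that f by simp
qed

subsection \<open>The local identities\<close>

lemma identitiesD: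
  assumes "e \<in> identities \<Gamma>"
  shows "e \<in> carrier \<Gamma>" "src \<Gamma> e = e" "tgt \<Gamma> e = e"
  using assms tgt_src[of e] by (auto simp: identities_def)

lemma tgt_identity: "\<gamma> \<in> carrier \<Gamma> \<Longrightarrow> tgt \<Gamma> \<gamma> \<in> identities \<Gamma>"
  by (simp add: identities_def tgt_closed src_tgt)

lemma src_identity: "\<gamma> \<in> carrier \<Gamma> \<Longrightarrow> src \<Gamma> \<gamma> \<in> identities \<Gamma>"
  by (simp add: identities_def src_closed src_src)

lemma loc_one_component:
  assumes "e \<in> identities \<Gamma>"
  shows "loc_one R e \<in> component R e"
proof -
  obtain u where u: "u \<in> component R e" "\<forall>a\<in>component R e. u \<otimes> a = a \<and> a \<otimes> u = a"
    using loc_one_exists[OF assms] by blast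
  have "loc_one R e = u" unfolding loc_one_def
  proof (rule the_equality)
    fix v assume v: "v \<in> component R e \<and> (\<forall>a\<in>component R e. v \<otimes> a = a \<and> a \<otimes> v = a)"
    then have "v = v \<otimes> u" using u by simp
    also have "\<dots> = u" using u v by blast
    finally show "v = u" .
  qed (use u in blast)
  then show ?thesis using u by simp
qed

lemma loc_one_closed: "e \<in> identities \<Gamma> \<Longrightarrow> loc_one R e \<in> carrier R"
  using loc_one_component component_closed identitiesD by blast

text \<open>Left multiplication by 1_e is thus the projection of R onto R(e) along the components
  with another range.\<close>

lemma loc_one_mult_component:
  assumes "e \<in> identities \<Gamma>" "\<gamma> \<in> carrier \<Gamma>" "x \<in> component R \<gamma>"
  shows "loc_one R e \<otimes> x = (if tgt \<Gamma> \<gamma> = e then x else \<zero>)"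
  using assms loc_one_left component_mult_zero[of e \<gamma>] identitiesD[OF assms(1)] loc_one_component
  by auto

text \<open>The graded right ideal \<open>R(e)\<close>.\<close>

definition at :: "'g \<Rightarrow> 'r set" where
  "at e = {x \<in> carrier R. loc_one R e \<otimes> x = x}"

lemma component_at: "\<gamma> \<in> carrier \<Gamma> \<Longrightarrow> component R \<gamma> \<subseteq> at (tgt \<Gamma> \<gamma>)"
  using loc_one_left component_closed by (auto simp: at_def)

text \<open>Here inverses in \<Gamma> enter. Because of cancellation, left multiplication by a
  homogeneous element sends distinct components to zero or into distinct components.\<close>

lemma comp_cancel:
  assumes "\<sigma> \<in> carrier \<Gamma>" "\<tau> \<in> carrier \<Gamma>" "\<tau>' \<in> carrier \<Gamma>" "src \<Gamma> \<sigma> = tgt \<Gamma> \<tau>" "src \<Gamma> \<sigma> = tgt \<Gamma> \<tau>'"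
    "comp \<Gamma> \<sigma> \<tau> = comp \<Gamma> \<sigma> \<tau>'"
  shows "\<tau> = \<tau>'"
proof -
  obtain \<rho> where r: "\<rho> \<in> carrier \<Gamma>" "src \<Gamma> \<rho> = tgt \<Gamma> \<sigma>" "comp \<Gamma> \<rho> \<sigma> = src \<Gamma> \<sigma>"
    using invertible[OF assms(1)] by blast
  have "\<tau> = comp \<Gamma> (comp \<Gamma> \<rho> \<sigma>) \<tau>" using r(3) assms(2,4) comp_tgt by simp
  also have "\<dots> = comp \<Gamma> (comp \<Gamma> \<rho> \<sigma>) \<tau>'" using r assms comp_assoc by metis
  also have "\<dots> = \<tau>'" using r(3) assms(3,5) comp_tgt by simp
  finally show ?thesis .
qed

text \<open>By cancellation only the part of a in degree \<tau> can contribute to b a in degree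
  \<sigma>\<tau>.\<close>

lemma proj_mult:
  assumes "\<sigma> \<in> carrier \<Gamma>" "\<tau> \<in> carrier \<Gamma>" "src \<Gamma> \<sigma> = tgt \<Gamma> \<tau>" "b \<in> component R \<sigma>" "a \<in> carrier R"
  shows "proj (comp \<Gamma> \<sigma> \<tau>) (b \<otimes> a) = b \<otimes> proj \<tau> a"
proof -
  have b: "b \<in> carrier R" using assms component_closed by blast
  have c: "comp \<Gamma> \<sigma> \<tau> \<in> carrier \<Gamma>" using assms comp_closed by blast
  let ?T = "{a \<in> carrier R. proj (comp \<Gamma> \<sigma> \<tau>) (b \<otimes> a) = b \<otimes> proj \<tau> a}"
  have "additive_subgroup ?T R"
    by (rule equalizer_additive_subgroup)
      (use b c assms in \<open>auto simp: mult_closed proj_closed proj_add right_distrib\<close>)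
  then have "carrier R \<subseteq> ?T"
  proof (rule carrier_le)
    fix \<delta> assume d: "\<delta> \<in> carrier \<Gamma>"
    have "proj (comp \<Gamma> \<sigma> \<tau>) (b \<otimes> a) = b \<otimes> proj \<tau> a" if a: "a \<in> component R \<delta>" for a
    proof (cases "\<delta> = \<tau>")
      case True
      then show ?thesis using a d c assms component_mult proj_same by simp
    next
      case False
      have "proj (comp \<Gamma> \<sigma> \<tau>) (b \<otimes> a) = \<zero>"
      proof (cases "src \<Gamma> \<sigma> = tgt \<Gamma> \<delta>")
        case True
        then show ?thesis using a d c assms component_mult comp_closed comp_cancel False
          by (metis proj_other)
      next
        case False
        then show ?thesis using a d c assms component_mult_zero proj_zero by simp
      qed
      then show ?thesis using proj_other[OF assms(2) d False a] b by simp
    qed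
    then show "component R \<delta> \<subseteq> ?T" using component_closed d by blast
  qed
  then show ?thesis using assms by blast
qed

subsection \<open>Graded right ideals\<close>

text \<open>Closure under homogeneous components is easier to verify than a direct sum
  decomposition; \<open>graded_submodule_regular_iff\<close> shows that the two agree.\<close>

definition gideal :: "'r set \<Rightarrow> bool" where
  "gideal B \<longleftrightarrow> additive_subgroup B R \<and> (\<forall>x\<in>B. \<forall>a\<in>carrier R. x \<otimes> a \<in> B) \<and>
     (\<forall>x\<in>B. \<forall>\<gamma>\<in>carrier \<Gamma>. proj \<gamma> x \<in> B)"

lemma gidealD:
  assumes "gideal B"
  shows "additive_subgroup B R" "B \<subseteq> carrier R" "\<zero> \<in> B"
    "\<And>x y. x \<in> B \<Longrightarrow> y \<in> B \<Longrightarrow> x \<oplus> y \<in> B" "\<And>x. x \<in> B \<Longrightarrow> \<ominus> x \<in> B"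
    "\<And>x y. x \<in> B \<Longrightarrow> y \<in> B \<Longrightarrow> x \<ominus> y \<in> B"
    "\<And>x a. x \<in> B \<Longrightarrow> a \<in> carrier R \<Longrightarrow> x \<otimes> a \<in> B"
    "\<And>x \<gamma>. x \<in> B \<Longrightarrow> \<gamma> \<in> carrier \<Gamma> \<Longrightarrow> proj \<gamma> x \<in> B"
  using assms by (auto simp: gideal_def additive_subgroup_iff minus_eq)

text \<open>The relative form of \<open>carrier_le\<close>: an element of B is a finite sum of
  components that stay in B.\<close>

lemma gideal_le:
  assumes "gideal B" "additive_subgroup T R" "\<And>\<gamma>. \<gamma> \<in> carrier \<Gamma> \<Longrightarrow> B \<inter> component R \<gamma> \<subseteq> T"
  shows "B \<subseteq> T"
proof
  fix x assume x: "x \<in> B"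
  then have xc: "x \<in> carrier R" using gidealD(2)[OF assms(1)] by blast
  obtain F where F: "finite F" "F \<subseteq> carrier \<Gamma>" "x = finsum R (\<lambda>\<gamma>. proj \<gamma> x) F"
    using proj_decomposition[OF xc] by blast
  have "finsum R (\<lambda>\<gamma>. proj \<gamma> x) F \<in> T"
    using F proj_props(1)[OF _ xc] gidealD(8)[OF assms(1) x] assms(3)
    by (intro finsum_in_additive_subgroup[OF assms(2)]) blast+
  then show "x \<in> T" using F(3) by simp
qed

lemma gideal_zero: "gideal {\<zero>}"
  by (auto simp: gideal_def zero_additive_subgroup proj_zero)

lemma gideal_carrier: "gideal (carrier R)"
  by (auto simp: gideal_def carrier_additive_subgroup proj_closed mult_closed)

lemma gideal_Int: "gideal A \<Longrightarrow> gideal B \<Longrightarrow> gideal (A \<inter> B)"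
  by (auto simp: gideal_def Int_additive_subgroup)

lemma gideal_Inter:
  assumes "\<A> \<noteq> {}" "\<And>A. A \<in> \<A> \<Longrightarrow> gideal A"
  shows "gideal (\<Inter>\<A>)"
proof -
  have "\<Inter>\<A> \<subseteq> carrier R" using assms gidealD(2) by blast
  then show ?thesis using assms by (simp add: gideal_def additive_subgroup_iff)
qed

lemma gideal_chain_Union:
  assumes "\<A> \<noteq> {}" "\<And>A. A \<in> \<A> \<Longrightarrow> gideal A" "\<And>A B. A \<in> \<A> \<Longrightarrow> B \<in> \<A> \<Longrightarrow> A \<subseteq> B \<or> B \<subseteq> A"
  shows "gideal (\<Union>\<A>)"
proof -
  have "x \<oplus> y \<in> \<Union>\<A>" if "x \<in> \<Union>\<A>" "y \<in> \<Union>\<A>" for x y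
  proof -
    obtain A B where "A \<in> \<A>" "B \<in> \<A>" "x \<in> A" "y \<in> B" using \<open>x \<in> \<Union>\<A>\<close> \<open>y \<in> \<Union>\<A>\<close> by blast
    then obtain C where "C \<in> \<A>" "x \<in> C" "y \<in> C" using assms(3)[of A B] by blast
    then show ?thesis using gidealD(4)[OF assms(2)] by blast
  qed
  moreover have "\<Union>\<A> \<subseteq> carrier R" "\<zero> \<in> \<Union>\<A>" using assms gidealD(2,3) by blast+
  moreover have "\<ominus> x \<in> \<Union>\<A>" if "x \<in> \<Union>\<A>" for x using that gidealD(5)[OF assms(2)] by blast
  ultimately have "additive_subgroup (\<Union>\<A>) R" by (simp add: additive_subgroup_iff)
  then show ?thesis unfolding gideal_def using gidealD(7,8)[OF assms(2)] by blast
qed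

lemma gideal_family_sum:
  assumes "\<And>i. i \<in> I \<Longrightarrow> gideal (P i)"
  shows "gideal (family_sum R I P)"
proof -
  let ?S = "family_sum R I P"
  have S: "additive_subgroup ?S R"
    using family_sum_additive_subgroup gidealD(1)[OF assms] by blast
  have up: "P i \<subseteq> ?S" if "i \<in> I" for i
    using family_sum_upper[OF that] gidealD(2)[OF assms] that by blast
  have "?S \<subseteq> {x \<in> carrier R. x \<otimes> a \<in> ?S}" if "a \<in> carrier R" for a
    using that up gidealD(2,7)[OF assms]
    by (intro family_sum_least vimage_additive_subgroup[OF S]) (auto simp: mult_closed left_distrib, blast+)
  moreover have "?S \<subseteq> {x \<in> carrier R. proj \<gamma> x \<in> ?S}" if "\<gamma> \<in> carrier \<Gamma>" for \<gamma>
    using that up gidealD(2,8)[OF assms]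
    by (intro family_sum_least vimage_additive_subgroup[OF S]) (auto simp: proj_closed proj_add, blast+)
  ultimately show ?thesis using S by (auto simp: gideal_def)
qed

lemma mem_set_add_iff: "x \<in> A <+>\<^bsub>R\<^esub> B \<longleftrightarrow> (\<exists>a\<in>A. \<exists>b\<in>B. x = a \<oplus> b)"
  by (auto simp: set_add_def')

lemma gideal_add:
  assumes "gideal A" "gideal B"
  shows "gideal (A <+>\<^bsub>R\<^esub> B)"
proof -
  note D = gidealD[OF assms(1)] gidealD[OF assms(2)]
  have "x \<otimes> a \<in> A <+>\<^bsub>R\<^esub> B" if x: "x \<in> A <+>\<^bsub>R\<^esub> B" and a: "a \<in> carrier R" for x a
  proof -
    obtain y z where yz: "y \<in> A" "z \<in> B" "x = y \<oplus> z" using x mem_set_add_iff by auto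
    then have "x \<otimes> a = y \<otimes> a \<oplus> z \<otimes> a"
      using subsetD[OF D(2)] subsetD[OF D(10)] a left_distrib by simp
    then show ?thesis using D(7)[OF yz(1) a] D(15)[OF yz(2) a] mem_set_add_iff by blast
  qed
  moreover have "proj \<gamma> x \<in> A <+>\<^bsub>R\<^esub> B" if x: "x \<in> A <+>\<^bsub>R\<^esub> B" and a: "\<gamma> \<in> carrier \<Gamma>" for x \<gamma>
  proof -
    obtain y z where yz: "y \<in> A" "z \<in> B" "x = y \<oplus> z" using x mem_set_add_iff by auto
    then have "proj \<gamma> x = proj \<gamma> y \<oplus> proj \<gamma> z"
      using subsetD[OF D(2)] subsetD[OF D(10)] a proj_add by simp
    then show ?thesis using D(8)[OF yz(1) a] D(16)[OF yz(2) a] mem_set_add_iff by blast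
  qed
  ultimately show ?thesis
    unfolding gideal_def using add_additive_subgroups[OF D(1,9)] by blast
qed

lemma add_upper1: "gideal A \<Longrightarrow> gideal B \<Longrightarrow> A \<subseteq> A <+>\<^bsub>R\<^esub> B"
proof
  fix x assume "gideal A" "gideal B" "x \<in> A"
  then have "x = x \<oplus> \<zero>" "\<zero> \<in> B" using gidealD(2)[of A] gidealD(3)[of B] by auto
  then show "x \<in> A <+>\<^bsub>R\<^esub> B" using \<open>x \<in> A\<close> mem_set_add_iff by blast
qed

lemma add_upper2: "gideal A \<Longrightarrow> gideal B \<Longrightarrow> B \<subseteq> A <+>\<^bsub>R\<^esub> B"
proof
  fix x assume "gideal A" "gideal B" "x \<in> B"
  then have "x = \<zero> \<oplus> x" "\<zero> \<in> A" using gidealD(2)[of B] gidealD(3)[of A] by auto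
  then show "x \<in> A <+>\<^bsub>R\<^esub> B" using \<open>x \<in> B\<close> mem_set_add_iff by blast
qed

lemma add_least: "gideal C \<Longrightarrow> A \<subseteq> C \<Longrightarrow> B \<subseteq> C \<Longrightarrow> A <+>\<^bsub>R\<^esub> B \<subseteq> C"
  using gidealD(4)[of C] by (auto simp: mem_set_add_iff) blast

text \<open>If x = a + b lies in C, so does b = x - a. This is the nontrivial direction of
  Dedekind's modular law.\<close>

lemma modular:
  assumes "gideal A" "gideal B" "gideal C" "A \<subseteq> C"
  shows "(A <+>\<^bsub>R\<^esub> B) \<inter> C \<subseteq> A <+>\<^bsub>R\<^esub> (B \<inter> C)"
proof
  fix x assume "x \<in> (A <+>\<^bsub>R\<^esub> B) \<inter> C"
  then obtain a b where ab: "a \<in> A" "b \<in> B" "x = a \<oplus> b" "x \<in> C" using mem_set_add_iff by auto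
  have c: "a \<in> carrier R" "b \<in> carrier R" using ab gidealD(2)[OF assms(1)] gidealD(2)[OF assms(2)] by auto
  have "b = x \<ominus> a" using c ab(3) add_minus_cancel(1) by simp
  then have "b \<in> C" using gidealD(6)[OF assms(3)] ab assms(4) by blast
  then show "x \<in> A <+>\<^bsub>R\<^esub> (B \<inter> C)" using ab mem_set_add_iff by blast
qed

text \<open>On each component 1_e acts as the identity or as zero, so left multiplication by it
  cannot leave a graded right ideal.\<close>

lemma loc_one_mult_gideal:
  assumes "gideal B" "e \<in> identities \<Gamma>" "x \<in> B"
  shows "loc_one R e \<otimes> x \<in> B"
proof -
  have "B \<subseteq> {x \<in> carrier R. loc_one R e \<otimes> x \<in> B}"
  proof (rule gideal_le[OF assms(1)])
    show "additive_subgroup {x \<in> carrier R. loc_one R e \<otimes> x \<in> B} R"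
      using loc_one_closed[OF assms(2)]
      by (intro vimage_additive_subgroup gidealD(1)[OF assms(1)]) (auto simp: mult_closed right_distrib)
    show "B \<inter> component R \<gamma> \<subseteq> {x \<in> carrier R. loc_one R e \<otimes> x \<in> B}" if "\<gamma> \<in> carrier \<Gamma>" for \<gamma>
      using that gidealD(3)[OF assms(1)] loc_one_mult_component[OF assms(2) that] component_closed
      by auto
  qed
  then show ?thesis using assms by blast
qed

lemma loc_one_idem: "e \<in> identities \<Gamma> \<Longrightarrow> loc_one R e \<otimes> loc_one R e = loc_one R e"
  using loc_one_mult_component[of e e "loc_one R e"] loc_one_component identitiesD by auto

lemma loc_one_at: "e \<in> identities \<Gamma> \<Longrightarrow> loc_one R e \<in> at e"
  by (simp add: at_def loc_one_idem loc_one_closed)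

lemma loc_one_mult_at:
  "e \<in> identities \<Gamma> \<Longrightarrow> x \<in> carrier R \<Longrightarrow> loc_one R e \<otimes> x \<in> at e"
  using mult_assoc[of "loc_one R e" "loc_one R e" x]
  by (simp add: at_def loc_one_idem loc_one_closed mult_closed)

lemma gideal_at:
  assumes "e \<in> identities \<Gamma>"
  shows "gideal (at e)"
proof -
  have o: "loc_one R e \<in> carrier R" using loc_one_closed[OF assms] .
  have "additive_subgroup (at e) R"
    unfolding at_def by (rule equalizer_additive_subgroup) (auto simp: o mult_closed right_distrib)
  moreover have "x \<otimes> a \<in> at e" if "x \<in> at e" "a \<in> carrier R" for x a
    using that o by (auto simp: at_def mult_closed mult_assoc[symmetric])
  moreover have "proj \<gamma> x \<in> at e" if x: "x \<in> at e" and g: "\<gamma> \<in> carrier \<Gamma>" for x \<gamma>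
  proof (cases "tgt \<Gamma> \<gamma> = e")
    case True
    then show ?thesis using component_at[OF g] proj_props(1)[OF g] x by (auto simp: at_def)
  next
    case False
    \<comment> \<open>For every x the part of 1_e x in a degree with range other than e vanishes, as
      homogeneous x show; then x = 1_e x finishes the case.\<close>
    let ?T = "{x \<in> carrier R. proj \<gamma> (loc_one R e \<otimes> x) = \<zero>}"
    have "additive_subgroup ?T R"
      by (rule equalizer_additive_subgroup)
        (auto simp: o g mult_closed right_distrib proj_closed proj_add)
    then have "carrier R \<subseteq> ?T"
    proof (rule carrier_le)
      fix \<delta> assume d: "\<delta> \<in> carrier \<Gamma>"
      show "component R \<delta> \<subseteq> ?T"
      proof
        fix x assume x: "x \<in> component R \<delta>"
        have "proj \<gamma> (loc_one R e \<otimes> x) = \<zero>"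
          using loc_one_mult_component[OF assms d x] proj_other[OF g d _ x] proj_zero[OF g] False
          by auto
        then show "x \<in> ?T" using component_closed[OF d x] by blast
      qed
    qed
    then have "proj \<gamma> x = \<zero>" using x by (auto simp: at_def)
    then show ?thesis using o by (simp add: at_def)
  qed
  ultimately show ?thesis by (simp add: gideal_def)
qed

text \<open>A homogeneous element lies in R(e) for e the range of its degree, so inclusions may be
  tested object by object.\<close>

lemma gideal_le_of_at:
  assumes "gideal B" "gideal T" "\<And>e. e \<in> identities \<Gamma> \<Longrightarrow> B \<inter> at e \<subseteq> T"
  shows "B \<subseteq> T"
proof (rule gideal_le[OF assms(1) gidealD(1)[OF assms(2)]])
  fix \<gamma> assume "\<gamma> \<in> carrier \<Gamma>"
  then show "B \<inter> component R \<gamma> \<subseteq> T"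
    using component_at[of \<gamma>] assms(3)[OF tgt_identity[of \<gamma>]] by blast
qed

text \<open>The kernel of the map from R to R/A that sends x to the class of b x.\<close>

definition colon :: "'r set \<Rightarrow> 'r \<Rightarrow> 'r set" where
  "colon A b = {x \<in> carrier R. b \<otimes> x \<in> A}"

text \<open>Homogeneity of b keeps the preimage graded: by \<open>proj_mult\<close>, b times a
  component of x is a component of b x or zero.\<close>

lemma gideal_colon:
  assumes "gideal A" "\<sigma> \<in> carrier \<Gamma>" "b \<in> component R \<sigma>"
  shows "gideal (colon A b)"
proof -
  have b: "b \<in> carrier R" using assms component_closed by blast
  have "additive_subgroup (colon A b) R" unfolding colon_def
    by (rule vimage_additive_subgroup) (auto simp: b assms gidealD mult_closed right_distrib)
  moreover have "x \<otimes> a \<in> colon A b" if "x \<in> colon A b" "a \<in> carrier R" for x a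
    using that b gidealD(7)[OF assms(1)] by (auto simp: colon_def mult_closed mult_assoc[symmetric])
  moreover have "proj \<tau> x \<in> colon A b" if "x \<in> colon A b" "\<tau> \<in> carrier \<Gamma>" for x \<tau>
  proof (cases "src \<Gamma> \<sigma> = tgt \<Gamma> \<tau>")
    case True
    then show ?thesis
      using that assms proj_mult[OF assms(2) that(2) True assms(3), of x] comp_closed[OF assms(2) that(2) True]
        gidealD(8)[OF assms(1)] proj_closed[OF that(2)]
      by (metis (no_types, lifting) colon_def mem_Collect_eq)
  next
    case False
    have xc: "x \<in> carrier R" using that by (simp add: colon_def)
    have "b \<otimes> proj \<tau> x = \<zero>"
      using component_mult_zero[OF assms(2) that(2) False assms(3)] proj_props(1)[OF that(2) xc] by simp
    then show ?thesis using that proj_closed gidealD(3)[OF assms(1)] by (auto simp: colon_def)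
  qed
  ultimately show ?thesis by (simp add: gideal_def)
qed

definition lmult :: "'r \<Rightarrow> 'r set \<Rightarrow> 'r set" where
  "lmult b S = (\<lambda>a. b \<otimes> a) ` S"

lemma gideal_lmult:
  assumes "gideal S" "\<sigma> \<in> carrier \<Gamma>" "b \<in> component R \<sigma>"
  shows "gideal (lmult b S)"
proof -
  note D = gidealD[OF assms(1)]
  have b: "b \<in> carrier R" using assms component_closed by blast
  have Sc: "s \<in> carrier R" if "s \<in> S" for s using D(2) that by blast
  have "additive_subgroup (lmult b S) R"
    unfolding additive_subgroup_iff lmult_def
  proof (intro conjI ballI)
    show "(\<otimes>) b ` S \<subseteq> carrier R" using b Sc mult_closed by auto
    show "\<zero> \<in> (\<otimes>) b ` S" using D(3) mult_zero_right[OF b] by (metis image_eqI)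
    fix x y assume "x \<in> (\<otimes>) b ` S" "y \<in> (\<otimes>) b ` S"
    then show "x \<oplus> y \<in> (\<otimes>) b ` S" using D(4) right_distrib b Sc by (auto intro!: image_eqI simp flip: right_distrib)
  next
    fix x assume "x \<in> (\<otimes>) b ` S"
    then show "\<ominus> x \<in> (\<otimes>) b ` S" using D(5) b Sc by (auto intro!: image_eqI simp flip: mult_uminus_right)
  qed
  moreover have "x \<otimes> a \<in> lmult b S" if "x \<in> lmult b S" "a \<in> carrier R" for x a
    using that b Sc D(7) by (auto simp: lmult_def mult_assoc)
  moreover have "proj \<gamma> x \<in> lmult b S" if x: "x \<in> lmult b S" and g: "\<gamma> \<in> carrier \<Gamma>" for x \<gamma>
  proof -
    obtain s where s: "s \<in> S" "x = b \<otimes> s" using x by (auto simp: lmult_def)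
    let ?T = "{s \<in> carrier R. proj \<gamma> (b \<otimes> s) \<in> lmult b S}"
    have "additive_subgroup ?T R"
      by (rule vimage_additive_subgroup[OF \<open>additive_subgroup (lmult b S) R\<close>])
        (auto simp: b g mult_closed right_distrib proj_closed proj_add)
    then have "S \<subseteq> ?T"
    proof (rule gideal_le[OF assms(1)], intro subsetI)
      fix \<tau> t assume t: "\<tau> \<in> carrier \<Gamma>" "t \<in> S \<inter> component R \<tau>"
      \<comment> \<open>A product of homogeneous elements is homogeneous or zero, so each of its
        components is the product itself or zero.\<close>
      have "proj \<gamma> (b \<otimes> t) \<in> {\<zero>, b \<otimes> t}"
      proof (cases "src \<Gamma> \<sigma> = tgt \<Gamma> \<tau>")
        case True
        then have "b \<otimes> t \<in> component R (comp \<Gamma> \<sigma> \<tau>)" using component_mult[OF assms(2) t(1)] assms(3) t(2) by blast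
        then show ?thesis using proj_same[OF g] proj_other[OF g comp_closed[OF assms(2) t(1) True]] by blast
      next
        case False
        then have "b \<otimes> t = \<zero>" using component_mult_zero[OF assms(2) t(1)] assms(3) t(2) by blast
        then show ?thesis using proj_zero[OF g] by simp
      qed
      moreover have "\<zero> \<in> lmult b S" using D(3) b mult_zero_right[OF b] by (metis image_eqI lmult_def)
      ultimately have "proj \<gamma> (b \<otimes> t) \<in> lmult b S" using t(2) by (auto simp: lmult_def)
      then show "t \<in> ?T" using t Sc by blast
    qed
    then show ?thesis using s by blast
  qed
  ultimately show ?thesis by (simp add: gideal_def)
qed


subsection \<open>Quotients and the socle\<close>

text \<open>In lattice terms C/A is gr-simple, and no quotient has to be formed.\<close>

definition cover :: "'r set \<Rightarrow> 'r set \<Rightarrow> bool" where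
  "cover A C \<longleftrightarrow> gideal A \<and> gideal C \<and> A \<subset> C \<and>
     (\<forall>D. gideal D \<longrightarrow> A \<subseteq> D \<longrightarrow> D \<subseteq> C \<longrightarrow> D = A \<or> D = C)"

text \<open>The preimage in \<open>R\<close> of the graded socle of \<open>R/A\<close>.\<close>

definition soc_over :: "'r set \<Rightarrow> 'r set" where
  "soc_over A = family_sum R (insert A {C. cover A C}) (\<lambda>C. C)"

lemma gideal_soc_over: "gideal A \<Longrightarrow> gideal (soc_over A)"
  unfolding soc_over_def by (rule gideal_family_sum) (auto simp: cover_def)

lemma soc_over_upper:
  assumes "gideal A"
  shows "A \<subseteq> soc_over A" "cover A C \<Longrightarrow> C \<subseteq> soc_over A"
proof -
  have "C \<subseteq> soc_over A" if "C \<in> insert A {C. cover A C}" for C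
  proof -
    have "gideal C" using that assms by (auto simp: cover_def)
    then show ?thesis
      unfolding soc_over_def using family_sum_upper[OF that, of "\<lambda>C. C"] gidealD(2) by simp
  qed
  then show "A \<subseteq> soc_over A" "cover A C \<Longrightarrow> C \<subseteq> soc_over A" by auto
qed

lemma soc_over_least:
  assumes "additive_subgroup T R" "A \<subseteq> T" "\<And>C. cover A C \<Longrightarrow> C \<subseteq> T"
  shows "soc_over A \<subseteq> T"
  unfolding soc_over_def by (rule family_sum_least) (use assms in auto)

section \<open>The regular module and its graded submodules\<close>

lemma regular_simps [simp]:
  "carrier (regular R) = carrier R" "add (regular R) = add R" "zero (regular R) = zero R"
  "component (regular R) = component R" "act (regular R) = mult R"
  by (simp_all add: regular_def graded.extend_def graded_rmod.fields_def)

lemma abelian_group_regular: "abelian_group (regular R)"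
  by (rule abelian_group_of_additive_subgroup) (auto simp: carrier_additive_subgroup)

lemma additive_subgroup_regular: "additive_subgroup B (regular R) \<longleftrightarrow> additive_subgroup B R"
  using additive_subgroup_transfer[OF abelian_group_regular abelian_group_axioms, of B]
  by (auto dest: additive_subgroup.a_subset)

lemma gideal_decomposition:
  assumes "gideal B"
  shows "B = family_sum R (carrier \<Gamma>) (\<lambda>\<gamma>. B \<inter> component R \<gamma>)"
proof
  have a: "additive_subgroup (B \<inter> component R \<gamma>) R" if "\<gamma> \<in> carrier \<Gamma>" for \<gamma>
    using Int_additive_subgroup gidealD(1)[OF assms] component_additive_subgroup that by blast
  show "B \<subseteq> family_sum R (carrier \<Gamma>) (\<lambda>\<gamma>. B \<inter> component R \<gamma>)"
    using a additive_subgroup.a_subset[OF a]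
    by (intro gideal_le[OF assms] family_sum_additive_subgroup family_sum_upper) blast+
  show "family_sum R (carrier \<Gamma>) (\<lambda>\<gamma>. B \<inter> component R \<gamma>) \<subseteq> B"
    by (rule family_sum_least[OF gidealD(1)[OF assms]]) blast
qed

lemma gideal_direct_sum:
  assumes "gideal B"
  shows "is_direct_sum R (carrier \<Gamma>) (\<lambda>\<gamma>. B \<inter> component R \<gamma>) B"
proof -
  have "additive_subgroup (B \<inter> component R \<gamma>) R" if "\<gamma> \<in> carrier \<Gamma>" for \<gamma>
    using Int_additive_subgroup gidealD(1)[OF assms] component_additive_subgroup that by blast
  then show ?thesis
    using gideal_decomposition[OF assms] ring_decomposition unfolding is_direct_sum_def by blast
qed

lemma gidealI_family_sum:
  assumes "additive_subgroup B R" "\<And>x a. x \<in> B \<Longrightarrow> a \<in> carrier R \<Longrightarrow> x \<otimes> a \<in> B"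
    "B \<subseteq> family_sum R (carrier \<Gamma>) (\<lambda>\<gamma>. B \<inter> component R \<gamma>)"
  shows "gideal B"
proof -
  have "proj \<gamma> x \<in> B" if "x \<in> B" "\<gamma> \<in> carrier \<Gamma>" for x \<gamma>
  proof -
    have "family_sum R (carrier \<Gamma>) (\<lambda>\<gamma>. B \<inter> component R \<gamma>) \<subseteq> {x \<in> carrier R. proj \<gamma> x \<in> B}"
    proof (rule family_sum_least)
      show "additive_subgroup {x \<in> carrier R. proj \<gamma> x \<in> B} R"
        by (rule vimage_additive_subgroup[OF assms(1)]) (simp_all add: that proj_closed proj_add)
      fix \<delta> assume d: "\<delta> \<in> carrier \<Gamma>"
      show "B \<inter> component R \<delta> \<subseteq> {x \<in> carrier R. proj \<gamma> x \<in> B}"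
        using proj_same[OF that(2)] proj_other[OF that(2) d] additive_subgroup.zero_closed[OF assms(1)]
          component_closed[OF d]
        by (cases "\<delta> = \<gamma>") auto
    qed
    then show ?thesis using assms(3) that by blast
  qed
  then show ?thesis using assms by (simp add: gideal_def)
qed

lemma graded_submodule_regular_iff: "graded_submodule \<Gamma> R (regular R) B \<longleftrightarrow> gideal B"
proof -
  have "is_direct_sum (regular R) (carrier \<Gamma>) (\<lambda>\<gamma>. B \<inter> component R \<gamma>) B \<longleftrightarrow>
      is_direct_sum R (carrier \<Gamma>) (\<lambda>\<gamma>. B \<inter> component R \<gamma>) B"
    by (rule is_direct_sum_transfer[OF abelian_group_regular abelian_group_axioms])
      (auto dest: component_closed)
  then show ?thesis
    using gideal_direct_sum[of B] gidealI_family_sum[of B] gidealD(1,7)[of B]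
    by (auto simp: graded_submodule_def rsubmodule_def additive_subgroup_regular is_direct_sum_def)
qed

lemma a_r_coset_regular: "a_r_coset (regular R) = a_r_coset R"
  by (intro ext) (simp add: a_r_coset_def')

lemma a_rcosets_regular: "A_RCOSETS (regular R) = A_RCOSETS R"
  by (intro ext) (simp add: A_RCOSETS_def' a_r_coset_regular)

lemma set_add_regular: "set_add (regular R) = set_add R"
  by (intro ext) (simp add: set_add_def')

end

text \<open>
  \<open>Q\<close> is the quotient \<open>R/A\<close>, over whichever ring \<open>S\<close>: this covers both \<open>R/A\<close> as a right
  \<open>R\<close>-module and \<open>R/A\<close> as a right module over itself.
\<close>

locale graded_quotient = graded_ring \<Gamma> R
  for \<Gamma> :: "'g groupoid" and R :: "('r, 'g) graded" (structure) +
  fixes A :: "'r set" and S :: "('s, 'g) graded" and Q :: "('r set, 'g, 's) graded_rmod"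
  assumes gideal_A: "gideal A"
    and carrier_Q: "carrier Q = a_rcosets A"
    and add_Q: "add Q = set_add R"
    and zero_Q: "zero Q = A"
    and component_Q: "component Q \<gamma> = (\<lambda>a. A +> a) ` component R \<gamma>"
    and act_lift: "\<lbrakk>x \<in> carrier R; s \<in> carrier S\<rbrakk> \<Longrightarrow> \<exists>a\<in>carrier R. act Q (A +> x) s = A +> (x \<otimes> a)"
    and act_represented:
      "\<lbrakk>x \<in> carrier R; a \<in> carrier R\<rbrakk> \<Longrightarrow> \<exists>s\<in>carrier S. act Q (A +> x) s = A +> (x \<otimes> a)"
begin

sublocale A: abelian_subgroup A R
  by (rule abelian_subgroupI3[OF gidealD(1)[OF gideal_A] abelian_group_axioms])

lemma carrier_Q_image: "carrier Q = (\<lambda>x. A +> x) ` carrier R"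
  by (auto simp: carrier_Q A_RCOSETS_def')

lemma add_coset: "x \<in> carrier R \<Longrightarrow> y \<in> carrier R \<Longrightarrow> (A +> x) \<oplus>\<^bsub>Q\<^esub> (A +> y) = A +> (x \<oplus> y)"
  by (simp add: add_Q A.a_rcos_sum)

lemma coset_eq_iff: "x \<in> carrier R \<Longrightarrow> y \<in> carrier R \<Longrightarrow> A +> x = A +> y \<longleftrightarrow> x \<ominus> y \<in> A"
proof -
  assume x: "x \<in> carrier R" and y: "y \<in> carrier R"
  have "A +> x = A +> y \<longleftrightarrow> x \<in> A +> y"
    using A.a_repr_independence'[of x y] A.a_rcos_self[of x] x y by auto
  also have "\<dots> \<longleftrightarrow> x \<ominus> y \<in> A"
  proof
    assume "x \<in> A +> y"
    then obtain h where h: "h \<in> A" "x = h \<oplus> y" by (auto simp: a_r_coset_def')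
    then have "x \<ominus> y = h"
      using add_minus_cancel(1)[of y h] y gidealD(2)[OF gideal_A] by (simp add: a_comm subset_iff)
    then show "x \<ominus> y \<in> A" using h by simp
  next
    assume "x \<ominus> y \<in> A"
    moreover have "x = (x \<ominus> y) \<oplus> y" using add_minus_cancel(2)[OF x y] x y by (simp add: a_comm)
    ultimately show "x \<in> A +> y" unfolding a_r_coset_def' by blast
  qed
  finally show ?thesis .
qed

lemma coset_eq_zero_iff: "x \<in> carrier R \<Longrightarrow> A +> x = A \<longleftrightarrow> x \<in> A"
  using coset_eq_iff[of x \<zero>] a_coset_add_zero[OF gidealD(2)[OF gideal_A]] by (simp add: minus_eq)

lemma abelian_group_Q: "abelian_group Q"
proof (rule abelian_groupI)
  show "x \<oplus>\<^bsub>Q\<^esub> y \<in> carrier Q" if "x \<in> carrier Q" "y \<in> carrier Q" for x y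
    using that by (auto simp: carrier_Q_image add_coset)
  show "\<zero>\<^bsub>Q\<^esub> \<in> carrier Q"
    using coset_eq_zero_iff[of \<zero>] gidealD(3)[OF gideal_A]
    by (auto simp: carrier_Q_image zero_Q intro!: image_eqI[of _ _ \<zero>])
  show "x \<oplus>\<^bsub>Q\<^esub> y \<oplus>\<^bsub>Q\<^esub> z = x \<oplus>\<^bsub>Q\<^esub> (y \<oplus>\<^bsub>Q\<^esub> z)"
    if "x \<in> carrier Q" "y \<in> carrier Q" "z \<in> carrier Q" for x y z
    using that by (auto simp: carrier_Q_image add_coset a_assoc)
  show "x \<oplus>\<^bsub>Q\<^esub> y = y \<oplus>\<^bsub>Q\<^esub> x" if "x \<in> carrier Q" "y \<in> carrier Q" for x y
    using that by (auto simp: carrier_Q_image add_coset a_comm)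
  have zero: "\<zero>\<^bsub>Q\<^esub> = A +> \<zero>" using coset_eq_zero_iff[of \<zero>] gidealD(3)[OF gideal_A] by (simp add: zero_Q)
  show "\<zero>\<^bsub>Q\<^esub> \<oplus>\<^bsub>Q\<^esub> x = x" if "x \<in> carrier Q" for x
    using that zero by (auto simp: carrier_Q_image add_coset)
  show "\<exists>y\<in>carrier Q. y \<oplus>\<^bsub>Q\<^esub> x = \<zero>\<^bsub>Q\<^esub>" if x: "x \<in> carrier Q" for x
  proof -
    obtain a where a: "a \<in> carrier R" "x = A +> a" using x carrier_Q_image by auto
    then have "(A +> (\<ominus> a)) \<oplus>\<^bsub>Q\<^esub> x = \<zero>\<^bsub>Q\<^esub>" using zero by (simp add: add_coset l_neg)
    then show ?thesis using a carrier_Q_image by blast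
  qed
qed

sublocale Q: abelian_group Q
  by (rule abelian_group_Q)

lemma zero_coset: "\<zero>\<^bsub>Q\<^esub> = A +> \<zero>"
  using coset_eq_zero_iff[of \<zero>] gidealD(3)[OF gideal_A] by (simp add: zero_Q)

lemma coset_closed: "x \<in> carrier R \<Longrightarrow> A +> x \<in> carrier Q"
  by (simp add: carrier_Q_image)

lemma uminus_coset: "x \<in> carrier R \<Longrightarrow> \<ominus>\<^bsub>Q\<^esub> (A +> x) = A +> (\<ominus> x)"
  by (rule Q.minus_equality) (simp_all add: add_coset l_neg zero_coset coset_closed)

lemma finsum_coset:
  assumes "finite F" "\<And>i. i \<in> F \<Longrightarrow> f i \<in> carrier R"
  shows "finsum Q (\<lambda>i. A +> f i) F = A +> finsum R f F"
  using assms
proof (induction F)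
  case empty
  then show ?case by (simp add: zero_coset)
next
  case (insert i F)
  then have "f \<in> F \<rightarrow> carrier R" "f i \<in> carrier R" "(\<lambda>i. A +> f i) \<in> F \<rightarrow> carrier Q" "A +> f i \<in> carrier Q"
    by (auto simp: coset_closed)
  then show ?case using insert by (simp add: add_coset)
qed

lemma additive_subgroup_preimage:
  assumes "additive_subgroup N Q"
  shows "additive_subgroup {x \<in> carrier R. A +> x \<in> N} R"
proof -
  have "\<zero>\<^bsub>Q\<^esub> \<in> N" "\<And>x y. x \<in> N \<Longrightarrow> y \<in> N \<Longrightarrow> x \<oplus>\<^bsub>Q\<^esub> y \<in> N" "\<And>x. x \<in> N \<Longrightarrow> \<ominus>\<^bsub>Q\<^esub> x \<in> N"
    using assms by (simp_all add: Q.additive_subgroup_iff)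
  then show ?thesis unfolding additive_subgroup_iff
    by (auto simp: zero_coset simp flip: add_coset uminus_coset)
qed

lemma additive_subgroup_image:
  assumes "additive_subgroup B R"
  shows "additive_subgroup ((\<lambda>x. A +> x) ` B) Q"
proof -
  have D: "B \<subseteq> carrier R" "\<zero> \<in> B" "\<And>x y. x \<in> B \<Longrightarrow> y \<in> B \<Longrightarrow> x \<oplus> y \<in> B" "\<And>x. x \<in> B \<Longrightarrow> \<ominus> x \<in> B"
    using assms by (simp_all add: additive_subgroup_iff)
  then have c: "x \<in> carrier R" if "x \<in> B" for x using that by blast
  show ?thesis unfolding Q.additive_subgroup_iff using D c
    by (auto simp: zero_coset coset_closed add_coset uminus_coset)
qed

text \<open>Since A \<subseteq> B, the set B is a union of cosets of A, so the choice of
  representative does not matter.\<close>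

lemma mem_image_iff:
  assumes "gideal B" "A \<subseteq> B" "x \<in> carrier R"
  shows "A +> x \<in> (\<lambda>x. A +> x) ` B \<longleftrightarrow> x \<in> B"
proof
  assume "A +> x \<in> (\<lambda>x. A +> x) ` B"
  then obtain b where b: "b \<in> B" "A +> x = A +> b" by blast
  then have bc: "b \<in> carrier R" using gidealD(2)[OF assms(1)] by blast
  then have "x \<ominus> b \<in> B" using b coset_eq_iff assms by blast
  then have "b \<oplus> (x \<ominus> b) \<in> B" using gidealD(4)[OF assms(1)] b by blast
  then show "x \<in> B" using add_minus_cancel(2)[OF assms(3) bc] by simp
qed blast

text \<open>One half of the correspondence between graded submodules of Q and graded right ideals
  above A.\<close>

lemma gideal_preimage:
  assumes N: "graded_submodule \<Gamma> S Q N"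
  shows "gideal {x \<in> carrier R. A +> x \<in> N}" "A \<subseteq> {x \<in> carrier R. A +> x \<in> N}"
    "N = (\<lambda>x. A +> x) ` {x \<in> carrier R. A +> x \<in> N}"
proof -
  let ?B = "{x \<in> carrier R. A +> x \<in> N}"
  have a: "additive_subgroup N Q" and act: "\<And>X s. X \<in> N \<Longrightarrow> s \<in> carrier S \<Longrightarrow> act Q X s \<in> N"
    and dec: "N = family_sum Q (carrier \<Gamma>) (\<lambda>\<gamma>. N \<inter> component Q \<gamma>)"
    using N by (auto simp: graded_submodule_def rsubmodule_def is_direct_sum_def)
  have B: "additive_subgroup ?B R" by (rule additive_subgroup_preimage[OF a])
  have AB: "A \<subseteq> ?B"
  proof
    fix x assume x: "x \<in> A"
    then have xc: "x \<in> carrier R" using gidealD(2)[OF gideal_A] by blast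
    then have "A +> x = \<zero>\<^bsub>Q\<^esub>" using coset_eq_zero_iff x zero_Q by simp
    then show "x \<in> ?B" using xc additive_subgroup.zero_closed[OF a] by simp
  qed
  then show "A \<subseteq> ?B" .
  show "N = (\<lambda>x. A +> x) ` ?B"
    using additive_subgroup.a_subset[OF a] carrier_Q_image by auto
  have right: "x \<otimes> a \<in> ?B" if xa: "x \<in> ?B" "a \<in> carrier R" for x a
  proof -
    have x: "x \<in> carrier R" "A +> x \<in> N" using xa by auto
    obtain s where "s \<in> carrier S" "act Q (A +> x) s = A +> (x \<otimes> a)"
      using act_represented[OF x(1) xa(2)] by blast
    then show ?thesis using act[OF x(2)] x(1) xa(2) mult_closed by force
  qed
  have graded: "proj \<gamma> x \<in> ?B" if x: "x \<in> ?B" and g: "\<gamma> \<in> carrier \<Gamma>" for x \<gamma>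
  proof -
    have xc: "x \<in> carrier R" "A +> x \<in> N" using x by auto
    then obtain f F where f: "A +> x = finsum Q f F" "finite F" "F \<subseteq> carrier \<Gamma>"
      "\<forall>i\<in>F. f i \<in> N \<inter> component Q i"
      using dec unfolding family_sum_def by blast
    \<comment> \<open>Homogeneous representatives of the summands add up to x modulo A. As A is
      graded, the components of x agree with these representatives modulo A.\<close>
    have "\<forall>i\<in>F. \<exists>b\<in>component R i. f i = A +> b" using f(4) component_Q by blast
    then obtain b where b: "\<And>i. i \<in> F \<Longrightarrow> b i \<in> component R i" "\<And>i. i \<in> F \<Longrightarrow> f i = A +> b i"
      by metis
    have bc: "b i \<in> carrier R" if "i \<in> F" for i using b(1) that f(3) component_closed by blast
    have bB: "b i \<in> ?B" if "i \<in> F" for i using b(2) f(4) bc that by auto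
    let ?y = "finsum R b F"
    have yc: "?y \<in> carrier R" using bc by (intro finsum_closed) blast
    have "A +> x = finsum Q (\<lambda>i. A +> b i) F"
      unfolding f(1) using b(2) bc coset_closed by (intro Q.finsum_cong') auto
    then have "A +> x = A +> ?y" using finsum_coset[OF f(2) bc] by simp
    then have xy: "x \<ominus> ?y \<in> A" using coset_eq_iff xc yc by simp
    have "x = ?y \<oplus> (x \<ominus> ?y)" using add_minus_cancel xc yc by simp
    then have px: "proj \<gamma> x = proj \<gamma> ?y \<oplus> proj \<gamma> (x \<ominus> ?y)"
      using proj_add[OF g yc, of "x \<ominus> ?y"] xy gidealD(2)[OF gideal_A] by auto
    have p1: "proj \<gamma> (x \<ominus> ?y) \<in> ?B" using gidealD(8)[OF gideal_A xy g] AB by blast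
    have p2: "proj \<gamma> ?y \<in> ?B"
    proof (cases "\<gamma> \<in> F")
      case True
      then show ?thesis using proj_finsum[OF f(2,3) b(1)] bB by simp
    next
      case False
      have o: "additive_subgroup {y \<in> carrier R. proj \<gamma> y \<in> {\<zero>}} R"
        by (rule vimage_additive_subgroup[OF zero_additive_subgroup])
          (simp_all add: g proj_closed proj_add)
      have "?y \<in> {y \<in> carrier R. proj \<gamma> y \<in> {\<zero>}}"
        using False f(3) b(1) bc proj_other[OF g] by (intro finsum_in_additive_subgroup[OF o f(2)]) blast
      then show ?thesis using additive_subgroup.zero_closed[OF B] by simp
    qed
    show ?thesis unfolding px by (rule additive_subgroup.a_closed[OF B p2 p1])
  qed
  show "gideal ?B" using B right graded by (simp add: gideal_def)
qed

text \<open>The other half of the correspondence. Directness survives in Q because a vanishing sum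
  lifts to an element of A, and all components of that element lie in A.\<close>

lemma graded_submodule_image:
  assumes "gideal B" "A \<subseteq> B"
  shows "graded_submodule \<Gamma> S Q ((\<lambda>x. A +> x) ` B)"
proof -
  let ?\<pi> = "\<lambda>x. A +> x"
  have Bc: "x \<in> carrier R" if "x \<in> B" for x using gidealD(2)[OF assms(1)] that by blast
  \<comment> \<open>A homogeneous representative of a coset from the image already lies in B,
    because B contains A.\<close>
  have comp: "?\<pi> ` B \<inter> component Q \<gamma> = ?\<pi> ` (B \<inter> component R \<gamma>)" if g: "\<gamma> \<in> carrier \<Gamma>" for \<gamma>
  proof
    show "?\<pi> ` B \<inter> component Q \<gamma> \<subseteq> ?\<pi> ` (B \<inter> component R \<gamma>)"
    proof
      fix X assume X: "X \<in> ?\<pi> ` B \<inter> component Q \<gamma>"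
      then obtain a where a: "a \<in> component R \<gamma>" "X = A +> a" by (auto simp: component_Q)
      then have "a \<in> B" using X mem_image_iff[OF assms] component_closed[OF g] by auto
      then show "X \<in> ?\<pi> ` (B \<inter> component R \<gamma>)" using a by blast
    qed
  qed (auto simp: component_Q)
  have a: "additive_subgroup (?\<pi> ` B \<inter> component Q \<gamma>) Q" if g: "\<gamma> \<in> carrier \<Gamma>" for \<gamma>
    unfolding comp[OF g]
    by (intro additive_subgroup_image Int_additive_subgroup gidealD(1)[OF assms(1)] component_additive_subgroup g)
  have aB: "additive_subgroup (?\<pi> ` B) Q" by (rule additive_subgroup_image[OF gidealD(1)[OF assms(1)]])
  have act: "act Q X s \<in> ?\<pi> ` B" if X: "X \<in> ?\<pi> ` B" and s: "s \<in> carrier S" for X s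
  proof -
    obtain x where x: "x \<in> B" "X = A +> x" using X by blast
    then show ?thesis using act_lift[OF Bc[OF x(1)] s] gidealD(7)[OF assms(1) x(1)] by auto
  qed
  have h1: "?\<pi> ` B \<subseteq> family_sum Q (carrier \<Gamma>) (\<lambda>\<gamma>. ?\<pi> ` B \<inter> component Q \<gamma>)" (is "_ \<subseteq> ?F")
  proof -
    have F: "additive_subgroup ?F Q" by (rule Q.family_sum_additive_subgroup[OF a])
    have "B \<subseteq> {x \<in> carrier R. A +> x \<in> ?F}"
    proof (rule gideal_le[OF assms(1) additive_subgroup_preimage[OF F]])
      fix \<gamma> assume g: "\<gamma> \<in> carrier \<Gamma>"
      have "?\<pi> ` B \<inter> component Q \<gamma> \<subseteq> ?F"
        using Q.family_sum_upper[OF g, of "\<lambda>\<gamma>. ?\<pi> ` B \<inter> component Q \<gamma>"]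
          additive_subgroup.a_subset[OF a[OF g]] by blast
      then show "B \<inter> component R \<gamma> \<subseteq> {x \<in> carrier R. A +> x \<in> ?F}"
        using comp[OF g] Bc by blast
    qed
    then show ?thesis by blast
  qed
  have h2: "?F \<subseteq> ?\<pi> ` B"
    by (rule Q.family_sum_least[OF aB]) blast
  have h3: "\<forall>i\<in>F. f i = \<zero>\<^bsub>Q\<^esub>"
    if f: "finite F" "F \<subseteq> carrier \<Gamma>" "\<forall>i\<in>F. f i \<in> ?\<pi> ` B \<inter> component Q i" "finsum Q f F = \<zero>\<^bsub>Q\<^esub>" for f F
  proof -
    have "\<forall>i\<in>F. \<exists>b\<in>component R i. f i = A +> b" using f(3) component_Q by blast
    then obtain b where b: "\<And>i. i \<in> F \<Longrightarrow> b i \<in> component R i" "\<And>i. i \<in> F \<Longrightarrow> f i = A +> b i"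
      by metis
    have bc: "b i \<in> carrier R" if "i \<in> F" for i using b(1) that f(2) component_closed by blast
    let ?y = "finsum R b F"
    have yc: "?y \<in> carrier R" using bc by (intro finsum_closed) blast
    have "finsum Q f F = finsum Q (\<lambda>i. A +> b i) F"
      using b(2) bc coset_closed by (intro Q.finsum_cong') auto
    then have "A +> ?y = A" using finsum_coset[OF f(1) bc] f(4) zero_Q by simp
    then have "?y \<in> A" using coset_eq_zero_iff yc by simp
    then have "b i \<in> A" if "i \<in> F" for i
      using gidealD(8)[OF gideal_A, of ?y i] proj_finsum[OF f(1,2) b(1) that] that f(2) by auto
    then show ?thesis using b(2) bc coset_eq_zero_iff zero_Q by simp
  qed
  show ?thesis
    unfolding graded_submodule_def rsubmodule_def is_direct_sum_def
  proof (intro conjI ballI allI impI)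
    show "?\<pi> ` B = ?F" using h1 h2 by (rule subset_antisym)
  next
    fix f F i
    assume "finite F \<and> F \<subseteq> carrier \<Gamma> \<and> (\<forall>i\<in>F. f i \<in> ?\<pi> ` B \<inter> component Q i) \<and> finsum Q f F = \<zero>\<^bsub>Q\<^esub>"
      and "i \<in> F"
    then show "f i = \<zero>\<^bsub>Q\<^esub>" using h3[of F f] by simp
  qed (rule aB act a; assumption)+
qed

text \<open>The correspondence preserves inclusions, so gr-simple submodules of Q match the graded
  right ideals minimal above A.\<close>

lemma gr_simple_submodules_Q:
  "gr_simple_submodules \<Gamma> S Q = (\<lambda>C. (\<lambda>x. A +> x) ` C) ` {C. cover A C}"
proof
  let ?\<pi> = "\<lambda>x. A +> x"
  have inj: "B = C" if "gideal B" "A \<subseteq> B" "gideal C" "A \<subseteq> C" "?\<pi> ` B = ?\<pi> ` C" for B C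
  proof -
    have "x \<in> B \<longleftrightarrow> x \<in> C" if "x \<in> carrier R" for x
      using mem_image_iff that \<open>gideal B\<close> \<open>A \<subseteq> B\<close> \<open>gideal C\<close> \<open>A \<subseteq> C\<close> \<open>?\<pi> ` B = ?\<pi> ` C\<close> by metis
    then show ?thesis using gidealD(2) \<open>gideal B\<close> \<open>gideal C\<close> by blast
  qed
  have zero: "?\<pi> ` A = {\<zero>\<^bsub>Q\<^esub>}"
  proof -
    have "A +> x = A" if "x \<in> A" for x using that coset_eq_zero_iff gidealD(2)[OF gideal_A] by blast
    then have "?\<pi> ` A \<subseteq> {A}" by auto
    moreover have "?\<pi> ` A \<noteq> {}" using gidealD(3)[OF gideal_A] by blast
    ultimately show ?thesis unfolding zero_Q by blast
  qed
  show "gr_simple_submodules \<Gamma> S Q \<subseteq> (\<lambda>C. ?\<pi> ` C) ` {C. cover A C}"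
  proof
    fix N assume "N \<in> gr_simple_submodules \<Gamma> S Q"
    then have N: "graded_submodule \<Gamma> S Q N" "N \<noteq> {\<zero>\<^bsub>Q\<^esub>}"
      "\<And>K. graded_submodule \<Gamma> S Q K \<Longrightarrow> K \<subseteq> N \<Longrightarrow> K = {\<zero>\<^bsub>Q\<^esub>} \<or> K = N"
      using gr_simple_submodules_iff[OF abelian_group_Q] by blast+
    obtain C where C: "gideal C" "A \<subseteq> C" "N = ?\<pi> ` C" using gideal_preimage[OF N(1)] by blast
    have "D = A \<or> D = C" if D: "gideal D" "A \<subseteq> D" "D \<subseteq> C" for D
    proof -
      have "?\<pi> ` D = {\<zero>\<^bsub>Q\<^esub>} \<or> ?\<pi> ` D = N"
        using N(3) graded_submodule_image[OF D(1,2)] C(3) D(3) by blast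
      then show ?thesis using inj[OF D(1,2) gideal_A] inj[OF D(1,2) C(1,2)] C(3) zero by auto
    qed
    moreover have "A \<noteq> C" using N(2) C(3) zero by blast
    ultimately have "cover A C" using C gideal_A unfolding cover_def by blast
    then show "N \<in> (\<lambda>C. ?\<pi> ` C) ` {C. cover A C}" using C by blast
  qed
  show "(\<lambda>C. ?\<pi> ` C) ` {C. cover A C} \<subseteq> gr_simple_submodules \<Gamma> S Q"
  proof
    fix N assume "N \<in> (\<lambda>C. ?\<pi> ` C) ` {C. cover A C}"
    then obtain C where cov: "cover A C" and N: "N = ?\<pi> ` C" by blast
    then have C: "gideal C" "A \<subseteq> C" "A \<noteq> C" and
      max: "\<And>D. gideal D \<Longrightarrow> A \<subseteq> D \<Longrightarrow> D \<subseteq> C \<Longrightarrow> D = A \<or> D = C"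
      unfolding cover_def by blast+
    have "K = {\<zero>\<^bsub>Q\<^esub>} \<or> K = N" if K: "graded_submodule \<Gamma> S Q K" "K \<subseteq> N" for K
    proof -
      obtain D where D: "gideal D" "A \<subseteq> D" "K = ?\<pi> ` D" using gideal_preimage[OF K(1)] by blast
      have "D \<subseteq> C"
      proof
        fix x assume x: "x \<in> D"
        then have "A +> x \<in> ?\<pi> ` C" using D(3) K(2) N by blast
        then show "x \<in> C" using mem_image_iff[OF C(1,2)] x gidealD(2)[OF D(1)] by blast
      qed
      then show ?thesis using max[OF D(1,2)] D(3) N zero by blast
    qed
    moreover have "N \<noteq> {\<zero>\<^bsub>Q\<^esub>}" using inj[OF C(1,2) gideal_A] C(3) zero N by auto
    moreover have "graded_submodule \<Gamma> S Q N" unfolding N by (rule graded_submodule_image[OF C(1,2)])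
    ultimately show "N \<in> gr_simple_submodules \<Gamma> S Q"
      by (simp add: gr_simple_submodules_iff[OF abelian_group_Q])
  qed
qed

text \<open>A is itself a summand of \<open>soc_over A\<close>, so the sum is the full preimage even
  when nothing covers A.\<close>

lemma gr_soc_Q: "{x \<in> carrier R. A +> x \<in> gr_soc \<Gamma> S Q} = soc_over A"
proof
  let ?\<pi> = "\<lambda>x. A +> x"
  have cov: "gideal C" "A \<subseteq> C" if "cover A C" for C using that by (auto simp: cover_def)
  have img: "additive_subgroup N Q" if "N \<in> (\<lambda>C. ?\<pi> ` C) ` {C. cover A C}" for N
    using that additive_subgroup_image gidealD(1)[OF cov(1)] by auto
  have soc: "gr_soc \<Gamma> S Q = family_sum Q ((\<lambda>C. ?\<pi> ` C) ` {C. cover A C}) (\<lambda>S. S)"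
    by (simp add: gr_soc_def gr_simple_submodules_Q)
  have sub: "additive_subgroup (gr_soc \<Gamma> S Q) Q"
    unfolding soc by (rule Q.family_sum_additive_subgroup[OF img])
  show "soc_over A \<subseteq> {x \<in> carrier R. A +> x \<in> gr_soc \<Gamma> S Q}"
  proof (rule soc_over_least[OF additive_subgroup_preimage[OF sub]])
    show "A \<subseteq> {x \<in> carrier R. A +> x \<in> gr_soc \<Gamma> S Q}"
    proof
      fix x assume x: "x \<in> A"
      then have "x \<in> carrier R" using gidealD(2)[OF gideal_A] by blast
      moreover from this have "A +> x = \<zero>\<^bsub>Q\<^esub>" using coset_eq_zero_iff x zero_Q by simp
      ultimately show "x \<in> {x \<in> carrier R. A +> x \<in> gr_soc \<Gamma> S Q}"
        using additive_subgroup.zero_closed[OF sub] by simp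
    qed
    fix C assume C: "cover A C"
    have "?\<pi> ` C \<in> (\<lambda>C. ?\<pi> ` C) ` {C. cover A C}" using C by blast
    then have "?\<pi> ` C \<subseteq> gr_soc \<Gamma> S Q"
      unfolding soc using Q.family_sum_upper additive_subgroup.a_subset[OF img] by metis
    then show "C \<subseteq> {x \<in> carrier R. A +> x \<in> gr_soc \<Gamma> S Q}"
      using gidealD(2)[OF cov(1)[OF C]] by blast
  qed
  have g: "gideal (soc_over A)" by (rule gideal_soc_over[OF gideal_A])
  have "gr_soc \<Gamma> S Q \<subseteq> ?\<pi> ` soc_over A" unfolding soc
    using soc_over_upper(2)[OF gideal_A]
    by (intro Q.family_sum_least additive_subgroup_image gidealD(1)[OF g]) auto
  then show "{x \<in> carrier R. A +> x \<in> gr_soc \<Gamma> S Q} \<subseteq> soc_over A"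
    using mem_image_iff[OF g soc_over_upper(1)[OF gideal_A]] by blast
qed

end

section \<open>Quotients of R as a module and as a ring\<close>

context graded_ring
begin

text \<open>The action on a coset is a union over its representatives. It is a single coset since A
  is a right ideal.\<close>

lemma graded_quotient_quot_rmod:
  assumes A: "gideal A"
  shows "graded_quotient \<Gamma> R A R (quot_rmod (regular R) A)"
proof -
  interpret A: abelian_subgroup A R
    by (rule abelian_subgroupI3[OF gidealD(1)[OF A] abelian_group_axioms])
  have act: "act (quot_rmod (regular R) A) (A +> x) a = A +> (x \<otimes> a)"
    if x: "x \<in> carrier R" and a: "a \<in> carrier R" for x a
  proof -
    have "A +> (y \<otimes> a) = A +> (x \<otimes> a)" if y: "y \<in> A +> x" for y
    proof -
      obtain h where h: "h \<in> A" "y = h \<oplus> x" using y by (auto simp: a_r_coset_def')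
      have hc: "h \<in> carrier R" using h gidealD(2)[OF A] by blast
      have "y \<otimes> a = h \<otimes> a \<oplus> x \<otimes> a" using h hc x a left_distrib by simp
      moreover have "h \<otimes> a \<in> A" using gidealD(7)[OF A h(1) a] .
      ultimately have "y \<otimes> a \<in> A +> (x \<otimes> a)" by (auto simp: a_r_coset_def')
      then show ?thesis using A.a_repr_independence'[of "y \<otimes> a" "x \<otimes> a"] x a by (simp add: mult_closed)
    qed
    then have "(\<Union>y\<in>A +> x. A +> (y \<otimes> a)) = (\<Union>y\<in>A +> x. A +> (x \<otimes> a))" by simp
    \<comment> \<open>The union of a constant family is its value only over a nonempty index
      set.\<close>
    moreover have "A +> x \<noteq> {}" using A.a_rcos_self[OF x] by blast
    ultimately show ?thesis
      by (simp add: quot_rmod_def graded.extend_def graded_rmod.fields_def a_r_coset_regular)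
  qed
  show ?thesis
    by unfold_locales
      (auto simp: A act, auto simp: quot_rmod_def graded.extend_def graded_rmod.fields_def graded_quot_def
        ring.extend_def graded.fields_def FactRing_def a_r_coset_regular a_rcosets_regular set_add_regular)
qed

text \<open>Independence of the second representative of a product of cosets is where A has to be a
  left ideal as well.\<close>

lemma graded_quotient_graded_quot:
  assumes A: "gideal A" and left: "\<And>x a. x \<in> carrier R \<Longrightarrow> a \<in> A \<Longrightarrow> x \<otimes> a \<in> A"
  shows "graded_quotient \<Gamma> R A (graded_quot R A) (regular (graded_quot R A))"
proof -
  interpret A: abelian_subgroup A R
    by (rule abelian_subgroupI3[OF gidealD(1)[OF A] abelian_group_axioms])
  have mult: "rcoset_mult R A (A +> x) (A +> a) = A +> (x \<otimes> a)"
    if x: "x \<in> carrier R" and a: "a \<in> carrier R" for x a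
  proof -
    have "A +> (y \<otimes> b) = A +> (x \<otimes> a)" if y: "y \<in> A +> x" and b: "b \<in> A +> a" for y b
    proof -
      obtain h where h: "h \<in> A" "y = h \<oplus> x" using y by (auto simp: a_r_coset_def')
      obtain k where k: "k \<in> A" "b = k \<oplus> a" using b by (auto simp: a_r_coset_def')
      have c: "h \<in> carrier R" "k \<in> carrier R" using h k gidealD(2)[OF A] by blast+
      have "y \<otimes> b = (h \<otimes> b \<oplus> x \<otimes> k) \<oplus> x \<otimes> a"
        using h k c x a left_distrib right_distrib a_ac mult_closed by simp
      moreover have "h \<otimes> b \<oplus> x \<otimes> k \<in> A"
        using gidealD(4)[OF A] gidealD(7)[OF A h(1)] left[OF x k(1)] k c a by blast
      ultimately have "y \<otimes> b \<in> A +> (x \<otimes> a)" unfolding a_r_coset_def' by blast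
      then show ?thesis using A.a_repr_independence'[of "y \<otimes> b" "x \<otimes> a"] x a by (simp add: mult_closed)
    qed
    then have "(\<Union>y\<in>A +> x. \<Union>b\<in>A +> a. A +> (y \<otimes> b)) = (\<Union>y\<in>A +> x. \<Union>b\<in>A +> a. A +> (x \<otimes> a))"
      by simp
    moreover have "A +> x \<noteq> {}" "A +> a \<noteq> {}" using A.a_rcos_self x a by blast+
    ultimately show ?thesis unfolding rcoset_mult_def by simp
  qed
  have simps: "carrier (graded_quot R A) = a_rcosets A" "mult (graded_quot R A) = rcoset_mult R A"
    "add (graded_quot R A) = set_add R" "zero (graded_quot R A) = A"
    "component (graded_quot R A) = (\<lambda>\<gamma>. (\<lambda>a. A +> a) ` component R \<gamma>)"
    by (simp_all add: graded_quot_def ring.extend_def graded.fields_def FactRing_def)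
  have car: "a_rcosets A = (\<lambda>x. A +> x) ` carrier R" by (auto simp: A_RCOSETS_def')
  have reg: "carrier (regular S) = carrier S" "add (regular S) = add S" "zero (regular S) = zero S"
    "component (regular S) = component S" "act (regular S) = mult S" for S :: "('x, 'y) graded"
    by (simp_all add: regular_def graded.extend_def graded_rmod.fields_def)
  show ?thesis
    by unfold_locales (auto simp: A reg simps mult car)
qed

text \<open>This removes quotient records from the socle series: it is the iteration of
  \<open>soc_over\<close> from zero.\<close>

lemma gr_soc_iter_Suc:
  assumes "gideal (gr_soc_iter \<Gamma> R (regular R) n)"
  shows "gr_soc_iter \<Gamma> R (regular R) (Suc n) = soc_over (gr_soc_iter \<Gamma> R (regular R) n)"
  using graded_quotient.gr_soc_Q[OF graded_quotient_quot_rmod[OF assms]] by (simp add: a_r_coset_regular)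

lemma gideal_gr_soc_iter: "gideal (gr_soc_iter \<Gamma> R (regular R) n)"
proof (induction n)
  case 0
  then show ?case using gideal_zero by simp
next
  case (Suc n)
  then show ?case using gr_soc_iter_Suc gideal_soc_over by metis
qed

text \<open>\<open>gr_soc_Q\<close> holds over whichever ring acts, so semisimplicity of the ring
  R/A is read off from the same \<open>soc_over A\<close> as over R.\<close>

lemma gr_semisimple_quotient_iff:
  assumes A: "gideal A" and left: "\<And>x a. x \<in> carrier R \<Longrightarrow> a \<in> A \<Longrightarrow> x \<otimes> a \<in> A"
  shows "gr_semisimple_ring \<Gamma> (graded_quot R A) \<longleftrightarrow> soc_over A = carrier R"
proof -
  interpret Q: graded_quotient \<Gamma> R A "graded_quot R A" "regular (graded_quot R A)"
    by (rule graded_quotient_graded_quot[OF assms])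
  show ?thesis
    unfolding gr_semisimple_ring_def gr_semisimple_iff[OF Q.abelian_group_Q] Q.carrier_Q_image
    using Q.gr_soc_Q by auto
qed

lemma piece_submod_regular:
  assumes B: "gideal B" and e: "e \<in> identities \<Gamma>"
  shows "piece \<Gamma> (submod (regular R) B) e = B \<inter> at e"
proof -
  have Br: "additive_subgroup B (regular R)" using gidealD(1)[OF B] additive_subgroup_regular by simp
  have ab: "abelian_group (submod (regular R) B)"
    by (rule abelian_group_submod[OF abelian_group_regular Br])
  let ?I = "{\<gamma> \<in> carrier \<Gamma>. tgt \<Gamma> \<gamma> = e}"
  have "piece \<Gamma> (submod (regular R) B) e = family_sum R ?I (\<lambda>\<gamma>. B \<inter> component R \<gamma>)" (is "_ = ?F")
    unfolding piece_def submod_simps regular_simps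
    by (rule family_sum_transfer[OF ab abelian_group_axioms]) (use gidealD(2)[OF B] in auto)
  moreover have "?F \<subseteq> B \<inter> at e"
    using component_at
    by (intro family_sum_least gidealD(1) gideal_Int B gideal_at e) blast
  moreover have "B \<inter> at e \<subseteq> ?F"
  proof -
    have a: "additive_subgroup (B \<inter> component R \<gamma>) R" if "\<gamma> \<in> carrier \<Gamma>" for \<gamma>
      using Int_additive_subgroup gidealD(1)[OF B] component_additive_subgroup that by blast
    have F: "additive_subgroup ?F R" by (rule family_sum_additive_subgroup) (use a in auto)
    \<comment> \<open>Left multiplication by 1_e keeps components with range e and kills the others,
      so it maps B into the sum; it fixes \<open>at e\<close>.\<close>
    have "B \<subseteq> {x \<in> carrier R. loc_one R e \<otimes> x \<in> ?F}"
    proof (rule gideal_le[OF B])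
      show "additive_subgroup {x \<in> carrier R. loc_one R e \<otimes> x \<in> ?F} R"
        by (rule vimage_additive_subgroup[OF F]) (simp_all add: loc_one_closed[OF e] mult_closed right_distrib)
      fix \<gamma> assume g: "\<gamma> \<in> carrier \<Gamma>"
      show "B \<inter> component R \<gamma> \<subseteq> {x \<in> carrier R. loc_one R e \<otimes> x \<in> ?F}"
      proof (cases "tgt \<Gamma> \<gamma> = e")
        case True
        then have "B \<inter> component R \<gamma> \<subseteq> ?F"
          using g additive_subgroup.a_subset[OF a[OF g]]
            family_sum_upper[of \<gamma> ?I "\<lambda>\<gamma>. B \<inter> component R \<gamma>"] by blast
        then show ?thesis using loc_one_mult_component[OF e g] True component_closed[OF g] by auto
      next
        case False
        then show ?thesis using loc_one_mult_component[OF e g] component_closed[OF g]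
            additive_subgroup.zero_closed[OF F] by auto
      qed
    qed
    then show ?thesis by (auto simp: at_def)
  qed
  ultimately show ?thesis by blast
qed

lemma piece_regular: "e \<in> identities \<Gamma> \<Longrightarrow> piece \<Gamma> (regular R) e = at e"
proof -
  assume e: "e \<in> identities \<Gamma>"
  have ab: "abelian_group (submod (regular R) (carrier R))"
    by (rule abelian_group_submod[OF abelian_group_regular]) (simp add: additive_subgroup_regular carrier_additive_subgroup)
  \<comment> \<open>Regarding \<open>regular R\<close> as its own full submodule only intersects
    each component with the carrier, and then \<open>piece_submod_regular\<close> applies.\<close>
  have "piece \<Gamma> (regular R) e = piece \<Gamma> (submod (regular R) (carrier R)) e"
    unfolding piece_def submod_simps regular_simps
    using component_closed
    by (subst family_sum_transfer[OF ab abelian_group_regular])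
      (auto simp: subset_iff intro!: family_sum_cong)
  then show ?thesis using piece_submod_regular[OF gideal_carrier e] by (auto simp: at_def)
qed

lemma graded_submodule_submod_regular_iff:
  assumes "gideal B"
  shows "graded_submodule \<Gamma> R (submod (regular R) B) N \<longleftrightarrow> gideal N \<and> N \<subseteq> B"
  using graded_submodule_submod[OF abelian_group_regular, of B] gidealD(1)[OF assms]
  by (simp add: additive_subgroup_regular graded_submodule_regular_iff)


subsection \<open>The radical\<close>

lemma coverD:
  assumes "cover A C"
  shows "gideal A" "gideal C" "A \<subseteq> C" "A \<noteq> C"
    "\<And>D. gideal D \<Longrightarrow> A \<subseteq> D \<Longrightarrow> D \<subseteq> C \<Longrightarrow> D = A \<or> D = C"
  using assms by (auto simp: cover_def)

lemma coverI:
  assumes "gideal A" "gideal C" "A \<subseteq> C" "\<not> C \<subseteq> A"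
    "\<And>D. gideal D \<Longrightarrow> A \<subseteq> D \<Longrightarrow> D \<subseteq> C \<Longrightarrow> \<not> D \<subseteq> A \<Longrightarrow> C \<subseteq> D"
  shows "cover A C"
  unfolding cover_def
proof (intro conjI allI impI)
  show "A \<subset> C" using assms by auto
  fix D assume "gideal D" "A \<subseteq> D" "D \<subseteq> C"
  then show "D = A \<or> D = C" using assms(5)[of D] by auto
qed (use assms in auto)

lemma gr_maximal_right_ideal_iff: "gr_maximal_right_ideal \<Gamma> R I \<longleftrightarrow> cover I (carrier R)"
proof
  assume m: "gr_maximal_right_ideal \<Gamma> R I"
  then have I: "gideal I" "I \<noteq> carrier R"
    and max: "\<And>K. gideal K \<Longrightarrow> I \<subseteq> K \<Longrightarrow> K \<noteq> carrier R \<Longrightarrow> K = I"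
    by (auto simp: gr_maximal_right_ideal_def graded_submodule_regular_iff)
  show "cover I (carrier R)"
  proof (rule coverI)
    show "I \<subseteq> carrier R" "\<not> carrier R \<subseteq> I" using I(2) gidealD(2)[OF I(1)] by auto
    show "carrier R \<subseteq> D" if "gideal D" "I \<subseteq> D" "\<not> D \<subseteq> I" for D
      using max[OF that(1,2)] that(3) by auto
  qed (simp_all add: I gideal_carrier)
next
  assume c: "cover I (carrier R)"
  show "gr_maximal_right_ideal \<Gamma> R I"
    unfolding gr_maximal_right_ideal_def graded_submodule_regular_iff
    using coverD[OF c] gidealD(2) by auto
qed

lemma gideal_rad: "gideal (gr_rad \<Gamma> R)"
proof -
  \<comment> \<open>The inserted carrier keeps the family nonempty even if R has no gr-maximal right
    ideal.\<close>
  have "gr_rad \<Gamma> R = \<Inter>(insert (carrier R) {I. cover I (carrier R)})"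
    by (auto simp: gr_rad_def gr_maximal_right_ideal_iff)
  then show ?thesis
    using gideal_Inter[of "insert (carrier R) {I. cover I (carrier R)}"] gideal_carrier coverD(1) by auto
qed

lemma rad_closed: "j \<in> gr_rad \<Gamma> R \<Longrightarrow> j \<in> carrier R"
  by (simp add: gr_rad_def)

lemma rad_le: "cover I (carrier R) \<Longrightarrow> gr_rad \<Gamma> R \<subseteq> I"
  by (auto simp: gr_rad_def gr_maximal_right_ideal_iff)

lemma component_mult_homogeneous:
  assumes "\<sigma> \<in> carrier \<Gamma>" "b \<in> component R \<sigma>" "\<tau> \<in> carrier \<Gamma>" "y \<in> component R \<tau>"
  obtains \<gamma> where "\<gamma> \<in> carrier \<Gamma>" "b \<otimes> y \<in> component R \<gamma>"
proof (cases "src \<Gamma> \<sigma> = tgt \<Gamma> \<tau>")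
  case True
  then show ?thesis using that component_mult[of \<sigma> \<tau>] comp_closed[of \<sigma> \<tau>] assms by blast
next
  case False
  then have "b \<otimes> y = \<zero>" using component_mult_zero assms by blast
  \<comment> \<open>A zero product may be assigned any degree; \<sigma> will do.\<close>
  then show ?thesis
    using that[OF assms(1)] additive_subgroup.zero_closed[OF component_additive_subgroup[OF assms(1)]] by simp
qed

text \<open>A homogeneous element generates itself through b = b 1_d, although R need not have an
  identity.\<close>

lemma mem_lmult_self: "\<sigma> \<in> carrier \<Gamma> \<Longrightarrow> b \<in> component R \<sigma> \<Longrightarrow> b \<in> lmult b (carrier R)"
  using loc_one_right[of \<sigma> b] loc_one_closed[OF src_identity] unfolding lmult_def by (metis image_eqI)

lemma lmult_le: "gideal B \<Longrightarrow> b \<in> B \<Longrightarrow> lmult b (carrier R) \<subseteq> B"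
  using gidealD(7)[of B b] by (auto simp: lmult_def)

lemma gideal_le_homogeneous:
  assumes "gideal B" "gideal T" "\<And>\<gamma> x. \<gamma> \<in> carrier \<Gamma> \<Longrightarrow> x \<in> B \<Longrightarrow> x \<in> component R \<gamma> \<Longrightarrow> x \<in> T"
  shows "B \<subseteq> T"
  by (rule gideal_le[OF assms(1) gidealD(1)[OF assms(2)]]) (use assms(3) in auto)

text \<open>
  Left multiplication by a homogeneous \<open>b \<in> C\<close> embeds \<open>R/(A : b)\<close> into the gr-simple module \<open>C/A\<close>.
\<close>

lemma cover_colon:
  assumes cov: "cover A C" and s: "\<sigma> \<in> carrier \<Gamma>" and b: "b \<in> component R \<sigma>" "b \<in> C"
  shows "colon A b = carrier R \<or> cover (colon A b) (carrier R)"
proof (cases "carrier R \<subseteq> colon A b")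
  case True
  then show ?thesis by (auto simp: colon_def)
next
  case False
  note A = coverD(1)[OF cov] and C = coverD(2)[OF cov]
  have bc: "b \<in> carrier R" using b s component_closed by blast
  have g: "gideal (colon A b)" by (rule gideal_colon[OF A s b(1)])
  have "cover (colon A b) (carrier R)"
  proof (rule coverI[OF g gideal_carrier gidealD(2)[OF g] False])
    fix D assume D: "gideal D" "colon A b \<subseteq> D" "\<not> D \<subseteq> colon A b"
    obtain \<tau> y where y: "\<tau> \<in> carrier \<Gamma>" "y \<in> D" "y \<in> component R \<tau>" "y \<notin> colon A b"
      using gideal_le_homogeneous[OF D(1) g] D(3) by blast
    have yc: "y \<in> carrier R" using y component_closed by blast
    have by_nA: "b \<otimes> y \<notin> A" using y(4) yc by (simp add: colon_def)
    have by_C: "b \<otimes> y \<in> C" using gidealD(7)[OF C b(2) yc] .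
    obtain \<gamma> where g': "\<gamma> \<in> carrier \<Gamma>" "b \<otimes> y \<in> component R \<gamma>"
      using component_mult_homogeneous[OF s b(1) y(1,3)] .
    let ?L = "lmult (b \<otimes> y) (carrier R)"
    have L: "gideal ?L" by (rule gideal_lmult[OF gideal_carrier g'])
    have E: "gideal (A <+>\<^bsub>R\<^esub> ?L)" by (rule gideal_add[OF A L])
    have "b \<otimes> y \<in> A <+>\<^bsub>R\<^esub> ?L" using add_upper2[OF A L] mem_lmult_self[OF g'] by blast
    moreover have "A <+>\<^bsub>R\<^esub> ?L \<subseteq> C"
      by (rule add_least[OF C coverD(3)[OF cov] lmult_le[OF C by_C]])
    \<comment> \<open>Since b y lies in C but not in A, nothing smaller than C can contain both A
      and b y.\<close>
    ultimately have CE: "C = A <+>\<^bsub>R\<^esub> ?L"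
      using coverD(5)[OF cov E add_upper1[OF A L]] by_nA by auto
    show "carrier R \<subseteq> D"
    proof
      fix x assume x: "x \<in> carrier R"
      have "b \<otimes> x \<in> A <+>\<^bsub>R\<^esub> ?L" using gidealD(7)[OF C b(2) x] CE by simp
      then obtain a r where a: "a \<in> A" and r: "r \<in> carrier R" and eq: "b \<otimes> x = a \<oplus> (b \<otimes> y) \<otimes> r"
        by (auto simp: mem_set_add_iff lmult_def)
      have ac: "a \<in> carrier R" using a gidealD(2)[OF A] by blast
      have yr: "y \<otimes> r \<in> carrier R" using yc r by (rule mult_closed)
      \<comment> \<open>Thus x differs from y r, which lies in D, by an element of (A : b), and D
        contains that ideal too.\<close>
      have "b \<otimes> (x \<ominus> y \<otimes> r) = b \<otimes> x \<ominus> (b \<otimes> y) \<otimes> r"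
        using bc x yc r yr by (simp add: minus_eq right_distrib mult_uminus_right mult_assoc)
      also have "\<dots> = a"
        using eq ac bc yc r mult_closed add_minus_cancel(1)[of "(b \<otimes> y) \<otimes> r" a] by (simp add: a_comm)
      finally have "x \<ominus> y \<otimes> r \<in> colon A b" using a x yr by (simp add: colon_def)
      then have "y \<otimes> r \<oplus> (x \<ominus> y \<otimes> r) \<in> D"
        using D(2) gidealD(4)[OF D(1) gidealD(7)[OF D(1) y(2) r]] by blast
      then show "x \<in> D" using add_minus_cancel(2)[OF x yr] by simp
    qed
  qed
  then show ?thesis ..
qed

text \<open>\<open>colon A x\<close> is known to be graded for homogeneous x only; additivity in x
  carries conclusions over to all of C.\<close>

lemma gideal_mult_le:
  assumes "gideal C" "gideal A" "j \<in> carrier R"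
    "\<And>\<gamma> x. \<gamma> \<in> carrier \<Gamma> \<Longrightarrow> x \<in> C \<Longrightarrow> x \<in> component R \<gamma> \<Longrightarrow> x \<otimes> j \<in> A" "x \<in> C"
  shows "x \<otimes> j \<in> A"
proof -
  have "C \<subseteq> {x \<in> carrier R. x \<otimes> j \<in> A}"
  proof (rule gideal_le[OF assms(1)])
    show "additive_subgroup {x \<in> carrier R. x \<otimes> j \<in> A} R"
      by (rule vimage_additive_subgroup[OF gidealD(1)[OF assms(2)]])
        (simp_all add: assms(3) mult_closed left_distrib)
    show "C \<inter> component R \<gamma> \<subseteq> {x \<in> carrier R. x \<otimes> j \<in> A}" if "\<gamma> \<in> carrier \<Gamma>" for \<gamma>
      using assms(4)[OF that] component_closed[OF that] by auto
  qed
  then show ?thesis using assms(5) by blast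
qed

text \<open>Modulo A, the annihilator of a homogeneous element of C is R or gr-maximal, and J lies
  in either. So J annihilates gr-simple modules.\<close>

lemma cover_rad:
  assumes cov: "cover A C" and x: "x \<in> C" and j: "j \<in> gr_rad \<Gamma> R"
  shows "x \<otimes> j \<in> A"
proof (rule gideal_mult_le[OF coverD(2,1)[OF cov] rad_closed[OF j] _ x])
  fix \<gamma> y assume "\<gamma> \<in> carrier \<Gamma>" "y \<in> C" "y \<in> component R \<gamma>"
  then have "colon A y = carrier R \<or> cover (colon A y) (carrier R)" using cover_colon[OF cov] by blast
  then have "j \<in> colon A y" using rad_le rad_closed[OF j] j by blast
  then show "y \<otimes> j \<in> A" by (simp add: colon_def)
qed

text \<open>J annihilates R/I for each gr-maximal I, hence R J lies in every such I.\<close>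

lemma rad_left_ideal:
  assumes "x \<in> carrier R" "j \<in> gr_rad \<Gamma> R"
  shows "x \<otimes> j \<in> gr_rad \<Gamma> R"
  using assms cover_rad[OF _ assms] rad_closed mult_closed
  by (auto simp: gr_rad_def[of \<Gamma> R] gr_maximal_right_ideal_iff)

text \<open>J annihilates each gr-simple summand of the socle of R/A; this is the step by which J
  descends the socle series.\<close>

lemma soc_over_rad:
  assumes A: "gideal A" and x: "x \<in> soc_over A" and j: "j \<in> gr_rad \<Gamma> R"
  shows "x \<otimes> j \<in> A"
proof -
  have "soc_over A \<subseteq> {x \<in> carrier R. x \<otimes> j \<in> A}"
  proof (rule soc_over_least)
    show "additive_subgroup {x \<in> carrier R. x \<otimes> j \<in> A} R"
      by (rule vimage_additive_subgroup[OF gidealD(1)[OF A]])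
        (simp_all add: rad_closed[OF j] mult_closed left_distrib)
    show "A \<subseteq> {x \<in> carrier R. x \<otimes> j \<in> A}"
      using gidealD(2,7)[OF A] rad_closed[OF j] by auto
    show "C \<subseteq> {x \<in> carrier R. x \<otimes> j \<in> A}" if "cover A C" for C
      using cover_rad[OF that _ j] gidealD(2)[OF coverD(2)[OF that]] by auto
  qed
  then show ?thesis using x by blast
qed

text \<open>\<open>B/A\<close> is gr-semisimple, stated without choosing a family of gr-simple submodules.\<close>

definition semisimple :: "'r set \<Rightarrow> 'r set \<Rightarrow> bool" where
  "semisimple A B \<longleftrightarrow> gideal A \<and> gideal B \<and> A \<subseteq> B \<and>
     (\<forall>T. gideal T \<longrightarrow> A \<subseteq> T \<longrightarrow> (\<forall>C. cover A C \<longrightarrow> C \<subseteq> B \<longrightarrow> C \<subseteq> T) \<longrightarrow> B \<subseteq> T)"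

lemma semisimpleD:
  assumes "semisimple A B"
  shows "gideal A" "gideal B" "A \<subseteq> B"
    "\<And>T. gideal T \<Longrightarrow> A \<subseteq> T \<Longrightarrow> (\<And>C. cover A C \<Longrightarrow> C \<subseteq> B \<Longrightarrow> C \<subseteq> T) \<Longrightarrow> B \<subseteq> T"
  using assms by (auto simp: semisimple_def)

lemma semisimple_le_soc_over:
  assumes "semisimple A B"
  shows "B \<subseteq> soc_over A"
proof -
  note A = semisimpleD(1)[OF assms]
  show ?thesis
    by (rule semisimpleD(4)[OF assms gideal_soc_over[OF A] soc_over_upper(1)[OF A] soc_over_upper(2)[OF A]])
qed

text \<open>Left multiplication by b induces a map from S/J onto (A + b S)/A, well defined by
  \<open>bJ\<close>, and a nonzero image of a gr-simple module is gr-simple.\<close>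

lemma cover_lmult:
  assumes cov: "cover J S" and A: "gideal A" and s: "\<sigma> \<in> carrier \<Gamma>" and b: "b \<in> component R \<sigma>"
    and bJ: "\<And>j. j \<in> J \<Longrightarrow> b \<otimes> j \<in> A" and n: "\<not> lmult b S \<subseteq> A"
  shows "cover A (A <+>\<^bsub>R\<^esub> lmult b S)"
proof -
  note S = coverD(2)[OF cov]
  have bc: "b \<in> carrier R" using b s component_closed by blast
  have L: "gideal (lmult b S)" by (rule gideal_lmult[OF S s b])
  show ?thesis
  proof (rule coverI[OF A gideal_add[OF A L] add_upper1[OF A L]])
    show "\<not> A <+>\<^bsub>R\<^esub> lmult b S \<subseteq> A" using add_upper2[OF A L] n by blast
    fix D assume D: "gideal D" "A \<subseteq> D" "D \<subseteq> A <+>\<^bsub>R\<^esub> lmult b S" "\<not> D \<subseteq> A"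
    \<comment> \<open>The pullback of D to S lies between J and S, so it equals one of them.\<close>
    have E: "gideal (S \<inter> colon D b)" by (rule gideal_Int[OF S gideal_colon[OF D(1) s b]])
    have "J \<subseteq> S \<inter> colon D b"
      using coverD(3)[OF cov] bJ D(2) gidealD(2)[OF coverD(1)[OF cov]] by (auto simp: colon_def)
    then have "S \<inter> colon D b = J \<or> S \<inter> colon D b = S" using coverD(5)[OF cov E] by blast
    moreover have "S \<inter> colon D b \<noteq> J"
    proof
      assume EJ: "S \<inter> colon D b = J"
      \<comment> \<open>If the pullback is J, each a + b s in D has s in J, whence b s lies in
        A.\<close>
      have "D \<subseteq> A"
      proof
        fix x assume x: "x \<in> D"
        then have "x \<in> A <+>\<^bsub>R\<^esub> lmult b S" using D(3) by blast
        then obtain a s where as: "a \<in> A" "s \<in> S" "x = a \<oplus> b \<otimes> s"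
          by (auto simp: mem_set_add_iff lmult_def)
        have sc: "s \<in> carrier R" using as(2) gidealD(2)[OF S] by blast
        have ac: "a \<in> carrier R" using as(1) gidealD(2)[OF A] by blast
        have "x \<ominus> a = b \<otimes> s" using as(3) ac bc sc by (simp add: add_minus_cancel mult_closed)
        moreover have "x \<ominus> a \<in> D" using as(1) D(2) by (intro gidealD(6)[OF D(1) x]) blast
        ultimately have "b \<otimes> s \<in> D" by simp
        then have "s \<in> J" using EJ as(2) sc by (auto simp: colon_def)
        then show "x \<in> A" using bJ as gidealD(4)[OF A] by blast
      qed
      then show False using D(4) by blast
    qed
    ultimately have "S \<subseteq> colon D b" by blast
    then show "A <+>\<^bsub>R\<^esub> lmult b S \<subseteq> D"
      by (intro add_least D) (auto simp: lmult_def colon_def)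
  qed
qed

text \<open>
  A module annihilated by \<open>J\<close> is a sum of homomorphic images of \<open>R/J\<close>, so it is gr-semisimple if \<open>R/J\<close> is.
\<close>

lemma semisimple_layer:
  assumes semi: "soc_over J = carrier R" and J: "gideal J"
    and A: "gideal A" and B: "gideal B" and AB: "A \<subseteq> B"
    and BJ: "\<And>x j. x \<in> B \<Longrightarrow> j \<in> J \<Longrightarrow> x \<otimes> j \<in> A"
  shows "semisimple A B"
  unfolding semisimple_def
proof (intro conjI allI impI A B AB)
  fix T assume T: "gideal T" "A \<subseteq> T" and cov: "\<forall>C. cover A C \<longrightarrow> C \<subseteq> B \<longrightarrow> C \<subseteq> T"
  show "B \<subseteq> T"
  proof (rule gideal_le_homogeneous[OF B T(1)])
    fix \<gamma> b assume b: "\<gamma> \<in> carrier \<Gamma>" "b \<in> B" "b \<in> component R \<gamma>"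
    have "soc_over J \<subseteq> colon T b"
    proof (rule soc_over_least[OF gidealD(1)[OF gideal_colon[OF T(1) b(1,3)]]])
      show "J \<subseteq> colon T b" using BJ[OF b(2)] T(2) gidealD(2)[OF J] by (auto simp: colon_def)
      fix S assume S: "cover J S"
      note gS = coverD(2)[OF S]
      have L: "gideal (lmult b S)" by (rule gideal_lmult[OF gS b(1,3)])
      have "lmult b S \<subseteq> T"
      proof (cases "lmult b S \<subseteq> A")
        case True
        then show ?thesis using T(2) by blast
      next
        case False
        have c: "cover A (A <+>\<^bsub>R\<^esub> lmult b S)"
          by (rule cover_lmult[OF S A b(1,3) _ False]) (rule BJ[OF b(2)])
        have "lmult b S \<subseteq> B"
          using gidealD(2)[OF gS] gidealD(7)[OF B b(2)] by (auto simp: lmult_def)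
        then have "A <+>\<^bsub>R\<^esub> lmult b S \<subseteq> B" by (rule add_least[OF B AB])
        then have "A <+>\<^bsub>R\<^esub> lmult b S \<subseteq> T" using cov c by blast
        then show ?thesis using add_upper2[OF A L] by blast
      qed
      then show "S \<subseteq> colon T b" using gidealD(2)[OF gS] by (auto simp: lmult_def colon_def)
    qed
    \<comment> \<open>The local identity at the domain of the degree of b serves as the 1 in b = b
      1.\<close>
    then have "loc_one R (src \<Gamma> \<gamma>) \<in> colon T b"
      using semi loc_one_closed[OF src_identity[OF b(1)]] by blast
    then show "b \<in> T" using loc_one_right[OF b(1,3)] by (simp add: colon_def)
  qed
qed

subsection \<open>Finite length\<close>

text \<open>(D + C)/D is isomorphic to C/(C \<inter> D), and C \<inter> D = A because C/A is
  gr-simple and C is not inside D.\<close>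

lemma cover_join:
  assumes cov: "cover A C" and D: "gideal D" "A \<subseteq> D" "\<not> C \<subseteq> D"
  shows "cover D (D <+>\<^bsub>R\<^esub> C)"
proof -
  note C = coverD(2)[OF cov]
  show ?thesis
  proof (rule coverI[OF D(1) gideal_add[OF D(1) C] add_upper1[OF D(1) C]])
    show "\<not> D <+>\<^bsub>R\<^esub> C \<subseteq> D" using add_upper2[OF D(1) C] D(3) by blast
    fix E assume E: "gideal E" "D \<subseteq> E" "E \<subseteq> D <+>\<^bsub>R\<^esub> C" "\<not> E \<subseteq> D"
    have "C \<inter> E = A \<or> C \<inter> E = C"
      using coverD(5)[OF cov gideal_Int[OF C E(1)]] coverD(3)[OF cov] D(2) E(2) by blast
    moreover have "C \<inter> E \<noteq> A"
    proof
      assume "C \<inter> E = A"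
      then have "(D <+>\<^bsub>R\<^esub> C) \<inter> E \<subseteq> D"
        using modular[OF D(1) C E(1,2)] add_least[OF D(1) order_refl D(2)] by auto
      then show False using E(3,4) by blast
    qed
    ultimately show "D <+>\<^bsub>R\<^esub> C \<subseteq> E" by (intro add_least E) blast
  qed
qed

text \<open>Dual to \<open>cover_join\<close>: K/(K \<inter> L) is isomorphic to (L + K)/L =
  B/L.\<close>

lemma cover_meet:
  assumes cov: "cover L B" and K: "gideal K" "K \<subseteq> B" "\<not> K \<subseteq> L"
  shows "cover (K \<inter> L) K"
proof -
  note L = coverD(1)[OF cov] and B = coverD(2)[OF cov]
  show ?thesis
  proof (rule coverI[OF gideal_Int[OF K(1) L] K(1)])
    show "\<not> K \<subseteq> K \<inter> L" using K(3) by blast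
    fix E assume E: "gideal E" "K \<inter> L \<subseteq> E" "E \<subseteq> K" "\<not> E \<subseteq> K \<inter> L"
    have "L <+>\<^bsub>R\<^esub> E = L \<or> L <+>\<^bsub>R\<^esub> E = B"
      using coverD(5)[OF cov gideal_add[OF L E(1)] add_upper1[OF L E(1)]]
        add_least[OF B coverD(3)[OF cov], of E] E(3) K(2) by blast
    moreover have "L <+>\<^bsub>R\<^esub> E \<noteq> L" using add_upper2[OF L E(1)] E(3,4) by blast
    ultimately have LE: "K \<subseteq> L <+>\<^bsub>R\<^esub> E" using K(2) by blast
    have "L <+>\<^bsub>R\<^esub> E \<subseteq> E <+>\<^bsub>R\<^esub> L"
      by (intro add_least gideal_add add_upper1 add_upper2 L E(1))
    then have "K \<subseteq> (E <+>\<^bsub>R\<^esub> L) \<inter> K" using LE by blast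
    also have "\<dots> \<subseteq> E <+>\<^bsub>R\<^esub> (L \<inter> K)" by (rule modular[OF E(1) L K(1) E(3)])
    also have "\<dots> \<subseteq> E" using E(2) by (intro add_least E(1)) auto
    finally show "K \<subseteq> E" .
  qed blast
qed

text \<open>Well-foundedness of this relation is the descending chain condition for B/A, that of its
  converse the ascending one.\<close>

definition lt :: "'r set \<Rightarrow> 'r set \<Rightarrow> ('r set \<times> 'r set) set" where
  "lt A B = {(C, D). gideal C \<and> gideal D \<and> A \<subseteq> C \<and> C \<subset> D \<and> D \<subseteq> B}"

lemma lt_mono: "A' \<subseteq> A \<Longrightarrow> B \<subseteq> B' \<Longrightarrow> lt A B \<subseteq> lt A' B'"
  unfolding lt_def by auto

text \<open>
  Strict inclusions in \<open>[A, C]\<close> are detected lexicographically: first by the intersection with \<open>B\<close>,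
  then by whether the term lies in \<open>B\<close>.
\<close>

lemma lt_extend:
  assumes cov: "cover B C" and AB: "A \<subseteq> B" and lt: "(D, D') \<in> lt A C"
  shows "(D \<inter> B, D' \<inter> B) \<in> lt A B \<or> D \<inter> B = D' \<inter> B \<and> D \<subseteq> B \<and> \<not> D' \<subseteq> B"
proof (cases "D \<inter> B = D' \<inter> B")
  case True
  note B = coverD(1)[OF cov] and C = coverD(2)[OF cov]
  have D: "gideal D" "gideal D'" "A \<subseteq> D" "D \<subseteq> D'" "D \<noteq> D'" "D' \<subseteq> C" using lt by (auto simp: lt_def)
  \<comment> \<open>Otherwise the modular law and the equal traces on B would force D' \<subseteq>
    D.\<close>
  have ne: "\<not> D' \<subseteq> D <+>\<^bsub>R\<^esub> B"
  proof
    assume "D' \<subseteq> D <+>\<^bsub>R\<^esub> B"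
    then have "D' \<subseteq> (D <+>\<^bsub>R\<^esub> B) \<inter> D'" by blast
    also have "\<dots> \<subseteq> D <+>\<^bsub>R\<^esub> (B \<inter> D')" by (rule modular[OF D(1) B D(2,4)])
    also have "\<dots> \<subseteq> D" using True by (intro add_least D(1)) auto
    finally show False using D(4,5) by blast
  qed
  have "D <+>\<^bsub>R\<^esub> B = B \<or> D <+>\<^bsub>R\<^esub> B = C"
    using coverD(5)[OF cov gideal_add[OF D(1) B] add_upper2[OF D(1) B]]
      add_least[OF C _ coverD(3)[OF cov], of D] D(4,6) by blast
  then have "D <+>\<^bsub>R\<^esub> B = B" using ne D(6) by blast
  then have "D \<subseteq> B" "\<not> D' \<subseteq> B" using add_upper1[OF D(1) B] ne by auto
  then show ?thesis using True by blast
next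
  case False
  have D: "gideal D" "gideal D'" "A \<subseteq> D" "D \<subseteq> D'" using lt by (auto simp: lt_def)
  have "(D \<inter> B, D' \<inter> B) \<in> lt A B"
    using gideal_Int[OF D(1) coverD(1)[OF cov]] gideal_Int[OF D(2) coverD(1)[OF cov]] D AB False
    by (auto simp: lt_def)
  then show ?thesis ..
qed

text \<open>\<open>cover\<^sup>*\<^sup>* A B\<close> is a composition series of B/A. Along it, the
  lexicographic detection carries both chain conditions up one cover at a time.\<close>

lemma finite_length_wf:
  assumes "cover\<^sup>*\<^sup>* A B"
  shows "A \<subseteq> B \<and> wf (lt A B) \<and> wf ((lt A B)\<inverse>)"
  using assms
proof (induction rule: rtranclp_induct)
  case base
  have "lt A A = {}" by (auto simp: lt_def)
  then show ?case by simp
next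
  case (step B C)
  then have AB: "A \<subseteq> B" and dcc: "wf (lt A B)" and acc: "wf ((lt A B)\<inverse>)" and cov: "cover B C" by auto
  let ?f = "\<lambda>D. (D \<inter> B, if D \<subseteq> B then 0 else 1 :: nat)"
  \<comment> \<open>For ascending chains the larger ideal counts as the smaller element, so the
    values 0 and 1 are exchanged.\<close>
  let ?g = "\<lambda>D. (D \<inter> B, if D \<subseteq> B then 1 else 0 :: nat)"
  have sub1: "lt A C \<subseteq> inv_image (lt A B <*lex*> less_than) ?f"
  proof
    fix p assume "p \<in> lt A C"
    then obtain D D' where p: "p = (D, D')" "(D, D') \<in> lt A C" by (cases p) auto
    show "p \<in> inv_image (lt A B <*lex*> less_than) ?f"
      using lt_extend[OF cov AB p(2)] p(1) by auto
  qed
  have w1: "wf (lt A C)"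
    by (rule wf_subset[OF _ sub1]) (intro wf_inv_image wf_lex_prod dcc wf_less_than)
  have sub2: "(lt A C)\<inverse> \<subseteq> inv_image ((lt A B)\<inverse> <*lex*> less_than) ?g"
  proof
    fix p assume "p \<in> (lt A C)\<inverse>"
    then obtain D D' where p: "p = (D', D)" "(D, D') \<in> lt A C" by auto
    show "p \<in> inv_image ((lt A B)\<inverse> <*lex*> less_than) ?g"
      using lt_extend[OF cov AB p(2)] p(1) by auto
  qed
  have w2: "wf ((lt A C)\<inverse>)"
    by (rule wf_subset[OF _ sub2]) (intro wf_inv_image wf_lex_prod acc wf_less_than)
  show ?case using w1 w2 AB coverD(3)[OF cov] by blast
qed

text \<open>Take D maximal among the ideals reached from A by covers. It contains every C with C/A
  gr-simple, as D + C would otherwise be one cover further, so D = B by semisimplicity.\<close>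

lemma finite_length_if_acc:
  assumes ss: "semisimple A B" and acc: "wf ((lt A B)\<inverse>)"
  shows "cover\<^sup>*\<^sup>* A B"
proof -
  let ?X = "{D. cover\<^sup>*\<^sup>* A D \<and> gideal D \<and> A \<subseteq> D \<and> D \<subseteq> B}"
  have AX: "A \<in> ?X" using semisimpleD(1-3)[OF ss] by simp
  obtain D where D: "D \<in> ?X" and max: "\<And>E. (E, D) \<in> (lt A B)\<inverse> \<Longrightarrow> E \<notin> ?X"
    by (rule wfE_min[OF acc AX]) (rule that)
  have "B \<subseteq> D"
  proof (rule semisimpleD(4)[OF ss])
    fix C assume C: "cover A C" "C \<subseteq> B"
    show "C \<subseteq> D"
    proof (rule ccontr)
      assume n: "\<not> C \<subseteq> D"
      have c: "cover D (D <+>\<^bsub>R\<^esub> C)" using cover_join[OF C(1) _ _ n] D by blast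
      have "D <+>\<^bsub>R\<^esub> C \<subseteq> B" using add_least[OF semisimpleD(2)[OF ss]] D C(2) by blast
      then have "(D, D <+>\<^bsub>R\<^esub> C) \<in> lt A B" "D <+>\<^bsub>R\<^esub> C \<in> ?X"
        using D coverD[OF c] c by (auto simp: lt_def intro: rtranclp.rtrancl_into_rtrancl)
      then show False using max by blast
    qed
  qed (use D in auto)
  then have "D = B" using D by blast
  then show ?thesis using D by blast
qed

text \<open>Zorn's lemma provides the coatoms for \<open>semisimple_coatom\<close> and for
  Nakayama's lemma, neither of which has a chain condition at hand.\<close>

lemma ex_maximal_avoiding:
  assumes A: "gideal A" "A \<subseteq> B" "x \<notin> A"
  obtains L where "gideal L" "A \<subseteq> L" "L \<subseteq> B" "x \<notin> L"
    "\<And>E. gideal E \<Longrightarrow> L \<subset> E \<Longrightarrow> E \<subseteq> B \<Longrightarrow> x \<in> E"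
proof -
  let ?S = "{L. gideal L \<and> A \<subseteq> L \<and> L \<subseteq> B \<and> x \<notin> L}"
  have "\<exists>L\<in>?S. \<forall>E\<in>?S. L \<subseteq> E \<longrightarrow> E = L"
  proof (rule subset_Zorn_nonempty)
    show "?S \<noteq> {}" using A by blast
    fix \<C> assume C: "\<C> \<noteq> {}" "subset.chain ?S \<C>"
    then have sub: "\<And>L. L \<in> \<C> \<Longrightarrow> L \<in> ?S" and ch: "\<And>L E. L \<in> \<C> \<Longrightarrow> E \<in> \<C> \<Longrightarrow> L \<subseteq> E \<or> E \<subseteq> L"
      by (auto simp: subset_chain_def)
    have "gideal (\<Union>\<C>)" by (rule gideal_chain_Union[OF C(1) _ ch]) (use sub in auto)
    then show "\<Union>\<C> \<in> ?S" using sub C(1) by blast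
  qed
  then obtain L where L: "L \<in> ?S" and max: "\<forall>E\<in>?S. L \<subseteq> E \<longrightarrow> E = L"
    by (elim bexE) (rule that)
  show ?thesis
  proof (rule that[of L])
    fix E assume E: "gideal E" "L \<subset> E" "E \<subseteq> B"
    show "x \<in> E"
    proof (rule ccontr)
      assume "x \<notin> E"
      then have "E \<in> ?S" using E L by auto
      then show False using max E(2) by auto
    qed
  qed (use L in auto)
qed

text \<open>Let L be maximal without x, and E strictly above L, so that x lies in E. If C/A is
  gr-simple and C is not inside L, then L + C covers L and contains x; so E meets L + C in more than
  L and contains C. Hence E = B.\<close>

lemma semisimple_coatom:
  assumes ss: "semisimple A B" and x: "x \<in> B" "x \<notin> A"
  obtains L where "cover L B" "A \<subseteq> L" "x \<notin> L"
proof -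
  note B = semisimpleD(2)[OF ss]
  obtain L where L: "gideal L" "A \<subseteq> L" "L \<subseteq> B" "x \<notin> L"
    and max: "\<And>E. gideal E \<Longrightarrow> L \<subset> E \<Longrightarrow> E \<subseteq> B \<Longrightarrow> x \<in> E"
    using ex_maximal_avoiding[OF semisimpleD(1,3)[OF ss] x(2)] by blast
  have "cover L B"
  proof (rule coverI[OF L(1) B L(3)])
    show "\<not> B \<subseteq> L" using x L by blast
    fix E assume E: "gideal E" "L \<subseteq> E" "E \<subseteq> B" "\<not> E \<subseteq> L"
    have xE: "x \<in> E" using max[OF E(1) _ E(3)] E(2,4) by blast
    show "B \<subseteq> E"
    proof (rule semisimpleD(4)[OF ss E(1)])
      show "A \<subseteq> E" using L E by blast
      fix C assume C: "cover A C" "C \<subseteq> B"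
      note gC = coverD(2)[OF C(1)]
      show "C \<subseteq> E"
      proof (cases "C \<subseteq> L")
        case True
        then show ?thesis using E by blast
      next
        case False
        have c: "cover L (L <+>\<^bsub>R\<^esub> C)" by (rule cover_join[OF C(1) L(1,2) False])
        have "L <+>\<^bsub>R\<^esub> C \<subseteq> B" by (rule add_least[OF B L(3) C(2)])
        then have "x \<in> L <+>\<^bsub>R\<^esub> C" using max[OF coverD(2)[OF c]] coverD(3,4)[OF c] by blast
        then have "E \<inter> (L <+>\<^bsub>R\<^esub> C) = L <+>\<^bsub>R\<^esub> C"
          using coverD(5)[OF c gideal_Int[OF E(1) coverD(2)[OF c]]] E(2) coverD(3)[OF c] xE L(4) by blast
        then show ?thesis using add_upper2[OF L(1) gC] by blast
      qed
    qed
  qed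
  then show ?thesis using that L by blast
qed

text \<open>Descent from B intersects coatoms instead of adjoining gr-simple submodules: if K
  contains some x outside A, a coatom L without x makes K cover K \<inter> L.\<close>

lemma finite_length_if_dcc:
  assumes ss: "semisimple A B" and dcc: "wf (lt A B)"
  shows "cover\<^sup>*\<^sup>* A B"
proof -
  let ?X = "{K. cover\<^sup>*\<^sup>* K B \<and> gideal K \<and> A \<subseteq> K \<and> K \<subseteq> B}"
  note A = semisimpleD(1)[OF ss]
  have BX: "B \<in> ?X" using semisimpleD(1-3)[OF ss] by simp
  obtain K where K: "K \<in> ?X" and min: "\<And>E. (E, K) \<in> lt A B \<Longrightarrow> E \<notin> ?X"
    by (rule wfE_min[OF dcc BX]) (rule that)
  have "K \<subseteq> A"
  proof (rule ccontr)
    assume "\<not> K \<subseteq> A"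
    then obtain x where x: "x \<in> K" "x \<notin> A" by blast
    then have "x \<in> B" using K by blast
    then obtain L where L: "cover L B" "A \<subseteq> L" "x \<notin> L" using semisimple_coatom[OF ss _ x(2)] by blast
    have c: "cover (K \<inter> L) K" by (rule cover_meet[OF L(1)]) (use K x L in auto)
    have "(K \<inter> L, K) \<in> lt A B" using coverD[OF c] K L(2) by (auto simp: lt_def)
    moreover have "K \<inter> L \<in> ?X"
      using coverD(1)[OF c] K L(2) c by (auto intro: converse_rtranclp_into_rtranclp)
    ultimately show False using min by blast
  qed
  then have "K = A" using K by blast
  then show ?thesis using K by blast
qed

text \<open>
  Take \<open>K \<subseteq> R(e)\<close> minimal with \<open>R(e) \<subseteq> K + T\<close>, where \<open>T\<close> is the preimage of the socle of \<open>R/J\<close>.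
  If \<open>K\<close> were not contained in \<open>J\<close>, it would contain some \<open>C\<close> minimal over \<open>J\<close>, and a gr-maximal right
  ideal avoiding \<open>C\<close> would cut \<open>K\<close> down further.
\<close>

lemma soc_over_rad_eq_carrier:
  assumes dcc: "\<And>e. e \<in> identities \<Gamma> \<Longrightarrow> wf (lt {\<zero>} (at e))"
  shows "soc_over (gr_rad \<Gamma> R) = carrier R"
proof -
  let ?J = "gr_rad \<Gamma> R"
  let ?T = "soc_over ?J"
  have J: "gideal ?J" by (rule gideal_rad)
  have T: "gideal ?T" by (rule gideal_soc_over[OF J])
  have at_le: "at e \<subseteq> ?T" if e: "e \<in> identities \<Gamma>" for e
  proof -
    have at: "gideal (at e)" by (rule gideal_at[OF e])
    \<comment> \<open>The chain condition as a minimality principle in R(e), applied below both to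
      supplements of \<open>?T\<close> and to ideals not inside J.\<close>
    have minimal: "\<exists>K\<in>\<K>. \<forall>E. E \<subset> K \<longrightarrow> E \<notin> \<K>"
      if ne: "\<K> \<noteq> {}" and sub: "\<And>K. K \<in> \<K> \<Longrightarrow> gideal K \<and> K \<subseteq> at e" for \<K>
    proof -
      obtain K0 where K0: "K0 \<in> \<K>" using ne by blast
      obtain K where K: "K \<in> \<K>" "\<And>E. (E, K) \<in> lt {\<zero>} (at e) \<Longrightarrow> E \<notin> \<K>"
        by (rule wfE_min[OF dcc[OF e] K0]) (rule that)
      have "E \<notin> \<K>" if "E \<subset> K" for E
      proof
        assume E: "E \<in> \<K>"
        then have "gideal E" "gideal K" "K \<subseteq> at e" using sub K(1) by auto
        then have "(E, K) \<in> lt {\<zero>} (at e)" using that gidealD(3)[of E] by (auto simp: lt_def)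
        then show False using K(2) E by blast
      qed
      then show ?thesis using K(1) by blast
    qed
    let ?X = "{K. gideal K \<and> K \<subseteq> at e \<and> at e \<subseteq> K <+>\<^bsub>R\<^esub> ?T}"
    have "at e \<in> ?X" using at add_upper1[OF at T] by blast
    then have "?X \<noteq> {}" by blast
    then have "\<exists>K\<in>?X. \<forall>E. E \<subset> K \<longrightarrow> E \<notin> ?X" by (rule minimal) simp
    then obtain K where K: "K \<in> ?X" and minK: "\<forall>E. E \<subset> K \<longrightarrow> E \<notin> ?X"
      by (elim bexE) (rule that)
    then have gK: "gideal K" by blast
    have "K \<subseteq> ?J"
    proof (rule ccontr)
      assume nK: "\<not> K \<subseteq> ?J"
      let ?Y = "{C. gideal C \<and> C \<subseteq> K \<and> \<not> C \<subseteq> ?J}"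
      have "K \<in> ?Y" using gK nK by blast
      then have "?Y \<noteq> {}" by blast
      then have "\<exists>C\<in>?Y. \<forall>E. E \<subset> C \<longrightarrow> E \<notin> ?Y" by (rule minimal) (use K in auto)
      then obtain C where C: "C \<in> ?Y" and minC: "\<forall>E. E \<subset> C \<longrightarrow> E \<notin> ?Y"
        by (elim bexE) (rule that)
      then have gC: "gideal C" "C \<subseteq> K" "\<not> C \<subseteq> ?J" by auto
      \<comment> \<open>By the modular law an intermediate D equals J + (C \<inter> D). So C
        \<inter> D is not inside J, and minimality of C gives C \<inter> D = C.\<close>
      have "cover ?J (?J <+>\<^bsub>R\<^esub> C)"
      proof (rule coverI[OF J gideal_add[OF J gC(1)] add_upper1[OF J gC(1)]])
        show "\<not> ?J <+>\<^bsub>R\<^esub> C \<subseteq> ?J" using add_upper2[OF J gC(1)] gC(3) by blast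
        fix D assume D: "gideal D" "?J \<subseteq> D" "D \<subseteq> ?J <+>\<^bsub>R\<^esub> C" "\<not> D \<subseteq> ?J"
        have "C \<inter> D = C"
        proof (rule ccontr)
          assume "C \<inter> D \<noteq> C"
          then have "C \<inter> D \<notin> ?Y" using minC by blast
          then have "C \<inter> D \<subseteq> ?J" using gideal_Int[OF gC(1) D(1)] gC(2) by blast
          then have "?J <+>\<^bsub>R\<^esub> (C \<inter> D) \<subseteq> ?J" by (intro add_least J) auto
          then show False using modular[OF J gC(1) D(1,2)] D(3,4) by blast
        qed
        then show "?J <+>\<^bsub>R\<^esub> C \<subseteq> D" by (intro add_least D) auto
      qed
      then have CT: "C \<subseteq> ?T" using soc_over_upper(2)[OF J] add_upper2[OF J gC(1)] by blast
      obtain M where M: "cover M (carrier R)" "\<not> C \<subseteq> M"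
        using gC gidealD(2)[OF gC(1)] by (auto simp: gr_rad_def gr_maximal_right_ideal_iff)
      note gM = coverD(1)[OF M(1)]
      \<comment> \<open>M is gr-maximal and does not contain C. The modular law then gives K
        \<subseteq> C + (M \<inter> K), where C is absorbed by \<open>?T\<close>.\<close>
      have "C <+>\<^bsub>R\<^esub> M = carrier R"
        using coverD(5)[OF M(1) gideal_add[OF gC(1) gM] add_upper2[OF gC(1) gM]
            gidealD(2)[OF gideal_add[OF gC(1) gM]]] add_upper1[OF gC(1) gM] M(2) by blast
      then have "K \<subseteq> (C <+>\<^bsub>R\<^esub> M) \<inter> K" using gidealD(2)[OF gK] by blast
      also have "\<dots> \<subseteq> C <+>\<^bsub>R\<^esub> (M \<inter> K)" by (rule modular[OF gC(1) gM gK gC(2)])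
      also have "\<dots> \<subseteq> (K \<inter> M) <+>\<^bsub>R\<^esub> ?T"
        using CT add_upper1[OF gideal_Int[OF gK gM] T] add_upper2[OF gideal_Int[OF gK gM] T]
        by (intro add_least gideal_add gideal_Int gK gM T) auto
      finally have "K <+>\<^bsub>R\<^esub> ?T \<subseteq> (K \<inter> M) <+>\<^bsub>R\<^esub> ?T"
        using add_upper2[OF gideal_Int[OF gK gM] T]
        by (intro add_least gideal_add gideal_Int gK gM T)
      then have "K \<inter> M \<in> ?X" using K gideal_Int[OF gK gM] by blast
      then have "K \<inter> M = K" using minK by blast
      then show False using gC(2) M(2) by blast
    qed
    then have "K <+>\<^bsub>R\<^esub> ?T \<subseteq> ?T" using soc_over_upper(1)[OF J] by (intro add_least T) auto
    then show ?thesis using K by blast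
  qed
  have "carrier R \<subseteq> ?T"
    by (rule gideal_le_of_at[OF gideal_carrier T]) (rule le_infI2[OF at_le])
  then show ?thesis using gidealD(2)[OF T] by blast
qed


subsection \<open>Products and powers of ideals\<close>

lemma ideal_prod_le:
  assumes "additive_subgroup T R" "\<And>i j. i \<in> A \<Longrightarrow> j \<in> B \<Longrightarrow> i \<otimes> j \<in> T"
  shows "ideal_prod R A B \<subseteq> T"
proof
  fix x assume "x \<in> ideal_prod R A B"
  then show "x \<in> T"
    by induction (use assms(2) additive_subgroup.a_closed[OF assms(1)] in auto)
qed

lemma gideal_ideal_prod:
  assumes A: "gideal A" and B: "gideal B"
  shows "gideal (ideal_prod R A B)"
proof -
  let ?P = "ideal_prod R A B"
  have Ac: "i \<in> carrier R" if "i \<in> A" for i using gidealD(2)[OF A] that by blast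
  have Bc: "i \<in> carrier R" if "i \<in> B" for i using gidealD(2)[OF B] that by blast
  have sub: "?P \<subseteq> carrier R"
    by (rule ideal_prod_le[OF carrier_additive_subgroup]) (simp add: Ac Bc mult_closed)
  have zero: "\<zero> \<in> ?P" using ideal_prod.prod[OF gidealD(3)[OF A] gidealD(3)[OF B], of R] by simp
  have neg: "\<ominus> x \<in> ?P" if "x \<in> ?P" for x
    using that
  proof induction
    case (prod i j)
    then show ?case
      using ideal_prod.prod[OF gidealD(5)[OF A prod(1)] prod(2), of R] by (simp add: Ac Bc mult_uminus_left)
  next
    case (sum s1 s2)
    then have "\<ominus> (s1 \<oplus> s2) = \<ominus> s1 \<oplus> \<ominus> s2" using sub by (intro minus_add) auto
    then show ?case using ideal_prod.sum[OF sum(3,4)] by simp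
  qed
  have P: "additive_subgroup ?P R"
    unfolding additive_subgroup_iff using sub zero neg by (blast intro: ideal_prod.sum)
  have right: "x \<otimes> a \<in> ?P" if "x \<in> ?P" "a \<in> carrier R" for x a
  proof -
    have "?P \<subseteq> {x \<in> carrier R. x \<otimes> a \<in> ?P}"
    proof (rule ideal_prod_le)
      show "additive_subgroup {x \<in> carrier R. x \<otimes> a \<in> ?P} R"
        by (rule vimage_additive_subgroup[OF P]) (simp_all add: that mult_closed left_distrib)
      fix i j assume ij: "i \<in> A" "j \<in> B"
      then have "(i \<otimes> j) \<otimes> a = i \<otimes> (j \<otimes> a)" using that Ac Bc mult_assoc by simp
      then show "i \<otimes> j \<in> {x \<in> carrier R. x \<otimes> a \<in> ?P}"
        using ij that Ac Bc mult_closed ideal_prod.prod[OF ij(1) gidealD(7)[OF B ij(2) that(2)], of R] by simp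
    qed
    then show ?thesis using that by blast
  qed
  have proj: "proj \<gamma> x \<in> ?P" if "x \<in> ?P" and g: "\<gamma> \<in> carrier \<Gamma>" for x \<gamma>
  proof -
    let ?T = "{x \<in> carrier R. proj \<gamma> x \<in> ?P}"
    have T: "additive_subgroup ?T R"
      by (rule vimage_additive_subgroup[OF P]) (simp_all add: g proj_closed proj_add)
    \<comment> \<open>Gradedness is checked on products of homogeneous elements and extended by
      additivity, first in the right factor, then in the left one.\<close>
    have hom: "i \<otimes> j \<in> ?T" if i: "\<sigma> \<in> carrier \<Gamma>" "i \<in> A" "i \<in> component R \<sigma>"
      and j: "\<tau> \<in> carrier \<Gamma>" "j \<in> B" "j \<in> component R \<tau>" for \<sigma> \<tau> i j
    proof -
      obtain \<delta> where d: "\<delta> \<in> carrier \<Gamma>" "i \<otimes> j \<in> component R \<delta>"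
        using component_mult_homogeneous[OF i(1,3) j(1,3)] .
      have "proj \<gamma> (i \<otimes> j) \<in> {\<zero>, i \<otimes> j}"
        using d proj_same[OF g, of "i \<otimes> j"] proj_other[OF g d(1) _ d(2)] by (cases "\<delta> = \<gamma>") auto
      then show ?thesis using zero ideal_prod.prod[OF i(2) j(2), of R] Ac[OF i(2)] Bc[OF j(2)] mult_closed by auto
    qed
    have hom1: "i \<otimes> j \<in> ?T" if i: "\<sigma> \<in> carrier \<Gamma>" "i \<in> A" "i \<in> component R \<sigma>" and j: "j \<in> B" for \<sigma> i j
    proof -
      have "B \<subseteq> {j \<in> carrier R. i \<otimes> j \<in> ?T}"
      proof (rule gideal_le[OF B])
        show "additive_subgroup {j \<in> carrier R. i \<otimes> j \<in> ?T} R"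
          by (rule vimage_additive_subgroup[OF T]) (simp_all add: Ac i mult_closed right_distrib)
        show "B \<inter> component R \<tau> \<subseteq> {j \<in> carrier R. i \<otimes> j \<in> ?T}" if "\<tau> \<in> carrier \<Gamma>" for \<tau>
          using hom[OF i that] Bc by blast
      qed
      then show ?thesis using j by blast
    qed
    have hom2: "i \<otimes> j \<in> ?T" if i: "i \<in> A" and j: "j \<in> B" for i j
    proof -
      have "A \<subseteq> {i \<in> carrier R. i \<otimes> j \<in> ?T}"
      proof (rule gideal_le[OF A])
        show "additive_subgroup {i \<in> carrier R. i \<otimes> j \<in> ?T} R"
          by (rule vimage_additive_subgroup[OF T]) (simp_all add: Bc j mult_closed left_distrib)
        show "A \<inter> component R \<tau> \<subseteq> {i \<in> carrier R. i \<otimes> j \<in> ?T}" if "\<tau> \<in> carrier \<Gamma>" for \<tau>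
          using hom1[OF that _ _ j] Ac by blast
      qed
      then show ?thesis using i by blast
    qed
    have "?P \<subseteq> ?T" by (rule ideal_prod_le[OF T hom2])
    then show ?thesis using that by blast
  qed
  show ?thesis unfolding gideal_def using P right proj by blast
qed

lemma ideal_prod_assoc:
  assumes A: "gideal A" and B: "gideal B" and C: "gideal C"
  shows "ideal_prod R (ideal_prod R A B) C = ideal_prod R A (ideal_prod R B C)"
proof
  note AB = gideal_ideal_prod[OF A B] and BC = gideal_ideal_prod[OF B C]
  have c: "\<And>x. x \<in> A \<Longrightarrow> x \<in> carrier R" "\<And>x. x \<in> B \<Longrightarrow> x \<in> carrier R" "\<And>x. x \<in> C \<Longrightarrow> x \<in> carrier R"
    using gidealD(2)[OF A] gidealD(2)[OF B] gidealD(2)[OF C] by auto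
  show "ideal_prod R (ideal_prod R A B) C \<subseteq> ideal_prod R A (ideal_prod R B C)" (is "_ \<subseteq> ?r")
  proof (rule ideal_prod_le[OF gidealD(1)[OF gideal_ideal_prod[OF A BC]]])
    fix z k assume z: "z \<in> ideal_prod R A B" and k: "k \<in> C"
    have "ideal_prod R A B \<subseteq> {z \<in> carrier R. z \<otimes> k \<in> ?r}"
    proof (rule ideal_prod_le)
      show "additive_subgroup {z \<in> carrier R. z \<otimes> k \<in> ?r} R"
        by (rule vimage_additive_subgroup[OF gidealD(1)[OF gideal_ideal_prod[OF A BC]]])
          (simp_all add: c k mult_closed left_distrib)
      fix i j assume ij: "i \<in> A" "j \<in> B"
      have "i \<otimes> (j \<otimes> k) \<in> ?r" by (intro ideal_prod.prod ij k)
      then show "i \<otimes> j \<in> {z \<in> carrier R. z \<otimes> k \<in> ?r}" using ij k c mult_assoc mult_closed by simp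
    qed
    then show "z \<otimes> k \<in> ?r" using z by blast
  qed
  show "ideal_prod R A (ideal_prod R B C) \<subseteq> ideal_prod R (ideal_prod R A B) C" (is "_ \<subseteq> ?l")
  proof (rule ideal_prod_le[OF gidealD(1)[OF gideal_ideal_prod[OF AB C]]])
    fix i z assume i: "i \<in> A" and z: "z \<in> ideal_prod R B C"
    have "ideal_prod R B C \<subseteq> {z \<in> carrier R. i \<otimes> z \<in> ?l}"
    proof (rule ideal_prod_le)
      show "additive_subgroup {z \<in> carrier R. i \<otimes> z \<in> ?l} R"
        by (rule vimage_additive_subgroup[OF gidealD(1)[OF gideal_ideal_prod[OF AB C]]])
          (simp_all add: c i mult_closed right_distrib)
      fix j k assume jk: "j \<in> B" "k \<in> C"
      have "(i \<otimes> j) \<otimes> k \<in> ?l" by (intro ideal_prod.prod jk i)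
      then show "j \<otimes> k \<in> {z \<in> carrier R. i \<otimes> z \<in> ?l}" using jk i c mult_assoc mult_closed by simp
    qed
    then show "i \<otimes> z \<in> ?l" using z by blast
  qed
qed

lemma gideal_ideal_power:
  assumes "gideal J"
  shows "gideal (ideal_power R J n)"
  using gideal_carrier assms gideal_ideal_prod
  by (induction R J n rule: ideal_power.induct) auto

lemma ideal_power_Suc: "n \<ge> 1 \<Longrightarrow> ideal_power R J (Suc n) = ideal_prod R (ideal_power R J n) J"
  by (cases n) auto

lemma ideal_power_add:
  assumes J: "gideal J" and a: "a \<ge> 1" and b: "b \<ge> 1"
  shows "ideal_power R J (a + b) = ideal_prod R (ideal_power R J a) (ideal_power R J b)"
  using b
proof (induction b rule: nat_induct_at_least)
  case base
  then show ?case using ideal_power_Suc[OF a] by simp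
next
  case (Suc b)
  note P = gideal_ideal_power[OF J]
  have "ideal_power R J (a + Suc b) = ideal_prod R (ideal_power R J (a + b)) J"
    using ideal_power_Suc[of "a + b"] a by simp
  also have "\<dots> = ideal_prod R (ideal_power R J a) (ideal_prod R (ideal_power R J b) J)"
    using Suc ideal_prod_assoc[OF P P J] by simp
  finally show ?case using ideal_power_Suc Suc(1) by simp
qed

lemma ideal_power_left:
  assumes J: "gideal J" and left: "\<And>x j. x \<in> carrier R \<Longrightarrow> j \<in> J \<Longrightarrow> x \<otimes> j \<in> J"
    and x: "x \<in> carrier R" "j \<in> ideal_power R J n"
  shows "x \<otimes> j \<in> ideal_power R J n"
  using x(2)
proof (induction n arbitrary: j)
  case 0
  then show ?case using x mult_closed by simp
next
  case (Suc n)
  show ?case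
  proof (cases "n \<ge> 1")
    case True
    note P = gideal_ideal_power[OF J]
    let ?P = "ideal_prod R (ideal_power R J n) J"
    have "?P \<subseteq> {j \<in> carrier R. x \<otimes> j \<in> ?P}"
    proof (rule ideal_prod_le)
      show "additive_subgroup {j \<in> carrier R. x \<otimes> j \<in> ?P} R"
        by (rule vimage_additive_subgroup[OF gidealD(1)[OF gideal_ideal_prod[OF P J]]])
          (simp_all add: x mult_closed right_distrib)
      fix i j assume ij: "i \<in> ideal_power R J n" "j \<in> J"
      have c: "i \<in> carrier R" "j \<in> carrier R" using ij gidealD(2)[OF P] gidealD(2)[OF J] by auto
      have "(x \<otimes> i) \<otimes> j \<in> ?P" by (intro ideal_prod.prod Suc.IH ij)
      then show "i \<otimes> j \<in> {j \<in> carrier R. x \<otimes> j \<in> ?P}" using c x(1) mult_assoc mult_closed by simp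
    qed
    then show ?thesis using Suc.prems ideal_power_Suc[OF True] by auto
  next
    case False
    then have "n = 0" by simp
    then show ?thesis using left x(1) Suc.prems by simp
  qed
qed

lemma ideal_power_mult:
  assumes J: "gideal J" and left: "\<And>x j. x \<in> carrier R \<Longrightarrow> j \<in> J \<Longrightarrow> x \<otimes> j \<in> J"
    and x: "x \<in> ideal_power R J n" "j \<in> J"
  shows "x \<otimes> j \<in> ideal_power R J (Suc n)"
proof (cases "n \<ge> 1")
  case True
  then show ?thesis using ideal_prod.prod[OF x] ideal_power_Suc by simp
next
  case False
  \<comment> \<open>\<open>ideal_power R J 0\<close> is R, and R J \<subseteq> J as J is a left
    ideal.\<close>
  then have "n = 0" by simp
  then show ?thesis using left x by simp
qed

lemma ideal_power_antimono:
  assumes J: "gideal J"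
  shows "m \<le> n \<Longrightarrow> ideal_power R J n \<subseteq> ideal_power R J m"
proof (induction n rule: dec_induct)
  case (step n)
  note P = gideal_ideal_power[OF J]
  have "ideal_power R J (Suc n) \<subseteq> ideal_power R J n"
  proof (cases "n \<ge> 1")
    case True
    have "ideal_prod R (ideal_power R J n) J \<subseteq> ideal_power R J n"
      using gidealD(7)[OF P] gidealD(2)[OF J] by (intro ideal_prod_le gidealD(1)[OF P]) auto
    then show ?thesis using ideal_power_Suc[OF True] by simp
  next
    case False
    then have "n = 0" by simp
    then show ?thesis using gidealD(2)[OF J] by simp
  qed
  then show ?case using step by blast
qed simp

text \<open>Because 1_e fixes R(e), left multiplication by it cuts out B(e); this brings objectwise
  nilpotency into the lattice.\<close>

lemma loc_one_image:
  assumes B: "gideal B" and e: "e \<in> identities \<Gamma>"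
  shows "(\<lambda>x. loc_one R e \<otimes> x) ` B = B \<inter> at e"
proof
  show "(\<lambda>x. loc_one R e \<otimes> x) ` B \<subseteq> B \<inter> at e"
    using loc_one_mult_gideal[OF B e] loc_one_mult_at[OF e] gidealD(2)[OF B] by auto
  show "B \<inter> at e \<subseteq> (\<lambda>x. loc_one R e \<otimes> x) ` B"
    unfolding at_def by (auto intro!: image_eqI)
qed

text \<open>1_e (A B) = (1_e A) B, so only left factors from A(e) matter.\<close>

lemma ideal_prod_at_le:
  assumes A: "gideal A" and B: "gideal B" and T: "gideal T" and e: "e \<in> identities \<Gamma>"
    and le: "\<And>x y. x \<in> A \<inter> at e \<Longrightarrow> y \<in> B \<Longrightarrow> x \<otimes> y \<in> T"
  shows "ideal_prod R A B \<inter> at e \<subseteq> T"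
proof -
  have "ideal_prod R A B \<subseteq> {z \<in> carrier R. loc_one R e \<otimes> z \<in> T}"
  proof (rule ideal_prod_le)
    show "additive_subgroup {z \<in> carrier R. loc_one R e \<otimes> z \<in> T} R"
      by (rule vimage_additive_subgroup[OF gidealD(1)[OF T]])
        (simp_all add: loc_one_closed[OF e] mult_closed right_distrib)
    fix i j assume ij: "i \<in> A" "j \<in> B"
    have c: "i \<in> carrier R" "j \<in> carrier R" using ij gidealD(2)[OF A] gidealD(2)[OF B] by auto
    have "(loc_one R e \<otimes> i) \<otimes> j \<in> T"
      using loc_one_mult_gideal[OF A e ij(1)] loc_one_mult_at[OF e c(1)] ij(2) by (intro le) auto
    then show "i \<otimes> j \<in> {z \<in> carrier R. loc_one R e \<otimes> z \<in> T}"
      using c mult_closed mult_assoc loc_one_closed[OF e] by simp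
  qed
  then show ?thesis by (auto simp: at_def)
qed

subsection \<open>Finitely generated graded right ideals\<close>

definition homogeneous :: "'r set" where
  "homogeneous = (\<Union>\<gamma>\<in>carrier \<Gamma>. component R \<gamma>)"

text \<open>As a sum of cyclic ideals x R this is graded for homogeneous generators, and it contains
  them because x = x 1_d.\<close>

definition gen :: "'r set \<Rightarrow> 'r set" where
  "gen X = family_sum R X (\<lambda>x. lmult x (carrier R))"

definition fgen :: "'r set \<Rightarrow> bool" where
  "fgen B \<longleftrightarrow> (\<exists>X. finite X \<and> X \<subseteq> homogeneous \<and> B = gen X)"

lemma gideal_lmult_homogeneous: "x \<in> homogeneous \<Longrightarrow> gideal (lmult x (carrier R))"
  using gideal_lmult[OF gideal_carrier] by (auto simp: homogeneous_def)

lemma gideal_gen: "X \<subseteq> homogeneous \<Longrightarrow> gideal (gen X)"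
  unfolding gen_def by (rule gideal_family_sum) (auto intro: gideal_lmult_homogeneous)

lemma gen_upper:
  assumes "X \<subseteq> homogeneous"
  shows "X \<subseteq> gen X"
proof
  fix x assume x: "x \<in> X"
  then have h: "x \<in> homogeneous" using assms by blast
  have "lmult x (carrier R) \<subseteq> gen X"
    unfolding gen_def
    using family_sum_upper[OF x, of "\<lambda>x. lmult x (carrier R)"] gidealD(2)[OF gideal_lmult_homogeneous[OF h]]
    by simp
  then show "x \<in> gen X" using h mem_lmult_self by (auto simp: homogeneous_def)
qed

text \<open>T may be ungraded here, because \<open>finitely_generated\<close> quantifies over all
  submodules.\<close>

lemma gen_least:
  assumes "additive_subgroup T R" "\<And>x a. x \<in> T \<Longrightarrow> a \<in> carrier R \<Longrightarrow> x \<otimes> a \<in> T" "X \<subseteq> T"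
  shows "gen X \<subseteq> T"
  unfolding gen_def by (rule family_sum_least[OF assms(1)]) (use assms in \<open>auto simp: lmult_def\<close>)

lemma gen_least_gideal: "gideal T \<Longrightarrow> X \<subseteq> T \<Longrightarrow> gen X \<subseteq> T"
  by (rule gen_least) (auto dest: gidealD(1) intro: gidealD(7))

lemma gen_empty: "gen {} = {\<zero>}"
proof
  show "gen {} \<subseteq> {\<zero>}" by (rule gen_least_gideal[OF gideal_zero]) simp
  show "{\<zero>} \<subseteq> gen {}" using gidealD(3)[OF gideal_gen] by simp
qed

text \<open>A maximal finitely generated graded right ideal inside B is B: a missing homogeneous
  element could be adjoined as a generator.\<close>

lemma fgen_if_acc:
  assumes B: "gideal B" and acc: "wf ((lt {\<zero>} B)\<inverse>)"
  shows "fgen B"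
proof -
  let ?X = "{gen X | X. finite X \<and> X \<subseteq> homogeneous \<and> X \<subseteq> B}"
  have "gen {} \<in> ?X" by blast
  obtain G where G: "G \<in> ?X" and max: "\<And>E. (E, G) \<in> (lt {\<zero>} B)\<inverse> \<Longrightarrow> E \<notin> ?X"
    by (rule wfE_min[OF acc \<open>gen {} \<in> ?X\<close>]) (rule that)
  obtain X where X: "finite X" "X \<subseteq> homogeneous" "X \<subseteq> B" "G = gen X" using G by blast
  have gG: "gideal G" using gideal_gen X by simp
  have GB: "G \<subseteq> B" using gen_least_gideal[OF B] X by simp
  have "B \<subseteq> G"
  proof (rule gideal_le_homogeneous[OF B gG], rule ccontr)
    fix \<gamma> b assume b: "\<gamma> \<in> carrier \<Gamma>" "b \<in> B" "b \<in> component R \<gamma>" "b \<notin> G"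
    let ?Y = "insert b X"
    have Y: "?Y \<subseteq> homogeneous" "?Y \<subseteq> B" "finite ?Y" using X b by (auto simp: homogeneous_def)
    have gY: "gideal (gen ?Y)" by (rule gideal_gen[OF Y(1)])
    have up: "?Y \<subseteq> gen ?Y" by (rule gen_upper[OF Y(1)])
    then have "G \<subseteq> gen ?Y" using gen_least_gideal[OF gY] X(4) by simp
    moreover have "gen ?Y \<noteq> G" using up b(4) by blast
    ultimately have "(G, gen ?Y) \<in> lt {\<zero>} B"
      using gG gY gidealD(3)[OF gG] gen_least_gideal[OF B Y(2)] by (auto simp: lt_def)
    then have "gen ?Y \<notin> ?X" using max by blast
    then show False using Y by blast
  qed
  then show ?thesis using GB X by (auto simp: fgen_def)
qed

text \<open>Nakayama's lemma, with \<open>N J = N\<close> expressed by \<open>stable\<close>: a finitely generated \<open>N \<noteq> 0\<close> has a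
  maximal graded submodule, which contains \<open>N J\<close>.\<close>

lemma nakayama:
  assumes f: "fgen N"
    and stable: "\<And>T. gideal T \<Longrightarrow> (\<And>x j. x \<in> N \<Longrightarrow> j \<in> gr_rad \<Gamma> R \<Longrightarrow> x \<otimes> j \<in> T) \<Longrightarrow> N \<subseteq> T"
  shows "N = {\<zero>}"
proof -
  define P where "P X \<longleftrightarrow> finite X \<and> X \<subseteq> homogeneous \<and> N = gen X" for X
  obtain X0 where "P X0" using f by (auto simp: fgen_def P_def)
  \<comment> \<open>With a generating set of least size, no generator x is produced by the others,
    so L can be taken above the others and without x.\<close>
  then obtain X where X: "P X" and min: "\<And>Y. P Y \<Longrightarrow> card X \<le> card Y"
    using ex_has_least_nat[of P X0 card] by blast
  then have fin: "finite X" and hom: "X \<subseteq> homogeneous" and N: "N = gen X" by (auto simp: P_def)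
  have gN: "gideal N" using gideal_gen[OF hom] N by simp
  show ?thesis
  proof (cases "X = {}")
    case True
    then show ?thesis using N gen_empty by simp
  next
    case False
    then obtain x where x: "x \<in> X" by blast
    let ?Y = "X - {x}"
    have Yh: "?Y \<subseteq> homogeneous" using hom by blast
    have gY: "gideal (gen ?Y)" by (rule gideal_gen[OF Yh])
    have YX: "?Y \<subseteq> N" using gen_upper[OF hom] N by blast
    have YN: "gen ?Y \<subseteq> N" by (rule gen_least_gideal[OF gN YX])
    have "card ?Y < card X" using fin x by (rule card_Diff1_less)
    then have "\<not> P ?Y" using min by fastforce
    then have ne: "gen ?Y \<noteq> N" using fin Yh by (auto simp: P_def)
    have "x \<notin> gen ?Y"
    proof
      assume "x \<in> gen ?Y"
      then have "X \<subseteq> gen ?Y" using gen_upper[OF Yh] by blast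
      then have "N \<subseteq> gen ?Y" using gen_least_gideal[OF gY] N by simp
      then show False using ne YN by blast
    qed
    then obtain L where L: "gideal L" "gen ?Y \<subseteq> L" "L \<subseteq> N" "x \<notin> L"
      and max: "\<And>E. gideal E \<Longrightarrow> L \<subset> E \<Longrightarrow> E \<subseteq> N \<Longrightarrow> x \<in> E"
      using ex_maximal_avoiding[OF gY YN] by blast
    have xN: "x \<in> N" using gen_upper[OF hom] N x by blast
    have "cover L N"
    proof (rule coverI[OF L(1) gN L(3)])
      show "\<not> N \<subseteq> L" using xN L(4) by blast
      fix E assume E: "gideal E" "L \<subseteq> E" "E \<subseteq> N" "\<not> E \<subseteq> L"
      have "x \<in> E" using max[OF E(1) _ E(3)] E(2,4) by blast
      then have "X \<subseteq> E" using gen_upper[OF Yh] L(2) E(2) by blast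
      then show "N \<subseteq> E" using gen_least_gideal[OF E(1)] N by simp
    qed
    \<comment> \<open>\<open>cover_rad\<close> puts N J inside L, and stability then puts N
      there.\<close>
    then have "N \<subseteq> L" by (intro stable L(1)) (rule cover_rad)
    then show ?thesis using xN L(4) by blast
  qed
qed

text \<open>For x homogeneous with domain d, x v = x (1_d v) sees only B(d). So the products x y
  suffice, with y among generators of B(d), and the finitely many x involve finitely many objects
  even if B itself is not finitely generated.\<close>

lemma fgen_ideal_prod:
  assumes A: "gideal A" and B: "gideal B"
    and left: "\<And>x y. x \<in> carrier R \<Longrightarrow> y \<in> B \<Longrightarrow> x \<otimes> y \<in> B"
    and fA: "fgen (A \<inter> at e)" and fB: "\<And>d. d \<in> identities \<Gamma> \<Longrightarrow> fgen (B \<inter> at d)"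
    and e: "e \<in> identities \<Gamma>"
  shows "fgen (ideal_prod R A B \<inter> at e)"
proof -
  obtain X where X: "finite X" "X \<subseteq> homogeneous" "A \<inter> at e = gen X" using fA by (auto simp: fgen_def)
  have "\<exists>\<gamma>. \<gamma> \<in> carrier \<Gamma> \<and> x \<in> component R \<gamma>" if "x \<in> X" for x using X(2) that by (auto simp: homogeneous_def)
  then obtain deg where deg: "\<And>x. x \<in> X \<Longrightarrow> deg x \<in> carrier \<Gamma>" "\<And>x. x \<in> X \<Longrightarrow> x \<in> component R (deg x)" by metis
  have "\<exists>Y. finite Y \<and> Y \<subseteq> homogeneous \<and> B \<inter> at (src \<Gamma> (deg x)) = gen Y" if "x \<in> X" for x
    using fB[OF src_identity[OF deg(1)[OF that]]] by (auto simp: fgen_def)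
  then obtain Y where Y: "\<And>x. x \<in> X \<Longrightarrow> finite (Y x)" "\<And>x. x \<in> X \<Longrightarrow> Y x \<subseteq> homogeneous"
    "\<And>x. x \<in> X \<Longrightarrow> B \<inter> at (src \<Gamma> (deg x)) = gen (Y x)" by metis
  let ?Z = "\<Union>x\<in>X. (\<lambda>y. x \<otimes> y) ` Y x"
  have Zf: "finite ?Z" using X(1) Y(1) by blast
  have XA: "X \<subseteq> A \<inter> at e" using gen_upper[OF X(2)] X(3) by simp
  have xc: "x \<in> carrier R" if "x \<in> X" for x using deg[OF that] component_closed by blast
  have Yc: "y \<in> B" if "x \<in> X" "y \<in> Y x" for x y using gen_upper[OF Y(2)] Y(3) that by blast
  have Bc: "y \<in> carrier R" if "y \<in> B" for y using gidealD(2)[OF B] that by blast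
  have Zh: "?Z \<subseteq> homogeneous"
  proof
    fix z assume "z \<in> ?Z"
    then obtain x y where xy: "x \<in> X" "y \<in> Y x" "z = x \<otimes> y" by blast
    obtain \<tau> where t: "\<tau> \<in> carrier \<Gamma>" "y \<in> component R \<tau>"
      using xy(2) Y(2)[OF xy(1)] by (auto simp: homogeneous_def)
    obtain \<gamma> where "\<gamma> \<in> carrier \<Gamma>" "z \<in> component R \<gamma>"
      using component_mult_homogeneous[OF deg[OF xy(1)] t] xy(3) by blast
    then show "z \<in> homogeneous" by (auto simp: homogeneous_def)
  qed
  have gZ: "gideal (gen ?Z)" by (rule gideal_gen[OF Zh])
  have ZZ: "?Z \<subseteq> gen ?Z" by (rule gen_upper[OF Zh])
  have "gen ?Z \<subseteq> ideal_prod R A B \<inter> at e"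
  proof (rule gen_least_gideal[OF gideal_Int[OF gideal_ideal_prod[OF A B] gideal_at[OF e]]])
    show "?Z \<subseteq> ideal_prod R A B \<inter> at e"
    proof
      fix z assume "z \<in> ?Z"
      then obtain x y where xy: "x \<in> X" "y \<in> Y x" "z = x \<otimes> y" by blast
      have xA: "x \<in> A" "x \<in> at e" using XA xy(1) by auto
      have yB: "y \<in> B" using Yc xy by blast
      show "z \<in> ideal_prod R A B \<inter> at e"
        unfolding xy(3) using ideal_prod.prod[OF xA(1) yB, of R] gidealD(7)[OF gideal_at[OF e] xA(2) Bc[OF yB]] by simp
    qed
  qed
  moreover have "ideal_prod R A B \<inter> at e \<subseteq> gen ?Z"
  proof (rule ideal_prod_at_le[OF A B gZ e])
    fix u v assume u: "u \<in> A \<inter> at e" and v: "v \<in> B"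
    have "gen X \<subseteq> {u \<in> carrier R. u \<otimes> v \<in> gen ?Z}"
      unfolding gen_def[of X]
    proof (rule family_sum_least)
      show "additive_subgroup {u \<in> carrier R. u \<otimes> v \<in> gen ?Z} R"
        by (rule vimage_additive_subgroup[OF gidealD(1)[OF gZ]]) (simp_all add: Bc v mult_closed left_distrib)
      fix x assume x: "x \<in> X"
      have "gen (Y x) \<subseteq> colon (gen ?Z) x"
      proof (rule gen_least_gideal[OF gideal_colon[OF gZ deg[OF x]]])
        show "Y x \<subseteq> colon (gen ?Z) x" using ZZ Yc[OF x] Bc x by (auto simp: colon_def)
      qed
      then have col: "B \<inter> at (src \<Gamma> (deg x)) \<subseteq> colon (gen ?Z) x" using Y(3)[OF x] by simp
      show "lmult x (carrier R) \<subseteq> {u \<in> carrier R. u \<otimes> v \<in> gen ?Z}"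
      proof
        fix u assume "u \<in> lmult x (carrier R)"
        then obtain a where a: "a \<in> carrier R" "u = x \<otimes> a" by (auto simp: lmult_def)
        let ?o = "loc_one R (src \<Gamma> (deg x))"
        note i = src_identity[OF deg(1)[OF x]]
        \<comment> \<open>B is a left ideal, so the coefficient a of x can be moved into the right
          factor.\<close>
        have av: "a \<otimes> v \<in> B" by (rule left[OF a(1) v])
        have "?o \<otimes> (a \<otimes> v) \<in> B \<inter> at (src \<Gamma> (deg x))"
          using loc_one_mult_gideal[OF B i av] loc_one_mult_at[OF i Bc[OF av]] by simp
        then have "x \<otimes> (?o \<otimes> (a \<otimes> v)) \<in> gen ?Z" using col by (auto simp: colon_def)
        moreover have "x \<otimes> (?o \<otimes> (a \<otimes> v)) = (x \<otimes> ?o) \<otimes> (a \<otimes> v)"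
          using mult_assoc[OF xc[OF x] loc_one_closed[OF i] Bc[OF av]] by simp
        moreover have "x \<otimes> ?o = x" by (rule loc_one_right[OF deg[OF x]])
        ultimately have "u \<otimes> v \<in> gen ?Z" using a xc[OF x] Bc[OF v] mult_assoc by simp
        then show "u \<in> {u \<in> carrier R. u \<otimes> v \<in> gen ?Z}" using a xc[OF x] mult_closed by simp
      qed
    qed
    then show "u \<otimes> v \<in> gen ?Z" using u X(3) by blast
  qed
  ultimately show ?thesis using Zf Zh by (auto simp: fgen_def)
qed

section \<open>Finite generation by arbitrary and by homogeneous elements\<close>

lemma rsubmodule_submod_submod:
  assumes C: "gideal C" and B: "gideal B" "B \<subseteq> C"
  shows "rsubmodule R (submod (submod (regular R) C) B) N \<longleftrightarrow>
    additive_subgroup N R \<and> N \<subseteq> B \<and> (\<forall>x\<in>N. \<forall>a\<in>carrier R. x \<otimes> a \<in> N)"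
proof -
  have Cr: "additive_subgroup C (regular R)" using gidealD(1)[OF C] additive_subgroup_regular by simp
  have ab: "abelian_group (submod (regular R) C)" by (rule abelian_group_submod[OF abelian_group_regular Cr])
  have "additive_subgroup B (submod (regular R) C)"
    using additive_subgroup_transfer[OF ab abelian_group_regular, of B] gidealD[OF B(1)] B(2) gidealD(2)[OF C]
    by (simp add: additive_subgroup_regular)
  then show ?thesis
    using rsubmodule_submod[OF ab, of B R N] rsubmodule_submod[OF abelian_group_regular Cr, of R N] B(2)
    by (auto simp: rsubmodule_def additive_subgroup_regular)
qed

text \<open>The finitely many homogeneous components of finitely many generators generate as well,
  and they lie in B because B is graded.\<close>

lemma finitely_generated_iff_fgen:
  assumes C: "gideal C" and B: "gideal B" "B \<subseteq> C"
  shows "finitely_generated R (submod (submod (regular R) C) B) \<longleftrightarrow> fgen B"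
proof
  let ?sub = "\<lambda>N. additive_subgroup N R \<and> N \<subseteq> B \<and> (\<forall>x\<in>N. \<forall>a\<in>carrier R. x \<otimes> a \<in> N)"
  assume "finitely_generated R (submod (submod (regular R) C) B)"
  then have "\<exists>X. finite X \<and> X \<subseteq> B \<and> B = \<Inter>{N. ?sub N \<and> X \<subseteq> N}"
    unfolding finitely_generated_def rsubmodule_submod_submod[OF assms] submod_simps .
  then obtain X where X: "finite X" "X \<subseteq> B" "B = \<Inter>{N. ?sub N \<and> X \<subseteq> N}"
    by (elim exE conjE) (rule that)
  have "\<exists>F. finite F \<and> F \<subseteq> carrier \<Gamma> \<and> x = finsum R (\<lambda>\<gamma>. proj \<gamma> x) F" if x: "x \<in> X" for x
  proof -
    have "x \<in> carrier R" using x X(2) gidealD(2)[OF B(1)] by blast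
    then obtain F where "finite F" "F \<subseteq> carrier \<Gamma>" "x = finsum R (\<lambda>\<gamma>. proj \<gamma> x) F"
      by (rule proj_decomposition)
    then show ?thesis by (intro exI[of _ F] conjI)
  qed
  then have "\<exists>F. \<forall>x\<in>X. finite (F x) \<and> F x \<subseteq> carrier \<Gamma> \<and> x = finsum R (\<lambda>\<gamma>. proj \<gamma> x) (F x)"
    by (intro bchoice ballI)
  then obtain F where "\<forall>x\<in>X. finite (F x) \<and> F x \<subseteq> carrier \<Gamma> \<and> x = finsum R (\<lambda>\<gamma>. proj \<gamma> x) (F x)"
    by (elim exE) (rule that)
  then have F: "\<And>x. x \<in> X \<Longrightarrow> finite (F x)" "\<And>x. x \<in> X \<Longrightarrow> F x \<subseteq> carrier \<Gamma>"
    "\<And>x. x \<in> X \<Longrightarrow> x = finsum R (\<lambda>\<gamma>. proj \<gamma> x) (F x)"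
    by blast+
  let ?Y = "\<Union>x\<in>X. (\<lambda>\<gamma>. proj \<gamma> x) ` F x"
  have Yf: "finite ?Y" using X(1) F(1) by blast
  have Y: "proj \<gamma> x \<in> homogeneous \<inter> B" if x: "x \<in> X" and g: "\<gamma> \<in> F x" for x \<gamma>
  proof -
    have xB: "x \<in> B" using x X(2) by (rule subsetD[rotated])
    have "\<gamma> \<in> carrier \<Gamma>" using g F(2)[OF x] by (rule subsetD[rotated])
    then show ?thesis
      using proj_props(1)[of \<gamma> x] gidealD(8)[OF B(1) xB] subsetD[OF gidealD(2)[OF B(1)] xB]
      by (auto simp: homogeneous_def)
  qed
  have Yh: "?Y \<subseteq> homogeneous" and YB: "?Y \<subseteq> B" using Y by auto
  note G = gideal_gen[OF Yh]
  have GB: "gen ?Y \<subseteq> B" by (rule gen_least_gideal[OF B(1) YB])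
  have "X \<subseteq> gen ?Y"
  proof
    fix x assume x: "x \<in> X"
    have "finsum R (\<lambda>\<gamma>. proj \<gamma> x) (F x) \<in> gen ?Y"
      using gen_upper[OF Yh] x by (intro finsum_in_additive_subgroup[OF gidealD(1)[OF G] F(1)[OF x]]) blast
    then show "x \<in> gen ?Y" using F(3)[OF x] by simp
  qed
  then have "gen ?Y \<in> {N. ?sub N \<and> X \<subseteq> N}" using gidealD[OF G] GB by simp
  then have "B \<subseteq> gen ?Y" using X(3) by blast
  then have "B = gen ?Y" using GB by blast
  then show "fgen B" using Yf Yh by (auto simp: fgen_def)
next
  let ?sub = "\<lambda>N. additive_subgroup N R \<and> N \<subseteq> B \<and> (\<forall>x\<in>N. \<forall>a\<in>carrier R. x \<otimes> a \<in> N)"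
  assume "fgen B"
  then obtain X where X: "finite X" "X \<subseteq> homogeneous" "B = gen X" by (auto simp: fgen_def)
  have mem: "B \<in> {N. ?sub N \<and> X \<subseteq> N}" using gidealD[OF B(1)] gen_upper[OF X(2)] X(3) by simp
  have le: "B \<subseteq> N" if "N \<in> {N. ?sub N \<and> X \<subseteq> N}" for N
    using that gen_least[of N X] X(3) by simp
  have "B = \<Inter>{N. ?sub N \<and> X \<subseteq> N}"
    by (rule subset_antisym[OF Inter_greatest[OF le] Inter_lower[OF mem]])
  moreover have "X \<subseteq> B" using gen_upper[OF X(2)] X(3) by simp
  ultimately have "\<exists>X. finite X \<and> X \<subseteq> B \<and> B = \<Inter>{N. ?sub N \<and> X \<subseteq> N}"
    by (intro exI[of _ X] conjI X(1))
  then show "finitely_generated R (submod (submod (regular R) C) B)"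
    unfolding finitely_generated_def rsubmodule_submod_submod[OF assms] submod_simps .
qed

lemma obj_finitely_generated_iff:
  assumes "gideal C"
  shows "obj_finitely_generated \<Gamma> R (submod (regular R) C) \<longleftrightarrow> (\<forall>e\<in>identities \<Gamma>. fgen (C \<inter> at e))"
  unfolding obj_finitely_generated_def
  using piece_submod_regular[OF assms] finitely_generated_iff_fgen[OF assms gideal_Int[OF assms gideal_at]]
  by auto


subsection \<open>Chain conditions, nilpotency and the socle series\<close>

lemma graded_submodule_piece_iff:
  "e \<in> identities \<Gamma> \<Longrightarrow>
    graded_submodule \<Gamma> R (submod (regular R) (piece \<Gamma> (regular R) e)) N \<longleftrightarrow> gideal N \<and> N \<subseteq> at e"
  by (simp add: piece_regular graded_submodule_submod_regular_iff gideal_at)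

lemma gr_artinian_piece_iff:
  assumes e: "e \<in> identities \<Gamma>"
  shows "gr_artinian \<Gamma> R (submod (regular R) (piece \<Gamma> (regular R) e)) \<longleftrightarrow> wf (lt {\<zero>} (at e))"
proof -
  have "(\<forall>n. (gideal (N n) \<and> N n \<subseteq> at e) \<and> N (Suc n) \<subset> N n) \<longleftrightarrow> (\<forall>n. (N (Suc n), N n) \<in> lt {\<zero>} (at e))"
    for N :: "nat \<Rightarrow> 'r set"
    using gidealD(3) by (auto simp: lt_def)
  then show ?thesis
    unfolding gr_artinian_def graded_submodule_piece_iff[OF e] wf_iff_no_infinite_down_chain by simp
qed

lemma gr_noetherian_piece_iff:
  assumes e: "e \<in> identities \<Gamma>"
  shows "gr_noetherian \<Gamma> R (submod (regular R) (piece \<Gamma> (regular R) e)) \<longleftrightarrow> wf ((lt {\<zero>} (at e))\<inverse>)"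
proof -
  have "(\<forall>n. (gideal (N n) \<and> N n \<subseteq> at e) \<and> N n \<subset> N (Suc n)) \<longleftrightarrow>
      (\<forall>n. (N (Suc n), N n) \<in> (lt {\<zero>} (at e))\<inverse>)" for N :: "nat \<Rightarrow> 'r set"
    using gidealD(3) by (auto simp: lt_def)
  then show ?thesis
    unfolding gr_noetherian_def graded_submodule_piece_iff[OF e] wf_iff_no_infinite_down_chain by simp
qed

lemma right_obj_artinian_iff:
  "right_obj_artinian \<Gamma> R \<longleftrightarrow> (\<forall>e\<in>identities \<Gamma>. wf (lt {\<zero>} (at e)))"
  by (simp add: right_obj_artinian_def obj_artinian_def gr_artinian_piece_iff)

lemma right_obj_noetherian_iff:
  "right_obj_noetherian \<Gamma> R \<longleftrightarrow> (\<forall>e\<in>identities \<Gamma>. wf ((lt {\<zero>} (at e))\<inverse>))"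
  by (simp add: right_obj_noetherian_def obj_noetherian_def gr_noetherian_piece_iff)

lemma gr_semilocal_iff: "gr_semilocal \<Gamma> R \<longleftrightarrow> soc_over (gr_rad \<Gamma> R) = carrier R"
  unfolding gr_semilocal_def
  by (rule gr_semisimple_quotient_iff[OF gideal_rad]) (rule rad_left_ideal)

section \<open>Powers of the radical\<close>

abbreviation radpow :: "nat \<Rightarrow> 'r set" where
  "radpow n \<equiv> ideal_power R (gr_rad \<Gamma> R) n"

lemma gideal_radpow: "gideal (radpow n)"
  by (rule gideal_ideal_power[OF gideal_rad])

lemma gideal_radpow_at: "e \<in> identities \<Gamma> \<Longrightarrow> gideal (radpow n \<inter> at e)"
  by (rule gideal_Int[OF gideal_radpow gideal_at])

lemma radpow_mult: "x \<in> radpow n \<Longrightarrow> j \<in> gr_rad \<Gamma> R \<Longrightarrow> x \<otimes> j \<in> radpow (Suc n)"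
  by (rule ideal_power_mult[OF gideal_rad rad_left_ideal])

lemma radpow_at_mult:
  assumes "e \<in> identities \<Gamma>" "x \<in> radpow n \<inter> at e" "j \<in> gr_rad \<Gamma> R"
  shows "x \<otimes> j \<in> radpow (Suc n) \<inter> at e"
  using assms radpow_mult gidealD(7)[OF gideal_at[OF assms(1)]] rad_closed by blast

lemma right_obj_nilpotent_iff:
  "right_obj_nilpotent \<Gamma> R (gr_rad \<Gamma> R) \<longleftrightarrow> (\<forall>e\<in>identities \<Gamma>. \<exists>n\<ge>1. radpow n \<inter> at e = {\<zero>})"
  by (simp add: right_obj_nilpotent_def loc_one_image[OF gideal_radpow])

text \<open>Either chain condition restricts to the layers, where it yields a composition series;
  the series of the n layers are concatenated.\<close>

lemma finite_length_at:
  assumes e: "e \<in> identities \<Gamma>" and n: "radpow n \<inter> at e = {\<zero>}"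
    and semi: "soc_over (gr_rad \<Gamma> R) = carrier R"
    and chain: "wf (lt {\<zero>} (at e)) \<or> wf ((lt {\<zero>} (at e))\<inverse>)"
  shows "cover\<^sup>*\<^sup>* {\<zero>} (at e)"
proof -
  let ?P = "\<lambda>n. radpow n \<inter> at e"
  have step: "cover\<^sup>*\<^sup>* (?P (Suc k)) (?P k)" for k
  proof -
    have "?P (Suc k) \<subseteq> ?P k" using ideal_power_antimono[OF gideal_rad, of k "Suc k"] by auto
    then have ss: "semisimple (?P (Suc k)) (?P k)"
      by (rule semisimple_layer[OF semi gideal_rad gideal_radpow_at[OF e] gideal_radpow_at[OF e] _
            radpow_at_mult[OF e]])
    have sub: "lt (?P (Suc k)) (?P k) \<subseteq> lt {\<zero>} (at e)"
      using gidealD(3)[OF gideal_radpow_at[OF e]] by (intro lt_mono) auto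
    show ?thesis
      using chain
    proof
      assume "wf (lt {\<zero>} (at e))"
      then show ?thesis using finite_length_if_dcc[OF ss wf_subset[OF _ sub]] by blast
    next
      assume "wf ((lt {\<zero>} (at e))\<inverse>)"
      moreover have "(lt (?P (Suc k)) (?P k))\<inverse> \<subseteq> (lt {\<zero>} (at e))\<inverse>" using sub by auto
      ultimately show ?thesis using finite_length_if_acc[OF ss wf_subset] by blast
    qed
  qed
  have "cover\<^sup>*\<^sup>* (?P k) (?P 0)" for k
  proof (induction k)
    case (Suc k)
    then show ?case using step[of k] by (rule rtranclp_trans[rotated])
  qed simp
  \<comment> \<open>\<open>radpow 0\<close> is R, so the filtration starts at R(e) itself.\<close>
  from this[of n] show ?thesis using n gidealD(2)[OF gideal_at[OF e]] by (simp add: Int_absorb1)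
qed

text \<open>Either condition yields a composition series of every R(e), and such a series implies
  the other.\<close>

lemma artinian_iff_noetherian:
  assumes nil: "right_obj_nilpotent \<Gamma> R (gr_rad \<Gamma> R)" and semi: "gr_semilocal \<Gamma> R"
  shows "right_obj_artinian \<Gamma> R \<longleftrightarrow> right_obj_noetherian \<Gamma> R"
proof -
  have "wf (lt {\<zero>} (at e)) \<longleftrightarrow> wf ((lt {\<zero>} (at e))\<inverse>)" if e: "e \<in> identities \<Gamma>" for e
  proof -
    obtain n where n: "radpow n \<inter> at e = {\<zero>}"
      using nil e by (auto simp: right_obj_nilpotent_iff)
    show ?thesis
      using finite_length_at[OF e n] finite_length_wf[of "{\<zero>}" "at e"] semi gr_semilocal_iff by blast
  qed
  then show ?thesis by (simp add: right_obj_artinian_iff right_obj_noetherian_iff)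
qed

lemma gr_semilocal_if_artinian: "right_obj_artinian \<Gamma> R \<Longrightarrow> gr_semilocal \<Gamma> R"
  by (simp add: gr_semilocal_iff right_obj_artinian_iff soc_over_rad_eq_carrier)

lemma obj_finitely_generated_if_noetherian:
  assumes noe: "right_obj_noetherian \<Gamma> R" and B: "gideal B"
  shows "obj_finitely_generated \<Gamma> R (submod (regular R) B)"
  unfolding obj_finitely_generated_iff[OF B]
proof
  fix e assume e: "e \<in> identities \<Gamma>"
  have "(lt {\<zero>} (B \<inter> at e))\<inverse> \<subseteq> (lt {\<zero>} (at e))\<inverse>"
    unfolding converse_mono by (rule lt_mono) auto
  then have "wf ((lt {\<zero>} (B \<inter> at e))\<inverse>)"
    using noe e wf_subset unfolding right_obj_noetherian_iff by blast
  then show "fgen (B \<inter> at e)" by (rule fgen_if_acc[OF gideal_Int[OF B gideal_at[OF e]]])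
qed

lemma radpow_stable:
  assumes art: "right_obj_artinian \<Gamma> R" and e: "e \<in> identities \<Gamma>"
  obtains n where "\<And>m. m \<ge> n \<Longrightarrow> radpow m \<inter> at e = radpow n \<inter> at e"
proof -
  have wf: "wf (lt {\<zero>} (at e))" using art e by (simp add: right_obj_artinian_iff)
  let ?Q = "range (\<lambda>n. radpow n \<inter> at e)"
  have "radpow 0 \<inter> at e \<in> ?Q" by blast
  obtain K where K: "K \<in> ?Q" and min: "\<And>E. (E, K) \<in> lt {\<zero>} (at e) \<Longrightarrow> E \<notin> ?Q"
    by (rule wfE_min[OF wf \<open>radpow 0 \<inter> at e \<in> ?Q\<close>]) (rule that)
  obtain n where n: "K = radpow n \<inter> at e" using K by blast
  have "radpow m \<inter> at e = radpow n \<inter> at e" if "m \<ge> n" for m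
  proof (rule ccontr)
    assume ne: "radpow m \<inter> at e \<noteq> radpow n \<inter> at e"
    have "radpow m \<subseteq> radpow n" by (rule ideal_power_antimono[OF gideal_rad that])
    then have "(radpow m \<inter> at e, K) \<in> lt {\<zero>} (at e)"
      using ne n gideal_radpow_at[OF e] gidealD(3)[OF gideal_radpow_at[OF e]] by (auto simp: lt_def)
    then show False using min by blast
  qed
  then show ?thesis by (rule that)
qed

lemma nilpotent_if_obj_finitely_generated:
  assumes art: "right_obj_artinian \<Gamma> R" and k: "k \<ge> 1"
    and fg: "obj_finitely_generated \<Gamma> R (submod (regular R) (radpow k))"
  shows "right_obj_nilpotent \<Gamma> R (gr_rad \<Gamma> R)"
  unfolding right_obj_nilpotent_iff
proof
  have f1: "fgen (radpow k \<inter> at e)" if "e \<in> identities \<Gamma>" for e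
    using fg that obj_finitely_generated_iff[OF gideal_radpow] by blast
  \<comment> \<open>Finite generation at each object passes from J^k to its powers, so it is
    available for exponents that are multiples of k.\<close>
  have f: "\<forall>e\<in>identities \<Gamma>. fgen (radpow (m * k) \<inter> at e)" if "m \<ge> 1" for m
    using that
  proof (induction m rule: nat_induct_at_least)
    case base
    then show ?case using f1 by simp
  next
    case (Suc m)
    have "m * k \<ge> 1" using Suc(1) k by simp
    then have eq: "radpow (Suc m * k) = ideal_prod R (radpow (m * k)) (radpow k)"
      using ideal_power_add[OF gideal_rad _ k, of "m * k"] by (simp add: add.commute)
    show ?case unfolding eq
    proof
      fix e assume e: "e \<in> identities \<Gamma>"
      show "fgen (ideal_prod R (radpow (m * k)) (radpow k) \<inter> at e)"
        by (rule fgen_ideal_prod[OF gideal_radpow gideal_radpow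
              ideal_power_left[OF gideal_rad rad_left_ideal] bspec[OF Suc(2) e] f1 e])
    qed
  qed
  fix e assume e: "e \<in> identities \<Gamma>"
  obtain n where n: "\<And>m. m \<ge> n \<Longrightarrow> radpow m \<inter> at e = radpow n \<inter> at e"
    using radpow_stable[OF art e] by blast
  \<comment> \<open>A positive multiple of k beyond the point of stabilisation; n itself may be
    0.\<close>
  let ?m = "Suc n * k"
  have m: "?m \<ge> 1" "?m \<ge> n" using k by (simp_all add: trans_le_add1 trans_le_add2)
  let ?N = "radpow ?m \<inter> at e"
  \<comment> \<open>This equality is the condition N J = N for Nakayama's lemma.\<close>
  have stable: "radpow (Suc ?m) \<inter> at e = ?N" using n[of ?m] n[of "Suc ?m"] m(2) by simp
  have "?N = {\<zero>}"
  proof (rule nakayama)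
    show "fgen ?N" using f[of "Suc n"] e by simp
    fix T assume T: "gideal T" "\<And>x j. x \<in> ?N \<Longrightarrow> j \<in> gr_rad \<Gamma> R \<Longrightarrow> x \<otimes> j \<in> T"
    have "ideal_prod R (radpow ?m) (gr_rad \<Gamma> R) \<inter> at e \<subseteq> T"
      by (rule ideal_prod_at_le[OF gideal_radpow gideal_rad T(1) e T(2)])
    then show "?N \<subseteq> T" using stable ideal_power_Suc[OF m(1)] by simp
  qed
  then show "\<exists>n\<ge>1. radpow n \<inter> at e = {\<zero>}" using m(1) by blast
qed

lemma Inter_radpow_eq_zero_if_nilpotent:
  assumes "right_obj_nilpotent \<Gamma> R (gr_rad \<Gamma> R)"
  shows "(\<Inter>n\<in>{1..}. radpow n) = {\<zero>}"
proof -
  let ?I = "\<Inter>n\<in>{1..}. radpow n"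
  have I: "gideal ?I" by (rule gideal_Inter) (use gideal_radpow in auto)
  have "?I \<inter> at e \<subseteq> {\<zero>}" if e: "e \<in> identities \<Gamma>" for e
  proof -
    obtain n where "n \<ge> 1" "radpow n \<inter> at e = {\<zero>}"
      using assms e unfolding right_obj_nilpotent_iff by blast
    then show ?thesis by auto
  qed
  then have "?I \<subseteq> {\<zero>}" by (rule gideal_le_of_at[OF I gideal_zero])
  then show ?thesis using gidealD(3)[OF I] by blast
qed

lemma nilpotent_if_Inter_radpow_eq_zero:
  assumes art: "right_obj_artinian \<Gamma> R" and zero: "(\<Inter>n\<in>{1..}. radpow n) = {\<zero>}"
  shows "right_obj_nilpotent \<Gamma> R (gr_rad \<Gamma> R)"
  unfolding right_obj_nilpotent_iff
proof
  fix e assume e: "e \<in> identities \<Gamma>"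
  obtain n where n: "\<And>m. m \<ge> n \<Longrightarrow> radpow m \<inter> at e = radpow n \<inter> at e"
    using radpow_stable[OF art e] by blast
  \<comment> \<open>The stable value lies in every power. \<open>Suc n\<close> in place of n gives
    the positive exponent that nilpotency asks for.\<close>
  have "radpow (Suc n) \<inter> at e \<subseteq> radpow m" for m
  proof (cases "m \<le> Suc n")
    case True
    then show ?thesis using ideal_power_antimono[OF gideal_rad] by blast
  next
    case False
    then have "radpow m \<inter> at e = radpow (Suc n) \<inter> at e" using n[of m] n[of "Suc n"] by simp
    then show ?thesis by blast
  qed
  then have "radpow (Suc n) \<inter> at e \<subseteq> {\<zero>}" unfolding zero[symmetric] by blast
  then have "radpow (Suc n) \<inter> at e = {\<zero>}" using gidealD(3)[OF gideal_radpow_at[OF e]] by blast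
  then show "\<exists>n\<ge>1. radpow n \<inter> at e = {\<zero>}" by (intro exI[of _ "Suc n"]) simp
qed

section \<open>The socle series of R\<close>

abbreviation soc_iter :: "nat \<Rightarrow> 'r set" where
  "soc_iter n \<equiv> gr_soc_iter \<Gamma> R (regular R) n"

lemma soc_iter_Suc: "soc_iter (Suc n) = soc_over (soc_iter n)"
  by (rule gr_soc_iter_Suc[OF gideal_gr_soc_iter])

lemma soc_iter_mono: "m \<le> n \<Longrightarrow> soc_iter m \<subseteq> soc_iter n"
proof (induction n rule: dec_induct)
  case (step n)
  then show ?case using soc_over_upper(1)[OF gideal_gr_soc_iter, of n] soc_iter_Suc[of n] by blast
qed simp

lemma gideal_soc_infinity: "gideal (gr_soc_infinity \<Gamma> R (regular R))"
  unfolding gr_soc_infinity_def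
proof (rule gideal_chain_Union)
  fix A B assume "A \<in> range soc_iter" "B \<in> range soc_iter"
  then obtain m n where "A = soc_iter m" "B = soc_iter n" by blast
  then show "A \<subseteq> B \<or> B \<subseteq> A" using soc_iter_mono[of m n] soc_iter_mono[of n m] by (cases "m \<le> n") auto
qed (use gideal_gr_soc_iter in auto)

text \<open>B need not contain A, so A + B is used to form an interval; J carries it into A as
  well.\<close>

lemma le_soc_over:
  assumes semi: "soc_over (gr_rad \<Gamma> R) = carrier R" and A: "gideal A" and B: "gideal B"
    and BJ: "\<And>x j. x \<in> B \<Longrightarrow> j \<in> gr_rad \<Gamma> R \<Longrightarrow> x \<otimes> j \<in> A"
  shows "B \<subseteq> soc_over A"
proof -
  have "semisimple A (A <+>\<^bsub>R\<^esub> B)"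
  proof (rule semisimple_layer[OF semi gideal_rad A gideal_add[OF A B] add_upper1[OF A B]])
    fix x j assume x: "x \<in> A <+>\<^bsub>R\<^esub> B" and j: "j \<in> gr_rad \<Gamma> R"
    obtain a b where ab: "a \<in> A" "b \<in> B" "x = a \<oplus> b" using x mem_set_add_iff by blast
    have c: "a \<in> carrier R" "b \<in> carrier R" "j \<in> carrier R"
      using ab gidealD(2)[OF A] gidealD(2)[OF B] rad_closed[OF j] by auto
    have "x \<otimes> j = a \<otimes> j \<oplus> b \<otimes> j" using ab(3) c left_distrib by simp
    then show "x \<otimes> j \<in> A"
      using gidealD(4)[OF A gidealD(7)[OF A ab(1) c(3)] BJ[OF ab(2) j]] by simp
  qed
  then show ?thesis using semisimple_le_soc_over add_upper2[OF A B] by blast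
qed

lemma soc_infinity_if_nilpotent:
  assumes semi: "gr_semilocal \<Gamma> R" and nil: "right_obj_nilpotent \<Gamma> R (gr_rad \<Gamma> R)"
  shows "gr_soc_infinity \<Gamma> R (regular R) = carrier R"
proof -
  have semi': "soc_over (gr_rad \<Gamma> R) = carrier R" using semi gr_semilocal_iff by simp
  have "at e \<subseteq> gr_soc_infinity \<Gamma> R (regular R)" if e: "e \<in> identities \<Gamma>" for e
  proof -
    obtain n where n: "radpow n \<inter> at e = {\<zero>}" using nil e by (auto simp: right_obj_nilpotent_iff)
    \<comment> \<open>Falling powers are matched with rising socles; at k = n the power is
      \<open>radpow 0\<close>, which leaves all of R(e).\<close>
    have "radpow (n - k) \<inter> at e \<subseteq> soc_iter k" if "k \<le> n" for k
      using that
    proof (induction k)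
      case 0
      then show ?case using n by simp
    next
      case (Suc k)
      have "Suc (n - Suc k) = n - k" using Suc.prems by simp
      then have "x \<otimes> j \<in> soc_iter k" if "x \<in> radpow (n - Suc k) \<inter> at e" "j \<in> gr_rad \<Gamma> R" for x j
        using radpow_at_mult[OF e that] Suc.IH Suc.prems by auto
      then show ?case
        unfolding soc_iter_Suc by (rule le_soc_over[OF semi' gideal_gr_soc_iter gideal_radpow_at[OF e]])
    qed
    from this[of n] have "at e \<subseteq> soc_iter n"
      using gidealD(2)[OF gideal_at[OF e]] by (simp add: Int_absorb1)
    then show ?thesis by (auto simp: gr_soc_infinity_def)
  qed
  then have "carrier R \<subseteq> gr_soc_infinity \<Gamma> R (regular R)"
    by (intro gideal_le_of_at[OF gideal_carrier gideal_soc_infinity] le_infI2)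
  then show ?thesis using gidealD(2)[OF gideal_soc_infinity] by blast
qed

text \<open>Each factor from J lowers the socle index by one: a factor from J^m leads down to
  \<open>Suc k\<close>, and the last factor from J to k.\<close>

lemma soc_iter_radpow:
  assumes "m \<ge> 1" "x \<in> soc_iter (k + m)" "j \<in> radpow m"
  shows "x \<otimes> j \<in> soc_iter k"
  using assms
proof (induction m arbitrary: x j k rule: nat_induct_at_least)
  case base
  then show ?case
    using soc_over_rad[OF gideal_gr_soc_iter] by (simp add: soc_iter_Suc del: gr_soc_iter.simps)
next
  case (Suc m)
  note S = gideal_gr_soc_iter
  have x: "x \<in> carrier R" using Suc.prems(1) gidealD(2)[OF S] by blast
  have "ideal_prod R (radpow m) (gr_rad \<Gamma> R) \<subseteq> {j \<in> carrier R. x \<otimes> j \<in> soc_iter k}"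
  proof (rule ideal_prod_le)
    show "additive_subgroup {j \<in> carrier R. x \<otimes> j \<in> soc_iter k} R"
      by (rule vimage_additive_subgroup[OF gidealD(1)[OF S]]) (simp_all add: x mult_closed right_distrib)
    fix u v assume uv: "u \<in> radpow m" "v \<in> gr_rad \<Gamma> R"
    have c: "u \<in> carrier R" "v \<in> carrier R" using uv gidealD(2)[OF gideal_radpow] rad_closed by auto
    have "x \<otimes> u \<in> soc_iter (Suc k)" by (rule Suc.IH) (use Suc.prems(1) uv(1) in \<open>simp_all del: gr_soc_iter.simps\<close>)
    then have "(x \<otimes> u) \<otimes> v \<in> soc_iter k" using soc_over_rad[OF S _ uv(2)] soc_iter_Suc by blast
    then show "u \<otimes> v \<in> {j \<in> carrier R. x \<otimes> j \<in> soc_iter k}" using x c mult_assoc mult_closed by simp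
  qed
  then show ?case using Suc.prems(2) ideal_power_Suc[OF Suc.hyps] by auto
qed

lemma nilpotent_if_soc_infinity:
  assumes "gr_soc_infinity \<Gamma> R (regular R) = carrier R"
  shows "right_obj_nilpotent \<Gamma> R (gr_rad \<Gamma> R)"
  unfolding right_obj_nilpotent_iff
proof
  fix e assume e: "e \<in> identities \<Gamma>"
  obtain n where "loc_one R e \<in> soc_iter n"
    using assms loc_one_closed[OF e] by (auto simp: gr_soc_infinity_def)
  \<comment> \<open>The index is raised to have a positive exponent, and written as
    \<open>0 + Suc n\<close> so that \<open>soc_iter_radpow\<close> lands in
    \<open>soc_iter 0\<close>, the zero ideal.\<close>
  then have o: "loc_one R e \<in> soc_iter (0 + Suc n)" using soc_iter_mono[of n "Suc n"] by auto
  have "(\<lambda>x. loc_one R e \<otimes> x) ` radpow (Suc n) \<subseteq> {\<zero>}"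
    using soc_iter_radpow[OF _ o] by auto
  then have "radpow (Suc n) \<inter> at e \<subseteq> {\<zero>}" using loc_one_image[OF gideal_radpow e] by simp
  then have "radpow (Suc n) \<inter> at e = {\<zero>}" using gidealD(3)[OF gideal_radpow_at[OF e]] by blast
  then show "\<exists>n\<ge>1. radpow n \<inter> at e = {\<zero>}" by (intro exI[of _ "Suc n"]) simp
qed

end

theorem theorem5p1:
  fixes \<Gamma> :: "'g groupoid" and R :: "('r, 'g) graded" and J :: "'r set"
  assumes "graded_ring \<Gamma> R"
    and "J = gr_rad \<Gamma> R"
  shows "all_equivalent
    [right_obj_artinian \<Gamma> R \<and> right_obj_noetherian \<Gamma> R,
     right_obj_artinian \<Gamma> R \<and> obj_finitely_generated \<Gamma> R (submod (regular R) J),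
     right_obj_artinian \<Gamma> R \<and>
       (\<exists>k\<ge>1. obj_finitely_generated \<Gamma> R (submod (regular R) (ideal_power R J k))),
     right_obj_artinian \<Gamma> R \<and> right_obj_nilpotent \<Gamma> R J,
     right_obj_artinian \<Gamma> R \<and> (\<Inter>n\<in>{1..}. ideal_power R J n) = {\<zero>\<^bsub>R\<^esub>},
     right_obj_artinian \<Gamma> R \<and> gr_soc_infinity \<Gamma> R (regular R) = carrier R,
     gr_semilocal \<Gamma> R \<and> right_obj_noetherian \<Gamma> R \<and> right_obj_nilpotent \<Gamma> R J]"
proof -
  interpret graded_ring \<Gamma> R by fact
  let ?art = "right_obj_artinian \<Gamma> R" and ?noe = "right_obj_noetherian \<Gamma> R"
    and ?nil = "right_obj_nilpotent \<Gamma> R J"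
    and ?fg = "\<lambda>k. obj_finitely_generated \<Gamma> R (submod (regular R) (ideal_power R J k))"
  have art_noe: "?noe" if ?art ?nil
    using that artinian_iff_noetherian gr_semilocal_if_artinian assms(2) by simp
  have fg: "?fg k" if ?noe for k
    unfolding assms(2) by (rule obj_finitely_generated_if_noetherian[OF that gideal_radpow])
  have nil: ?nil if ?art "\<exists>k\<ge>1. ?fg k"
    using that nilpotent_if_obj_finitely_generated unfolding assms(2) by blast
  \<comment> \<open>Turns (2) into the case k = 1 of (3).\<close>
  have J: "ideal_power R J 1 = J" by simp
  have "?art \<and> ?noe \<longleftrightarrow> ?art \<and> ?nil" using art_noe fg[of 1] nil by blast
  moreover have "?art \<and> obj_finitely_generated \<Gamma> R (submod (regular R) J) \<longleftrightarrow> ?art \<and> ?nil"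
    using art_noe fg[of 1] nil J by (metis order_refl)
  moreover have "?art \<and> (\<exists>k\<ge>1. ?fg k) \<longleftrightarrow> ?art \<and> ?nil" using art_noe fg[of 1] nil by blast
  moreover have "?art \<and> (\<Inter>n\<in>{1..}. ideal_power R J n) = {\<zero>\<^bsub>R\<^esub>} \<longleftrightarrow> ?art \<and> ?nil"
    using Inter_radpow_eq_zero_if_nilpotent nilpotent_if_Inter_radpow_eq_zero unfolding assms(2) by blast
  moreover have "?art \<and> gr_soc_infinity \<Gamma> R (regular R) = carrier R \<longleftrightarrow> ?art \<and> ?nil"
    using soc_infinity_if_nilpotent nilpotent_if_soc_infinity gr_semilocal_if_artinian
    unfolding assms(2) by blast
  \<comment> \<open>Gr-semilocality is automatic in the artinian case, and under nilpotency it makes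
    the two chain conditions interchangeable.\<close>
  moreover have "gr_semilocal \<Gamma> R \<and> ?noe \<and> ?nil \<longleftrightarrow> ?art \<and> ?nil"
    using artinian_iff_noetherian gr_semilocal_if_artinian unfolding assms(2) by blast
  ultimately show ?thesis by (simp add: all_equivalent_def)
qed

end
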